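(* Let $\Omega$ be a bounded domain in $\mathbb R^2$ and let $\partial\Omega\cap B_{r_0}$ consist of two $C^{2}$-curves $\sigma_1$ and $\sigma_2$ intersecting at the origin at an angle $\mu\pi$, for some constant $\mu\in (0,2)$ and some $r_0>0$. Suppose $u \in C^{2}(\Omega)$ is a solution of $\Delta u=e^{2u}$ in $\Omega$ with $u=\infty$ on $\partial\Omega$. Then, for any $x\in\Omega\cap B_\delta$, $$\left|u(x)-f_\mu(x)\right|\le C d(x),$$ where $d(x)$ is the distance from $x$ to $\partial\Omega$, $f_\mu$ is the function defined in the context (by one formula for $\mu\in(0,1]$ and by another for $\mu\in(1,2)$), and $\delta$ and $C$ are positive constants depending only on $\mu$, $r_0$ and the $C^2$-norms of $\sigma_1$ and $\sigma_2$.
   Context: $B_r$ denotes the open disc of radius $r$ centered at the origin of $\mathbb R^2$. The condition $u=\infty$ on $\partial\Omega$ means $u(x)\to\infty$ as $x\in\Omega$ approaches $\partial\Omega$. Meaning of the conic singularity: the origin is a point of $\partial\Omega$ and is an end point of both $\sigma_1$ and $\sigma_2$ (which are $C^2$ up to the origin). Let $l_1,l_2$ be the rays starting from the origin and tangent at the origin to $\sigma_1,\sigma_2$, respectively. The rays divide $\mathbb R^2$ into two infinite cones, and one of them is the tangent cone of $\Omega$ at the origin; it has opening angle $\mu\pi$. After a rotation it is, in polar coordinates, $V_\mu=\{(r,\theta): 0<r<\infty,\ 0<\theta<\mu\pi\}$, where $l_1$ corresponds to $\theta=0$ and $l_2$ to $\theta=\mu\pi$; it is characterized by: for every $\varepsilon>0$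 there is $\rho>0$ such that $\{(r,\theta): r\in(0,\rho),\ \theta\in(\varepsilon,\mu\pi-\varepsilon)\}\subset\Omega\cap B_\rho\subset\{(r,\theta): r\in(0,\rho),\ \theta\in(-\varepsilon,\mu\pi+\varepsilon)\}$. Let $d,d_1,d_2$ be the distances to $\partial\Omega,\sigma_1,\sigma_2$, respectively. The function $f_\mu$ is defined for $x\in\Omega$ sufficiently close to the origin as follows. If $\mu\in(0,1]$: $$f_\mu(x)=-\log\left(\mu|x|\sin\frac{\arcsin\frac{d(x)}{|x|}}{\mu}\right).$$ If $\mu\in(1,2)$: $$f_\mu(x)=\begin{cases}-\log\left(\mu|x|\sin\frac{\arcsin\frac{d_1(x)}{|x|}}{\mu}\right)&\text{if }d_1(x)<d_2(x),\\[2mm] -\log\left(\mu|x|\sin\frac{\theta}{\mu}\right)&\text{if }d_1(x)=d_2(x),\\[2mm] -\log\left(\mu|x|\sin\frac{\arcsin\frac{d_2(x)}{|x|}}{\mu}\right)&\text{if }d_1(x)>d_2(x),\end{cases}$$ where $\theta$ is the angle measured anticlockwise from the tangent line of $\sigma_1$ at the origin (the ray $l_1$) to the vector $\overrightarrow{Ox}$ from the origin $O$ to $x$. *)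

theory Defs
  imports "HOL-Analysis.Analysis"
begin

text \<open>The plane is modelled by the type \<^typ>\<open>complex\<close>, whose norm and inner product are those of
  the Euclidean plane.\<close>

definition C2_on :: "('a::euclidean_space \<Rightarrow> real) \<Rightarrow> 'a set \<Rightarrow> bool" where
  "C2_on u \<Omega> \<longleftrightarrow> (\<exists>(Du :: 'a \<Rightarrow> 'a \<Rightarrow>\<^sub>L real) (D2u :: 'a \<Rightarrow> 'a \<Rightarrow>\<^sub>L ('a \<Rightarrow>\<^sub>L real)).
     (\<forall>x\<in>\<Omega>. (u has_derivative blinfun_apply (Du x)) (at x)) \<and>
     (\<forall>x\<in>\<Omega>. (Du has_derivative blinfun_apply (D2u x)) (at x)) \<and>
     continuous_on \<Omega> D2u)"

definition laplacian :: "('a::euclidean_space \<Rightarrow> real) \<Rightarrow> 'a \<Rightarrow> real" where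
  "laplacian u x = (\<Sum>b\<in>Basis. (deriv ^^ 2) (\<lambda>t. u (x + t *\<^sub>R b)) 0)"

definition C2_with_derivs ::
  "real \<Rightarrow> (real \<Rightarrow> 'a::real_normed_vector) \<Rightarrow> (real \<Rightarrow> 'a) \<Rightarrow> (real \<Rightarrow> 'a) \<Rightarrow> bool" where
  "C2_with_derivs b g g' g'' \<longleftrightarrow>
     (\<forall>t\<in>{0..b}. (g has_vector_derivative g' t) (at t within {0..b})) \<and>
     (\<forall>t\<in>{0..b}. (g' has_vector_derivative g'' t) (at t within {0..b})) \<and>
     continuous_on {0..b} g''"

text \<open>A simple regular \<open>C\<^sup>2\<close> arc that starts at the origin, where its tangent ray has
  direction \<open>cis \<alpha>\<close>; it is \<open>C\<^sup>2\<close> up to both end points.\<close>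

definition C2_arc_from_origin :: "complex set \<Rightarrow> real \<Rightarrow> bool" where
  "C2_arc_from_origin \<sigma> \<alpha> \<longleftrightarrow>
     (\<exists>\<gamma> \<gamma>' \<gamma>''. arc \<gamma> \<and> path_image \<gamma> = \<sigma> \<and> pathstart \<gamma> = 0 \<and>
        C2_with_derivs 1 \<gamma> \<gamma>' \<gamma>'' \<and> (\<forall>t\<in>{0..1}. \<gamma>' t \<noteq> 0) \<and>
        (\<exists>c>0. \<gamma>' 0 = of_real c * cis \<alpha>))"

text \<open>The \<open>C\<^sup>2\<close>-norm of a curve is measured, as usual for portions of a boundary, by writing the
  curve near the origin as a graph over its tangent ray. The statement \<open>C2_norm_le \<sigma> \<alpha> N\<close> says that
  in the disc of radius \<open>1/N\<close> the curve is the graph of some \<open>\<phi>\<close> whose values and first two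
  derivatives are bounded by \<open>N\<close>. It is monotone in \<open>N\<close>, and every arc as above satisfies it for
  some \<open>N\<close> (lemma \<open>C2_norm_finite\<close> below). Bounds on the derivatives of an arc length
  parametrization would not do: they do not prevent the curve from turning around and passing the
  origin again at an arbitrarily small distance.\<close>

definition C2_norm_le :: "complex set \<Rightarrow> real \<Rightarrow> real \<Rightarrow> bool" where
  "C2_norm_le \<sigma> \<alpha> N \<longleftrightarrow> N > 0 \<and>
     (\<exists>\<phi> \<phi>' \<phi>'' :: real \<Rightarrow> real. C2_with_derivs (1/N) \<phi> \<phi>' \<phi>'' \<and> \<phi> 0 = 0 \<and> \<phi>' 0 = 0 \<and>
        (\<forall>t\<in>{0..1/N}. \<bar>\<phi> t\<bar> \<le> N \<and> \<bar>\<phi>' t\<bar> \<le> N \<and> \<bar>\<phi>'' t\<bar> \<le> N) \<and>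
        \<sigma> \<inter> ball 0 (1/N) = (\<lambda>t. Complex t (\<phi> t) * cis \<alpha>) ` {0..1/N} \<inter> ball 0 (1/N))"

definition sector :: "real \<Rightarrow> real \<Rightarrow> real \<Rightarrow> real \<Rightarrow> complex set" where
  "sector \<alpha> a b \<rho> = {rcis r (\<alpha> + \<theta>) | r \<theta>. 0 < r \<and> r < \<rho> \<and> a < \<theta> \<and> \<theta> < b}"

text \<open>The rays \<open>l\<^sub>1\<close> and \<open>l\<^sub>2\<close> have directions \<open>cis \<alpha>\<close> and \<open>cis (\<alpha> + \<mu> * pi)\<close>, so that \<open>\<alpha>\<close> is the
  rotation that carries \<open>V\<^sub>\<mu>\<close> to the tangent cone.\<close>

definition conic_singularity ::
  "complex set \<Rightarrow> complex set \<Rightarrow> complex set \<Rightarrow> real \<Rightarrow> real \<Rightarrow> real \<Rightarrow> bool" where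
  "conic_singularity \<Omega> \<sigma>\<^sub>1 \<sigma>\<^sub>2 \<alpha> \<mu> r\<^sub>0 \<longleftrightarrow>
     C2_arc_from_origin \<sigma>\<^sub>1 \<alpha> \<and> C2_arc_from_origin \<sigma>\<^sub>2 (\<alpha> + \<mu> * pi) \<and>
     frontier \<Omega> \<inter> ball 0 r\<^sub>0 = (\<sigma>\<^sub>1 \<union> \<sigma>\<^sub>2) \<inter> ball 0 r\<^sub>0 \<and>
     (\<forall>\<epsilon>>0. \<exists>\<rho>>0. sector \<alpha> \<epsilon> (\<mu> * pi - \<epsilon>) \<rho> \<subseteq> \<Omega> \<inter> ball 0 \<rho> \<and>
                 \<Omega> \<inter> ball 0 \<rho> \<subseteq> sector \<alpha> (- \<epsilon>) (\<mu> * pi + \<epsilon>) \<rho>)"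

definition f_corner ::
  "complex set \<Rightarrow> complex set \<Rightarrow> complex set \<Rightarrow> real \<Rightarrow> real \<Rightarrow> complex \<Rightarrow> real" where
  "f_corner \<Omega> \<sigma>\<^sub>1 \<sigma>\<^sub>2 \<alpha> \<mu> x =
     (let d = infdist x (frontier \<Omega>); d\<^sub>1 = infdist x \<sigma>\<^sub>1; d\<^sub>2 = infdist x \<sigma>\<^sub>2;
          \<theta> = Arg2pi (x * cis (- \<alpha>))
      in if \<mu> \<le> 1 then - ln (\<mu> * norm x * sin (arcsin (d / norm x) / \<mu>))
         else if d\<^sub>1 < d\<^sub>2 then - ln (\<mu> * norm x * sin (arcsin (d\<^sub>1 / norm x) / \<mu>))
         else if d\<^sub>1 = d\<^sub>2 then - ln (\<mu> * norm x * sin (\<theta> / \<mu>))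
         else - ln (\<mu> * norm x * sin (arcsin (d\<^sub>2 / norm x) / \<mu>)))"

lemma inverse_has_vector_derivative_within:
  fixes x x' \<tau> :: "real \<Rightarrow> real"
  assumes dx: "(x has_vector_derivative D) (at t within S)" and D: "D \<noteq> 0" and t: "t \<in> S"
    and inv: "\<And>s. s \<in> S \<Longrightarrow> \<tau> (x s) = s" and cont: "continuous_on (x ` S) \<tau>"
  shows "(\<tau> has_vector_derivative 1 / D) (at (x t) within x ` S)"
proof -
  have dx': "((\<lambda>s. (x s - x t) / (s - t)) \<longlongrightarrow> D) (at t within S)"
    using dx by (simp add: has_real_derivative_iff_has_vector_derivative[symmetric] has_field_derivative_iff)
  have "(\<tau> \<longlongrightarrow> \<tau> (x t)) (at (x t) within x ` S)"
    using cont t by (auto simp: continuous_on_def)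
  moreover have "eventually (\<lambda>v. \<tau> v \<in> S \<and> \<tau> v \<noteq> \<tau> (x t)) (at (x t) within x ` S)"
    unfolding eventually_at_filter using inv t by (intro always_eventually) auto
  ultimately have "filterlim \<tau> (at t within S) (at (x t) within x ` S)"
    using inv[OF t] by (simp add: filterlim_at)
  from filterlim_compose[OF dx' this]
  have "((\<lambda>v. (x (\<tau> v) - x t) / (\<tau> v - t)) \<longlongrightarrow> D) (at (x t) within x ` S)" .
  then have "((\<lambda>v. 1 / ((x (\<tau> v) - x t) / (\<tau> v - t))) \<longlongrightarrow> 1 / D) (at (x t) within x ` S)"
    using D by (intro tendsto_intros)
  moreover have "eventually (\<lambda>v. 1 / ((x (\<tau> v) - x t) / (\<tau> v - t)) = (\<tau> v - \<tau> (x t)) / (v - x t))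
      (at (x t) within x ` S)"
    unfolding eventually_at_filter using inv t by (intro always_eventually) auto
  ultimately have "((\<lambda>v. (\<tau> v - \<tau> (x t)) / (v - x t)) \<longlongrightarrow> 1 / D) (at (x t) within x ` S)"
    by (rule Lim_transform_eventually)
  then show ?thesis
    by (simp add: has_real_derivative_iff_has_vector_derivative[symmetric] has_field_derivative_iff)
qed

lemma C2_norm_finite:
  assumes "C2_arc_from_origin \<sigma> \<alpha>"
  shows "\<exists>N. C2_norm_le \<sigma> \<alpha> N"
proof -
  obtain \<gamma> \<gamma>' \<gamma>'' c where arc: "arc \<gamma>" and im: "path_image \<gamma> = \<sigma>" and start: "pathstart \<gamma> = 0"
    and C2: "C2_with_derivs 1 \<gamma> \<gamma>' \<gamma>''" and c: "c > 0" "\<gamma>' 0 = of_real c * cis \<alpha>"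
    using assms unfolding C2_arc_from_origin_def by blast
  define x where "x t = Re (\<gamma> t * cis (- \<alpha>))" for t
  define x' where "x' t = Re (\<gamma>' t * cis (- \<alpha>))" for t
  define x'' where "x'' t = Re (\<gamma>'' t * cis (- \<alpha>))" for t
  define y where "y t = Im (\<gamma> t * cis (- \<alpha>))" for t
  define y' where "y' t = Im (\<gamma>' t * cis (- \<alpha>))" for t
  define y'' where "y'' t = Im (\<gamma>'' t * cis (- \<alpha>))" for t
  note defs = x_def x'_def x''_def y_def y'_def y''_def
  have d1: "(\<gamma> has_vector_derivative \<gamma>' t) (at t within {0..1})"
    and d2: "(\<gamma>' has_vector_derivative \<gamma>'' t) (at t within {0..1})" if "t \<in> {0..1}" for t
    using C2 that by (auto simp: C2_with_derivs_def)
  have c2: "continuous_on {0..1} \<gamma>''" using C2 by (simp add: C2_with_derivs_def)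
  have Re_d: "((\<lambda>t. Re (f t * cis (- \<alpha>))) has_vector_derivative Re (f' * cis (- \<alpha>))) (at t within S)"
    and Im_d: "((\<lambda>t. Im (f t * cis (- \<alpha>))) has_vector_derivative Im (f' * cis (- \<alpha>))) (at t within S)"
    if "(f has_vector_derivative f') (at t within S)" for f f' t S
    using bounded_linear.has_vector_derivative[OF bounded_linear_Re
        bounded_linear.has_vector_derivative[OF bounded_linear_mult_left that]]
      bounded_linear.has_vector_derivative[OF bounded_linear_Im
        bounded_linear.has_vector_derivative[OF bounded_linear_mult_left that]]
    by blast+
  have dx: "(x has_vector_derivative x' t) (at t within {0..1})"
    and dx': "(x' has_vector_derivative x'' t) (at t within {0..1})"
    and dy: "(y has_vector_derivative y' t) (at t within {0..1})"
    and dy': "(y' has_vector_derivative y'' t) (at t within {0..1})" if "t \<in> {0..1}" for t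
    using Re_d[OF d1[OF that]] Re_d[OF d2[OF that]] Im_d[OF d1[OF that]] Im_d[OF d2[OF that]]
    unfolding defs by auto
  have contx: "continuous_on {0..1} x" and contx': "continuous_on {0..1} x'"
    and conty: "continuous_on {0..1} y" and conty': "continuous_on {0..1} y'"
    by (rule continuous_on_vector_derivative, erule dx dx' dy dy')+
  have contx'': "continuous_on {0..1} x''" and conty'': "continuous_on {0..1} y''"
    using c2 unfolding defs by (auto intro!: continuous_intros)
  have g0: "\<gamma> 0 = 0" using start by (simp add: pathstart_def)
  have x0: "x 0 = 0" "y 0 = 0" by (simp_all add: defs g0)
  have "\<gamma>' 0 * cis (- \<alpha>) = of_real c" using c(2) by (simp add: mult.assoc cis_mult)
  then have x'0: "x' 0 = c" "y' 0 = 0" by (simp_all add: defs)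
  obtain e where e: "e > 0" "\<And>t. t \<in> {0..1} \<Longrightarrow> dist t 0 < e \<Longrightarrow> dist (x' t) (x' 0) < c"
    using contx'[unfolded continuous_on_iff, rule_format, of 0 c] c(1) by auto
  define s where "s = min 1 (e / 2)"
  have s: "0 < s" "s \<le> 1" "s < e" using e(1) by (auto simp: s_def)
  have x'pos: "x' t > 0" if "t \<in> {0..s}" for t
    using e(2)[of t] that s x'0 by (auto simp: dist_real_def)
  have sub: "{0..s} \<subseteq> {0..1}" using s by auto
  have mono: "x a < x b" if "a < b" "a \<in> {0..s}" "b \<in> {0..s}" for a b
  proof (rule DERIV_pos_imp_increasing_open[OF that(1)])
    fix t assume t: "a < t" "t < b"
    then have "t \<in> {0<..<1}" using that s by auto
    then have "(x has_vector_derivative x' t) (at t)"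
      using dx[of t] at_within_Icc_at[of 0 t 1] by auto
    then show "\<exists>y. (x has_real_derivative y) (at t) \<and> y > 0"
      using x'pos[of t] t that by (auto simp: has_real_derivative_iff_has_vector_derivative)
  next
    show "continuous_on {a..b} x"
      using contx by (rule continuous_on_subset) (use that s in auto)
  qed
  have inj: "inj_on x {0..s}"
  proof (rule inj_onI)
    fix a b assume "a \<in> {0..s}" "b \<in> {0..s}" "x a = x b"
    then show "a = b" using mono[of a b] mono[of b a] by (cases a b rule: linorder_cases) auto
  qed
  define X where "X = x s"
  have X: "X > 0" using mono[of 0 s] s x0 by (auto simp: X_def)
  have contxs: "continuous_on {0..s} x" using contx sub by (rule continuous_on_subset)
  have img: "x ` {0..s} = {0..X}"
  proof
    show "x ` {0..s} \<subseteq> {0..X}"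
    proof
      fix v assume "v \<in> x ` {0..s}"
      then obtain t where t: "t \<in> {0..s}" "v = x t" by auto
      have "x 0 \<le> x t" using mono[of 0 t] t by (cases "t = 0") auto
      moreover have "x t \<le> x s" using mono[of t s] t by (cases "t = s") auto
      ultimately show "v \<in> {0..X}" using t x0 by (auto simp: X_def)
    qed
    show "{0..X} \<subseteq> x ` {0..s}"
    proof
      fix v assume "v \<in> {0..X}"
      then obtain t where "0 \<le> t" "t \<le> s" "x t = v"
        using IVT'[of x 0 v s] x0 s contxs by (auto simp: X_def)
      then show "v \<in> x ` {0..s}" by auto
    qed
  qed
  define \<tau> where "\<tau> = the_inv_into {0..s} x"
  have \<tau>x: "\<tau> (x t) = t" if "t \<in> {0..s}" for t
    using the_inv_into_f_f[OF inj that] by (simp add: \<tau>_def)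
  have contT: "continuous_on {0..X} \<tau>"
    using continuous_on_inv_into[OF contxs _ inj] img by (simp add: \<tau>_def)
  have \<tau>S: "\<tau> v \<in> {0..s}" and x\<tau>: "x (\<tau> v) = v" if "v \<in> {0..X}" for v
    using that \<tau>x unfolding img[symmetric] by auto
  have d\<tau>: "(\<tau> has_vector_derivative 1 / x' (\<tau> v)) (at v within {0..X})" if "v \<in> {0..X}" for v
  proof -
    have "(x has_vector_derivative x' (\<tau> v)) (at (\<tau> v) within {0..s})"
      using dx[of "\<tau> v"] \<tau>S[OF that] sub by (auto intro: has_vector_derivative_within_subset)
    from inverse_has_vector_derivative_within[OF this _ \<tau>S[OF that] \<tau>x]
    show ?thesis using x'pos[OF \<tau>S[OF that]] contT img x\<tau>[OF that] by simp
  qed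
  have comp: "((\<lambda>v. f (\<tau> v)) has_vector_derivative f' / x' (\<tau> v)) (at v within {0..X})"
    if "v \<in> {0..X}" "(f has_vector_derivative f') (at (\<tau> v) within {0..1})" for f f' v
  proof -
    have "(f has_vector_derivative f') (at (\<tau> v) within \<tau> ` {0..X})"
      by (rule has_vector_derivative_within_subset[OF that(2)]) (use \<tau>S sub in blast)
    from field_vector_diff_chain_within[OF d\<tau>[OF that(1)], of f f'] this
    show ?thesis by (simp add: o_def has_real_derivative_iff_has_vector_derivative)
  qed
  define \<phi> where "\<phi> v = y (\<tau> v)" for v
  define \<phi>' where "\<phi>' v = y' (\<tau> v) / x' (\<tau> v)" for v
  define \<phi>'' where "\<phi>'' v = (y'' (\<tau> v) / x' (\<tau> v) * x' (\<tau> v) - y' (\<tau> v) * (x'' (\<tau> v) / x' (\<tau> v)))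
      / (x' (\<tau> v) * x' (\<tau> v))" for v
  have T1: "\<tau> v \<in> {0..1}" if "v \<in> {0..X}" for v using \<tau>S[OF that] sub by blast
  have d\<phi>: "(\<phi> has_vector_derivative \<phi>' v) (at v within {0..X})" if "v \<in> {0..X}" for v
    unfolding \<phi>_def \<phi>'_def using comp[OF that dy[OF T1[OF that]]] .
  have d\<phi>': "(\<phi>' has_vector_derivative \<phi>'' v) (at v within {0..X})" if "v \<in> {0..X}" for v
  proof -
    note a = comp[OF that dy'[OF T1[OF that]]] and b = comp[OF that dx'[OF T1[OF that]]]
    show ?thesis
      unfolding \<phi>'_def \<phi>''_def has_real_derivative_iff_has_vector_derivative[symmetric]
      using a b x'pos[OF \<tau>S[OF that]]
      by (intro DERIV_divide) (auto simp: has_real_derivative_iff_has_vector_derivative)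
  qed
  have compc: "continuous_on {0..X} (\<lambda>v. f (\<tau> v))" if "continuous_on {0..1} f" for f :: "real \<Rightarrow> real"
    by (rule continuous_on_compose2[OF that contT]) (use T1 in auto)
  have nz: "x' (\<tau> v) \<noteq> 0" if "v \<in> {0..X}" for v using x'pos[OF \<tau>S[OF that]] by simp
  have cont\<phi>'': "continuous_on {0..X} \<phi>''"
    unfolding \<phi>''_def using nz
    by (intro continuous_intros compc contx' contx'' conty' conty'') auto
  have cont\<phi>: "continuous_on {0..X} \<phi>" "continuous_on {0..X} \<phi>'"
    by (rule continuous_on_vector_derivative, erule d\<phi> d\<phi>')+
  have bdd: "\<exists>M. \<forall>v\<in>{0..X}. \<bar>f v\<bar> \<le> M" if "continuous_on {0..X} f" for f :: "real \<Rightarrow> real"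
  proof -
    have "bounded (f ` {0..X})" by (intro compact_imp_bounded compact_continuous_image that) simp
    then show ?thesis by (auto simp: bounded_iff)
  qed
  obtain M0 where M0: "\<forall>v\<in>{0..X}. \<bar>\<phi> v\<bar> \<le> M0" using bdd[OF cont\<phi>(1)] ..
  obtain M1 where M1: "\<forall>v\<in>{0..X}. \<bar>\<phi>' v\<bar> \<le> M1" using bdd[OF cont\<phi>(2)] ..
  obtain M2 where M2: "\<forall>v\<in>{0..X}. \<bar>\<phi>'' v\<bar> \<le> M2" using bdd[OF cont\<phi>''] ..
  have contg: "continuous_on {0..1} \<gamma>" and injg: "inj_on \<gamma> {0..1}"
    using arc by (auto simp: arc_def path_def)
  have notin: "0 \<notin> \<gamma> ` {s..1}"
  proof
    assume "0 \<in> \<gamma> ` {s..1}"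
    then obtain t where "t \<in> {s..1}" "\<gamma> t = \<gamma> 0" using g0 by auto
    then show False using inj_onD[OF injg, of t 0] s by auto
  qed
  have "closed (\<gamma> ` {s..1})"
    by (intro compact_imp_closed compact_continuous_image continuous_on_subset[OF contg])
      (use s in auto)
  from separate_point_closed[OF this notin]
  obtain m where m: "m > 0" "\<forall>z\<in>\<gamma> ` {s..1}. m \<le> dist 0 z" by auto
  define N where "N = Max {1, 1 / X, 1 / m, M0, M1, M2}"
  have Nge: "1 \<le> N" "1 / X \<le> N" "1 / m \<le> N" "M0 \<le> N" "M1 \<le> N" "M2 \<le> N"
    by (auto simp: N_def)
  have N0: "N > 0" using Nge by simp
  have NX: "1 / N \<le> X" "1 / N \<le> m"
    using Nge(2,3) X m(1) N0 by (auto simp: field_simps)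
  have subN: "{0..1/N} \<subseteq> {0..X}" using NX by auto
  have repr: "\<gamma> t = Complex (x t) (y t) * cis \<alpha>" for t
  proof -
    have "Complex (x t) (y t) = \<gamma> t * cis (- \<alpha>)" by (simp add: defs complex_eq_iff)
    then show ?thesis by (simp add: mult.assoc cis_mult)
  qed
  have xle: "\<bar>x t\<bar> \<le> norm (\<gamma> t)" for t
    using abs_Re_le_cmod[of "\<gamma> t * cis (- \<alpha>)"] by (simp add: defs norm_mult)
  have "C2_with_derivs (1/N) \<phi> \<phi>' \<phi>''"
    unfolding C2_with_derivs_def using d\<phi> d\<phi>' cont\<phi>'' subN
    by (auto intro: has_vector_derivative_within_subset[OF _ subN] continuous_on_subset)
  moreover have "\<phi> 0 = 0" "\<phi>' 0 = 0"
    using \<tau>x[of 0] s x0 x'0 by (auto simp: \<phi>_def \<phi>'_def)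
  moreover have "\<forall>t\<in>{0..1/N}. \<bar>\<phi> t\<bar> \<le> N \<and> \<bar>\<phi>' t\<bar> \<le> N \<and> \<bar>\<phi>'' t\<bar> \<le> N"
    using M0 M1 M2 subN Nge by (auto intro: order_trans)
  moreover have "\<sigma> \<inter> ball 0 (1/N) = (\<lambda>t. Complex t (\<phi> t) * cis \<alpha>) ` {0..1/N} \<inter> ball 0 (1/N)"
  proof (intro equalityI subsetI)
    fix z assume z: "z \<in> \<sigma> \<inter> ball 0 (1/N)"
    then obtain t where t: "t \<in> {0..1}" "z = \<gamma> t" using im by (auto simp: path_image_def)
    have zn: "norm (\<gamma> t) < 1/N" using z t by simp
    have "t \<notin> {s..1}" using m(2) zn NX by force
    then have ts: "t \<in> {0..s}" using t by auto
    then have "x t \<in> {0..1/N}" using xle[of t] zn img by fastforce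
    moreover have "z = Complex (x t) (\<phi> (x t)) * cis \<alpha>"
      using repr t \<tau>x[OF ts] by (simp add: \<phi>_def)
    ultimately show "z \<in> (\<lambda>t. Complex t (\<phi> t) * cis \<alpha>) ` {0..1/N} \<inter> ball 0 (1/N)"
      using z by blast
  next
    fix z assume z: "z \<in> (\<lambda>t. Complex t (\<phi> t) * cis \<alpha>) ` {0..1/N} \<inter> ball 0 (1/N)"
    then obtain v where v: "v \<in> {0..1/N}" "z = Complex v (\<phi> v) * cis \<alpha>" by auto
    then have vX: "v \<in> {0..X}" using subN by blast
    have "z = \<gamma> (\<tau> v)" using v repr[of "\<tau> v"] x\<tau>[OF vX] by (simp add: \<phi>_def)
    then show "z \<in> \<sigma> \<inter> ball 0 (1/N)"
      using z T1[OF vX] im by (auto simp: path_image_def)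
  qed
  ultimately have "C2_norm_le \<sigma> \<alpha> N" unfolding C2_norm_le_def using N0 by blast
  then show ?thesis ..
qed

end

theory Submission
  imports Defs "HOL-Complex_Analysis.Cauchy_Integral_Formula"
begin

text \<open>By the maximum principle \<open>u\<close> lies below every solution that blows up on the boundary of a smaller
  domain and above every such solution on a larger domain. A region bounded by two circular arcs that meet
  at the angle \<open>\<mu> * pi\<close> is mapped onto a sector by a Moebius map, so its solution is explicit. Given
  \<open>x \<in> \<Omega>\<close> near the corner with nearest boundary point \<open>p\<close> on \<open>\<sigma>\<^sub>1\<close>, take such a region whose first arc is tangent
  to \<open>\<sigma>\<^sub>1\<close> at \<open>p\<close> and whose corner is the origin shifted along the bisector by \<open>O(\<bar>p\<bar>\<^sup>2)\<close>; arcs of large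
  curvature bending inwards or outwards give a region inside or outside \<open>\<Omega>\<close>. At \<open>x\<close> the distance to the arc is
  exactly \<open>d\<close>, so both solutions are \<open>- ln (d * (1 + O(d))) - ln (\<mu> * sin (\<theta> / \<mu>) / sin \<theta>)\<close>, where \<open>\<theta>\<close> differs from
  \<open>arcsin (d / \<bar>x\<bar>)\<close> by \<open>O(\<bar>x\<bar>)\<close>. Since the last logarithm is even and smooth in \<open>\<theta> = O(d / \<bar>x\<bar>)\<close>, the error is
  \<open>O(d)\<close>. If the corner itself is the nearest point, then \<open>d = \<bar>x\<bar>\<close> and an error \<open>O(\<bar>x\<bar>)\<close> suffices.\<close>

subsection \<open>Second derivatives along lines and the comparison principle\<close>

text \<open>The obstacle is that the error must be O(d) and not merely O(\<bar>x\<bar>). A fixed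
  sector with vertex 0 matches the domain up to a relative error O(\<bar>x\<bar>), which is too
  coarse near one side; this is why the barrier must depend on x and touch the nearer curve at the
  foot. Passing through the foot with the tangent of the curve, and starting at a prescribed corner,
  determine the first arc; the opening angle then determines the second. The second arc has no
  contact to meet, it only has to stay on the correct side of its curve, and the shift of the corner
  by \<open>M * a\<^sup>2\<close> (with a the abscissa of the foot and M large against the bound on
  second derivatives) pays for that; it also makes the curvature of the arcs comparable to M. The
  exterior barrier is the interior construction in the mirrored complement, with opening angle (2 -
  \<mu>) pi. Barriers may touch the frontier of \<Omega>, so the comparison principle is applied to
  lenses whose two corners are moved by s, and s tends to 0. All scales are fixed from \<mu>, the
  radius and the graph bounds before the domain is given, hence the uniform \<delta> and C.\<close>

definition line_deriv2 :: "('a::real_normed_vector \<Rightarrow> real) \<Rightarrow> 'a \<Rightarrow> 'a \<Rightarrow> real \<Rightarrow> bool" where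
  "line_deriv2 f x b D \<longleftrightarrow> (\<exists>g. (\<forall>\<^sub>F t in nhds 0. ((\<lambda>t. f (x + t *\<^sub>R b)) has_real_derivative g t) (at t)) \<and>
     (g has_real_derivative D) (at 0))"

lemma eventually_line_mem:
  fixes x b :: "'a::real_normed_vector"
  assumes "open D" "x \<in> D"
  shows "\<forall>\<^sub>F t in nhds 0. x + t *\<^sub>R b \<in> D"
proof -
  have "((\<lambda>t. x + t *\<^sub>R b) \<longlongrightarrow> x + 0 *\<^sub>R b) (nhds 0)" by (intro tendsto_intros filterlim_ident)
  then show ?thesis using assms by (auto dest: topological_tendstoD)
qed

text \<open>\<open>laplacian\<close> iterates \<open>deriv\<close>, which has an arbitrary value
  where no derivative exists. \<open>line_deriv2\<close> carries existence along with the value;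
  this lemma is the way back to \<open>laplacian\<close>.\<close>

lemma line_deriv2_deriv:
  assumes "line_deriv2 f x b D"
  shows "(deriv ^^ 2) (\<lambda>t. f (x + t *\<^sub>R b)) 0 = D"
proof -
  obtain g where g: "\<forall>\<^sub>F t in nhds 0. ((\<lambda>t. f (x + t *\<^sub>R b)) has_real_derivative g t) (at t)"
    and D: "(g has_real_derivative D) (at 0)"
    using assms by (auto simp: line_deriv2_def)
  have "\<forall>\<^sub>F t in nhds 0. deriv (\<lambda>t. f (x + t *\<^sub>R b)) t = g t"
    using g by eventually_elim (rule DERIV_imp_deriv)
  then have "deriv (deriv (\<lambda>t. f (x + t *\<^sub>R b))) 0 = deriv g 0"
    by (rule deriv_cong_ev) simp
  then show ?thesis
    using D by (simp add: DERIV_imp_deriv numeral_2_eq_2)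
qed

lemma line_deriv2_diff:
  assumes "line_deriv2 f x b D" "line_deriv2 g x b E"
  shows "line_deriv2 (\<lambda>y. f y - g y) x b (D - E)"
proof -
  obtain f' where f': "\<forall>\<^sub>F t in nhds 0. ((\<lambda>t. f (x + t *\<^sub>R b)) has_real_derivative f' t) (at t)"
    and D: "(f' has_real_derivative D) (at 0)"
    using assms(1) by (auto simp: line_deriv2_def)
  obtain g' where g': "\<forall>\<^sub>F t in nhds 0. ((\<lambda>t. g (x + t *\<^sub>R b)) has_real_derivative g' t) (at t)"
    and E: "(g' has_real_derivative E) (at 0)"
    using assms(2) by (auto simp: line_deriv2_def)
  have "\<forall>\<^sub>F t in nhds 0. ((\<lambda>t. f (x + t *\<^sub>R b) - g (x + t *\<^sub>R b)) has_real_derivative f' t - g' t) (at t)"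
    using f' g' by eventually_elim (rule DERIV_diff)
  moreover have "((\<lambda>t. f' t - g' t) has_real_derivative D - E) (at 0)"
    using D E by (rule DERIV_diff)
  ultimately show ?thesis unfolding line_deriv2_def by (intro exI conjI)
qed

lemma line_deriv2_local_max:
  assumes "line_deriv2 f x b D" and max: "\<forall>\<^sub>F t in nhds 0. f (x + t *\<^sub>R b) \<le> f x"
  shows "D \<le> 0"
proof (rule ccontr)
  assume "\<not> D \<le> 0"
  obtain g where g: "\<forall>\<^sub>F t in nhds 0. ((\<lambda>t. f (x + t *\<^sub>R b)) has_real_derivative g t) (at t)"
    and D: "(g has_real_derivative D) (at 0)"
    using assms(1) by (auto simp: line_deriv2_def)
  from eventually_conj[OF g max] obtain e where e: "e > 0"
    "\<And>t. \<bar>t\<bar> < e \<Longrightarrow> ((\<lambda>t. f (x + t *\<^sub>R b)) has_real_derivative g t) (at t)"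
    "\<And>t. \<bar>t\<bar> < e \<Longrightarrow> f (x + t *\<^sub>R b) \<le> f x"
    unfolding eventually_nhds_metric by (auto simp: dist_real_def)
  have g0: "g 0 = 0"
    by (rule DERIV_local_max[OF e(2)[of 0] e(1)]) (use e in auto)
  obtain d where d: "d > 0" "\<And>h. h > 0 \<Longrightarrow> h < d \<Longrightarrow> g 0 < g h"
    using DERIV_pos_inc_right[OF D] \<open>\<not> D \<le> 0\<close> by auto
  define h where "h = min d e / 2"
  have h: "0 < h" "h < d" "h < e" using d(1) e(1) by (auto simp: h_def)
  have "f (x + 0 *\<^sub>R b) < f (x + h *\<^sub>R b)"
  proof (rule DERIV_pos_imp_increasing_open[OF h(1)])
    fix t assume t: "0 < t" "t < h"
    then show "\<exists>y. ((\<lambda>t. f (x + t *\<^sub>R b)) has_real_derivative y) (at t) \<and> y > 0"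
      using e(2)[of t] d(2)[of t] g0 h by auto
  next
    show "continuous_on {0..h} (\<lambda>t. f (x + t *\<^sub>R b))"
      by (rule DERIV_continuous_on, rule has_field_derivative_at_within, rule e(2)) (use h in auto)
  qed
  then show False using e(3)[of h] h by simp
qed

lemma C2_on_line_deriv2:
  assumes u: "C2_on u \<Omega>" and op: "open \<Omega>" and x: "x \<in> \<Omega>"
  shows "\<exists>D. line_deriv2 u x b D"
proof -
  obtain Du D2u where Du: "\<And>y. y \<in> \<Omega> \<Longrightarrow> (u has_derivative blinfun_apply (Du y)) (at y)"
    and D2u: "\<And>y. y \<in> \<Omega> \<Longrightarrow> (Du has_derivative blinfun_apply (D2u y)) (at y)"
    using u unfolding C2_on_def by blast
  have line: "((\<lambda>t. x + t *\<^sub>R b) has_derivative (\<lambda>s. s *\<^sub>R b)) (at t)" for t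
    by (auto intro!: derivative_eq_intros)
  have "\<forall>\<^sub>F t in nhds 0. x + t *\<^sub>R b \<in> \<Omega>" by (rule eventually_line_mem[OF op x])
  then have "\<forall>\<^sub>F t in nhds 0. ((\<lambda>t. u (x + t *\<^sub>R b)) has_real_derivative Du (x + t *\<^sub>R b) b) (at t)"
  proof eventually_elim
    case (elim t)
    have "((u \<circ> (\<lambda>t. x + t *\<^sub>R b)) has_derivative (Du (x + t *\<^sub>R b) \<circ> (\<lambda>s. s *\<^sub>R b))) (at t)"
      by (rule diff_chain_at[OF line Du[OF elim]])
    then show ?case
      by (simp add: has_field_derivative_def o_def blinfun.scaleR_right mult_commute_abs)
  qed
  moreover have "((\<lambda>t. Du (x + t *\<^sub>R b) b) has_real_derivative D2u x b b) (at 0)"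
  proof -
    have "((Du \<circ> (\<lambda>t. x + t *\<^sub>R b)) has_derivative (D2u x \<circ> (\<lambda>s. s *\<^sub>R b))) (at 0)"
      using diff_chain_at[OF line[of 0], of Du "D2u x"] D2u[OF x] by simp
    from bounded_linear.has_derivative[OF blinfun.bounded_linear_left this, of b]
    have "((\<lambda>t. Du (x + t *\<^sub>R b) b) has_derivative (\<lambda>s. D2u x (s *\<^sub>R b) b)) (at 0)"
      by (auto simp: o_def intro!: derivative_eq_intros)
    then show ?thesis
      by (simp add: has_field_derivative_def blinfun.scaleR_right blinfun.scaleR_left mult_commute_abs)
  qed
  ultimately show ?thesis unfolding line_deriv2_def by (intro exI conjI)
qed

lemma line_deriv2_cong:
  assumes "line_deriv2 f x b d" "open D" "x \<in> D" and eq: "\<And>z. z \<in> D \<Longrightarrow> f z = g z"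
  shows "line_deriv2 g x b d"
proof -
  have ev: "\<forall>\<^sub>F t in nhds 0. x + t *\<^sub>R b \<in> D" by (rule eventually_line_mem[OF assms(2,3)])
  obtain f' where f': "\<forall>\<^sub>F t in nhds 0. ((\<lambda>t. f (x + t *\<^sub>R b)) has_real_derivative f' t) (at t)"
    and d: "(f' has_real_derivative d) (at 0)"
    using assms(1) by (auto simp: line_deriv2_def)
  \<comment> \<open>The derivative at \<open>t\<close> depends on the values near \<open>t\<close>,
    so agreement is needed on a neighbourhood of each nearby parameter.\<close>
  have "\<forall>\<^sub>F t in nhds 0. \<forall>\<^sub>F s in nhds t. x + s *\<^sub>R b \<in> D"
    using ev by (simp add: eventually_eventually)
  with f' have "\<forall>\<^sub>F t in nhds 0. ((\<lambda>t. g (x + t *\<^sub>R b)) has_real_derivative f' t) (at t)"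
  proof eventually_elim
    case (elim t)
    from elim(2) have *: "\<forall>\<^sub>F s in nhds t. f (x + s *\<^sub>R b) = g (x + s *\<^sub>R b)"
      by eventually_elim (rule eq)
    show ?case using elim(1) DERIV_cong_ev[OF refl * refl, of "f' t"] by simp
  qed
  with d show ?thesis unfolding line_deriv2_def by (intro exI conjI)
qed

lemma C2_on_continuous:
  assumes "C2_on u \<Omega>" shows "continuous_on \<Omega> u"
proof -
  from assms obtain Du :: "'a \<Rightarrow> 'a \<Rightarrow>\<^sub>L real" where "\<And>y. y \<in> \<Omega> \<Longrightarrow> (u has_derivative blinfun_apply (Du y)) (at y)"
    unfolding C2_on_def by blast
  then show ?thesis
    by (intro continuous_at_imp_continuous_on ballI has_derivative_continuous)
qed

text \<open>At an interior maximum of \<open>w - v\<close> with positive value the Laplacian of \<open>w - v\<close> would be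
  \<open>exp (2 * w) - exp (2 * v) > 0\<close>.\<close>

lemma liouville_comparison:
  fixes v w :: "complex \<Rightarrow> real"
  assumes D: "open D" "bounded D"
    and v2: "\<And>x b. x \<in> D \<Longrightarrow> \<exists>d. line_deriv2 v x b d" and w2: "\<And>x b. x \<in> D \<Longrightarrow> \<exists>d. line_deriv2 w x b d"
    and vl: "\<And>x. x \<in> D \<Longrightarrow> laplacian v x = exp (2 * v x)"
    and wl: "\<And>x. x \<in> D \<Longrightarrow> laplacian w x = exp (2 * w x)"
    and vc: "continuous_on D v" and wc: "continuous_on D w"
    and bd: "\<And>z. z \<in> frontier D \<Longrightarrow> filterlim (\<lambda>x. v x - w x) at_top (at z within D)"
    and x: "x \<in> D"
  shows "w x \<le> v x"
proof (rule ccontr)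
  assume neg: "\<not> w x \<le> v x"
  define f where "f y = w y - v y" for y
  have fx: "f x > 0" using neg by (simp add: f_def)
  \<comment> \<open>This superlevel set stays off \<open>frontier D\<close>, because
    \<open>w - v\<close> tends to minus infinity there. So it is compact although \<open>D\<close>
    is open, and the maximum over \<open>D\<close> is attained.\<close>
  define K where "K = {y \<in> D. f y \<ge> f x}"
  have "closed K"
    unfolding closed_sequential_limits
  proof (intro allI impI, elim conjE)
    fix s l assume s: "\<forall>n. s n \<in> K" and l: "s \<longlonglongrightarrow> l"
    have sD: "s n \<in> D" "f (s n) \<ge> f x" for n using s by (auto simp: K_def)
    have "l \<in> closure D" using sD l by (auto simp: closure_sequential)
    moreover have "l \<notin> frontier D"
    proof
      assume lf: "l \<in> frontier D"
      then have "l \<notin> D" using D(1) by (auto simp: frontier_def interior_open)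
      then have "s n \<noteq> l" for n using sD by auto
      then have "filterlim s (at l within D) sequentially"
        using l sD by (auto simp: filterlim_at)
      from filterlim_compose[OF bd[OF lf] this]
      have "\<forall>\<^sub>F n in sequentially. 0 \<le> v (s n) - w (s n)"
        unfolding filterlim_at_top by (rule spec)
      then obtain n where "v (s n) - w (s n) \<ge> 0" by (auto dest: eventually_happens)
      then show False using sD(2)[of n] fx by (simp add: f_def)
    qed
    ultimately have lD: "l \<in> D" using D(1) by (auto simp: frontier_def interior_open)
    have fcont: "continuous_on D f" unfolding f_def using vc wc by (intro continuous_intros)
    then have "isCont f l" using lD D(1) by (simp add: continuous_on_eq_continuous_at)
    then have "(\<lambda>n. f (s n)) \<longlonglongrightarrow> f l" using l by (rule isCont_tendsto_compose)
    then have "f l \<ge> f x" by (rule tendsto_lowerbound) (use sD in auto)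
    then show "l \<in> K" using lD by (simp add: K_def)
  qed
  moreover have "bounded K" by (rule bounded_subset[OF D(2)]) (auto simp: K_def)
  ultimately have "compact K" by (simp add: compact_eq_bounded_closed)
  moreover have "x \<in> K" using x by (simp add: K_def)
  moreover have "continuous_on K f"
    unfolding f_def by (intro continuous_intros continuous_on_subset[OF vc] continuous_on_subset[OF wc])
      (auto simp: K_def)
  ultimately obtain y where y: "y \<in> K" "\<And>z. z \<in> K \<Longrightarrow> f z \<le> f y"
    using continuous_attains_sup[of K f] by blast
  have yD: "y \<in> D" and fy: "f y > 0" using y fx by (auto simp: K_def)
  have ymax: "f z \<le> f y" if "z \<in> D" for z
    using y(2)[of z] that y(1) by (cases "f z \<ge> f x") (auto simp: K_def)
  have "(deriv ^^ 2) (\<lambda>t. w (y + t *\<^sub>R b)) 0 \<le> (deriv ^^ 2) (\<lambda>t. v (y + t *\<^sub>R b)) 0" for b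
  proof -
    obtain d1 d2 where d: "line_deriv2 w y b d1" "line_deriv2 v y b d2"
      using v2[OF yD] w2[OF yD] by blast
    from eventually_line_mem[OF D(1) yD]
    have "\<forall>\<^sub>F t in nhds 0. w (y + t *\<^sub>R b) - v (y + t *\<^sub>R b) \<le> w y - v y"
      by eventually_elim (use ymax in \<open>auto simp: f_def\<close>)
    from line_deriv2_local_max[OF line_deriv2_diff[OF d] this]
    show ?thesis using line_deriv2_deriv[OF d(1)] line_deriv2_deriv[OF d(2)] by simp
  qed
  then have "laplacian w y \<le> laplacian v y"
    unfolding laplacian_def by (intro sum_mono)
  then show False using vl[OF yD] wl[OF yD] fy by (simp add: f_def)
qed

subsection \<open>Explicit solutions in circular lenses\<close>

text \<open>For \<open>\<kappa> > 0\<close> the set \<open>lens \<mu> q b \<kappa>\<close> is bounded by two circular arcs from \<open>q\<close> to \<open>q + b / \<kappa>\<close>, which form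
  the interior angle \<open>\<mu> * pi\<close> with bisector \<open>b\<close> at \<open>q\<close>; for \<open>\<kappa> < 0\<close> it is the complement of such a lens on
  the other side of \<open>q\<close>. With \<open>\<zeta> = (z - q) * cnj b\<close> the Moebius map \<open>\<zeta> / (1 - \<kappa> * \<zeta>)\<close> straightens the arcs;
  \<open>lens_map\<close> is its product with the positive factor \<open>\<bar>1 - \<kappa> * \<zeta>\<bar>\<^sup>2\<close>, which makes it quadratic and turns
  the pulled back sector metric into \<open>1 / wedge_weight\<close>.\<close>

definition lens_map :: "complex \<Rightarrow> complex \<Rightarrow> real \<Rightarrow> complex \<Rightarrow> complex" where
  "lens_map q b \<kappa> z = (z - q) * cnj b - of_real (\<kappa> * (cmod (z - q))\<^sup>2)"

text \<open>The open sector of angle \<open>\<mu> * pi\<close> about the positive real axis. A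
  linear inequality in place of \<open>Arg\<close> makes openness and passage to closures immediate,
  also for \<open>\<mu> > 1\<close>, where the cosine is negative.\<close>

definition wedge :: "real \<Rightarrow> complex set" where
  "wedge \<mu> = {W. cos (\<mu> * pi / 2) * \<bar>Im W\<bar> < sin (\<mu> * pi / 2) * Re W}"

text \<open>Homogeneity of degree one in \<open>W\<close> is the point: a positive factor of
  \<open>W\<close> comes out of the weight, so the factor put into \<open>lens_map\<close> supplies
  exactly the conformal factor of the Moebius map.\<close>

definition wedge_weight :: "real \<Rightarrow> complex \<Rightarrow> real" where
  "wedge_weight \<mu> W = \<mu> * cmod W * cos (Arg W / \<mu>)"

definition lens :: "real \<Rightarrow> complex \<Rightarrow> complex \<Rightarrow> real \<Rightarrow> complex set" where
  "lens \<mu> q b \<kappa> = {z. lens_map q b \<kappa> z \<in> wedge \<mu>}"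

definition lens_sol :: "real \<Rightarrow> complex \<Rightarrow> complex \<Rightarrow> real \<Rightarrow> complex \<Rightarrow> real" where
  "lens_sol \<mu> q b \<kappa> z = - ln (wedge_weight \<mu> (lens_map q b \<kappa> z))"

text \<open>The sine of a difference, applied to \<open>\<bar>Arg W\<bar>\<close>. Its sign decides
  membership in the wedge, and its zeros give the behaviour at the frontier.\<close>

lemma wedge_polar:
  "sin (\<mu> * pi / 2) * Re W - cos (\<mu> * pi / 2) * \<bar>Im W\<bar> = cmod W * sin (\<mu> * pi / 2 - \<bar>Arg W\<bar>)"
proof -
  have "\<bar>Arg W\<bar> \<le> pi" using Arg_bounded[of W] by auto
  then have "0 \<le> sin \<bar>Arg W\<bar>" by (intro sin_ge_zero) auto
  then have "sin \<bar>Arg W\<bar> = \<bar>sin (Arg W)\<bar>" by (auto simp: abs_if)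
  moreover have "Re W = cmod W * cos (Arg W)" "Im W = cmod W * sin (Arg W)"
    using arg_cong[OF rcis_cmod_Arg[of W], of Re] arg_cong[OF rcis_cmod_Arg[of W], of Im] by simp_all
  ultimately have "Re W = cmod W * cos \<bar>Arg W\<bar>" "\<bar>Im W\<bar> = cmod W * sin \<bar>Arg W\<bar>"
    by (simp_all add: abs_mult)
  then show ?thesis by (simp only: sin_diff) (simp add: algebra_simps)
qed

text \<open>Because of \<open>\<mu> < 2\<close> the angle
  \<open>\<mu> * pi / 2 - \<bar>Arg W\<bar>\<close> lies between \<open>- pi\<close> and
  \<open>pi\<close>, where its sine is positive exactly when the angle is.\<close>

lemma wedge_iff_Arg:
  assumes "0 < \<mu>" "\<mu> < 2"
  shows "W \<in> wedge \<mu> \<longleftrightarrow> W \<noteq> 0 \<and> \<bar>Arg W\<bar> < \<mu> * pi / 2"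
proof (cases "W = 0")
  case False
  define y where "y = \<mu> * pi / 2 - \<bar>Arg W\<bar>"
  have "\<mu> * pi / 2 < pi" "0 < \<mu> * pi / 2" "\<bar>Arg W\<bar> \<le> pi" using assms Arg_bounded[of W] by auto
  then have y: "- pi \<le> y" "y < pi" unfolding y_def by linarith+
  have "W \<in> wedge \<mu> \<longleftrightarrow> 0 < cmod W * sin y"
    using wedge_polar[of \<mu> W] by (auto simp: wedge_def y_def)
  also have "\<dots> \<longleftrightarrow> 0 < sin y" using False by (simp add: zero_less_mult_iff)
  also have "\<dots> \<longleftrightarrow> 0 < y"
  proof
    assume "0 < sin y"
    show "0 < y"
    proof (rule ccontr)
      assume "\<not> 0 < y"
      then have "sin (- y) \<ge> 0" using y by (intro sin_ge_zero) auto
      then show False using \<open>0 < sin y\<close> by simp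
    qed
  next
    assume "0 < y" then show "0 < sin y" using y by (intro sin_gt_zero) auto
  qed
  finally show ?thesis using False by (simp add: y_def)
qed (simp add: wedge_def)

lemma wedge_weight_pos:
  assumes "0 < \<mu>" "\<mu> < 2" "W \<in> wedge \<mu>"
  shows "cos (Arg W / \<mu>) > 0" "wedge_weight \<mu> W > 0"
proof -
  have W: "W \<noteq> 0" "\<bar>Arg W\<bar> < \<mu> * pi / 2" using assms by (auto simp: wedge_iff_Arg)
  then have "\<bar>Arg W / \<mu>\<bar> < pi / 2" using assms by (simp add: abs_div field_simps)
  then show "cos (Arg W / \<mu>) > 0" by (intro cos_gt_zero_pi) linarith+
  then show "wedge_weight \<mu> W > 0" using W assms by (simp add: wedge_weight_def)
qed

lemma open_wedge: "open (wedge \<mu>)"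
  unfolding wedge_def by (intro open_Collect_less continuous_intros)

lemma continuous_lens_map [continuous_intros]: "continuous_on A (lens_map q b \<kappa>)"
  unfolding lens_map_def by (intro continuous_intros)

lemma open_lens: "open (lens \<mu> q b \<kappa>)"
  unfolding lens_def using open_vimage[OF open_wedge continuous_lens_map] by (simp add: vimage_def)

lemma wedge_not_neg_real:
  assumes "0 < \<mu>" "\<mu> < 2" "W \<in> wedge \<mu>"
  shows "W \<notin> \<real>\<^sub>\<le>\<^sub>0"
proof
  assume "W \<in> \<real>\<^sub>\<le>\<^sub>0"
  then have "Im W = 0" "Re W \<le> 0" by (auto simp: complex_nonpos_Reals_iff)
  moreover have "sin (\<mu> * pi / 2) > 0" using assms by (intro sin_gt_zero) auto
  ultimately show False using assms(3) by (auto simp: wedge_def zero_less_mult_iff)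
qed

lemma isCont_wedge_weight:
  assumes "0 < \<mu>" "\<mu> < 2" "W \<in> wedge \<mu>"
  shows "isCont (wedge_weight \<mu>) W"
  unfolding wedge_weight_def
  by (intro continuous_intros continuous_at_Arg wedge_not_neg_real[OF assms]) (use assms in auto)

text \<open>Going through half the logarithm of the squared modulus avoids the choice of a branch of
  the complex logarithm.\<close>

lemma has_real_derivative_ln_cmod:
  assumes c: "(c has_vector_derivative c') (at t)" and nz: "c t \<noteq> 0"
  shows "((\<lambda>t. ln (cmod (c t))) has_real_derivative Re (c' / c t)) (at t)"
proof -
  have re: "((\<lambda>t. Re (c t)) has_real_derivative Re c') (at t)"
    and im: "((\<lambda>t. Im (c t)) has_real_derivative Im c') (at t)"
    using bounded_linear.has_vector_derivative[OF bounded_linear_Re c]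
      bounded_linear.has_vector_derivative[OF bounded_linear_Im c]
    by (auto simp: has_real_derivative_iff_has_vector_derivative)
  have pos: "(Re (c t))\<^sup>2 + (Im (c t))\<^sup>2 > 0"
    using nz by (metis cmod_power2 zero_less_norm_iff zero_less_power)
  have eq: "ln (cmod z) = ln ((Re z)\<^sup>2 + (Im z)\<^sup>2) / 2" for z
    by (simp add: cmod_def ln_sqrt)
  have "((\<lambda>t. ln ((Re (c t))\<^sup>2 + (Im (c t))\<^sup>2) / 2) has_real_derivative
      (2 * Re (c t) * Re c' + 2 * Im (c t) * Im c') / ((Re (c t))\<^sup>2 + (Im (c t))\<^sup>2) / 2) (at t)"
  proof -
    have "((\<lambda>t. ln ((X t)\<^sup>2 + (Y t)\<^sup>2) / 2) has_real_derivative
        (2 * X t * X' + 2 * Y t * Y') / ((X t)\<^sup>2 + (Y t)\<^sup>2) / 2) (at t)"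
      if "(X has_real_derivative X') (at t)" "(Y has_real_derivative Y') (at t)" "(X t)\<^sup>2 + (Y t)\<^sup>2 > 0"
      for X Y X' Y'
      using that by (auto intro!: derivative_eq_intros simp: field_simps)
    from this[OF re im pos] show ?thesis .
  qed
  moreover have "(2 * Re (c t) * Re c' + 2 * Im (c t) * Im c') / ((Re (c t))\<^sup>2 + (Im (c t))\<^sup>2) / 2 = Re (c' / c t)"
  proof -
    have "(2 * a * a' + 2 * e * e') / D / 2 = (a' * a + e' * e) / D" for a a' e e' D :: real
      by (simp add: add_divide_distrib mult.commute)
    then show ?thesis unfolding Re_divide by this
  qed
  ultimately show ?thesis by (simp add: eq)
qed

lemma line_has_vector_derivative:
  assumes "(h has_field_derivative h') (at (x + t *\<^sub>R b))"
  shows "((\<lambda>t. h (x + t *\<^sub>R b)) has_vector_derivative b * h') (at t)"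
proof -
  have "((\<lambda>t. x + t *\<^sub>R b) has_vector_derivative b) (at t)"
    by (auto intro!: derivative_eq_intros)
  from field_vector_diff_chain_at[OF this assms] show ?thesis by (simp add: o_def)
qed

text \<open>The function is the solution \<open>- ln (cos (Im w))\<close> of the strip pulled back
  by \<open>G\<close>. The direction enters two of the three terms only through
  \<open>b\<^sup>2\<close>, which prepares their cancellation in the Laplacian.\<close>

lemma line_deriv2_strip:
  assumes D: "open D" and G: "G holomorphic_on D" and x: "x \<in> D"
    and strip: "\<And>z. z \<in> D \<Longrightarrow> \<bar>Im (G z)\<bar> < pi / 2" and nz: "\<And>z. z \<in> D \<Longrightarrow> deriv G z \<noteq> 0"
  shows "line_deriv2 (\<lambda>z. ln (cmod (deriv G z)) - ln (cos (Im (G z)))) x b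
    (Re (b\<^sup>2 * deriv (\<lambda>z. deriv (deriv G) z / deriv G z) x) + (Im (b * deriv G x))\<^sup>2 / (cos (Im (G x)))\<^sup>2
      + tan (Im (G x)) * Im (b\<^sup>2 * deriv (deriv G) x))"
proof -
  define G1 where "G1 = deriv G"
  define G2 where "G2 = deriv G1"
  define l where "l = (\<lambda>z. G2 z / G1 z)"
  have h1: "G1 holomorphic_on D" unfolding G1_def by (rule holomorphic_deriv[OF G D])
  have h2: "G2 holomorphic_on D" unfolding G2_def by (rule holomorphic_deriv[OF h1 D])
  have h3: "l holomorphic_on D" unfolding l_def using h1 h2 nz by (intro holomorphic_intros) (auto simp: G1_def)
  have d0: "(G has_field_derivative G1 z) (at z)" and d1: "(G1 has_field_derivative G2 z) (at z)"
    and dl: "(l has_field_derivative deriv l z) (at z)" if "z \<in> D" for z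
    using holomorphic_derivI[OF G D that] holomorphic_derivI[OF h1 D that] holomorphic_derivI[OF h3 D that]
    by (auto simp: G1_def G2_def)
  have ev: "\<forall>\<^sub>F t in nhds 0. x + t *\<^sub>R b \<in> D" by (rule eventually_line_mem[OF D x])
  have cospos: "cos (Im (G z)) > 0" if "z \<in> D" for z using strip[OF that] by (intro cos_gt_zero_pi) auto
  have ImG: "((\<lambda>t. Im (G (x + t *\<^sub>R b))) has_real_derivative Im (b * G1 (x + t *\<^sub>R b))) (at t)"
    if "x + t *\<^sub>R b \<in> D" for t
    using bounded_linear.has_vector_derivative[OF bounded_linear_Im line_has_vector_derivative[OF d0[OF that]]]
    by (simp add: has_real_derivative_iff_has_vector_derivative)
  have ImG1: "((\<lambda>t. Im (b * G1 (x + t *\<^sub>R b))) has_real_derivative Im (b\<^sup>2 * G2 (x + t *\<^sub>R b))) (at t)"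
    if "x + t *\<^sub>R b \<in> D" for t
    using bounded_linear.has_vector_derivative[OF bounded_linear_Im
        bounded_linear.has_vector_derivative[OF bounded_linear_mult_right[of b] line_has_vector_derivative[OF d1[OF that]]]]
    by (simp add: has_real_derivative_iff_has_vector_derivative power2_eq_square mult.assoc)
  have Rel: "((\<lambda>t. Re (b * l (x + t *\<^sub>R b))) has_real_derivative Re (b\<^sup>2 * deriv l (x + t *\<^sub>R b))) (at t)"
    if "x + t *\<^sub>R b \<in> D" for t
    using bounded_linear.has_vector_derivative[OF bounded_linear_Re
        bounded_linear.has_vector_derivative[OF bounded_linear_mult_right[of b] line_has_vector_derivative[OF dl[OF that]]]]
    by (simp add: has_real_derivative_iff_has_vector_derivative power2_eq_square mult.assoc)
  define g where "g t = Re (b * l (x + t *\<^sub>R b)) + tan (Im (G (x + t *\<^sub>R b))) * Im (b * G1 (x + t *\<^sub>R b))" for t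
  have "\<forall>\<^sub>F t in nhds 0. ((\<lambda>t. ln (cmod (G1 (x + t *\<^sub>R b))) - ln (cos (Im (G (x + t *\<^sub>R b)))))
      has_real_derivative g t) (at t)"
    using ev
  proof eventually_elim
    case (elim t)
    have "((\<lambda>t. ln (cmod (G1 (x + t *\<^sub>R b)))) has_real_derivative Re (b * l (x + t *\<^sub>R b))) (at t)"
      using has_real_derivative_ln_cmod[OF line_has_vector_derivative[OF d1[OF elim]]] nz[OF elim]
      by (simp add: l_def G1_def)
    moreover have "((\<lambda>t. ln (cos (Im (G (x + t *\<^sub>R b))))) has_real_derivative
        - (tan (Im (G (x + t *\<^sub>R b))) * Im (b * G1 (x + t *\<^sub>R b)))) (at t)"
    proof -
      have "((\<lambda>t. ln (cos (F t))) has_real_derivative - (tan (F t) * F')) (at t)"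
        if "(F has_real_derivative F') (at t)" "cos (F t) > 0" for F F'
        using that by (auto intro!: derivative_eq_intros simp: tan_def)
      from this[OF ImG[OF elim] cospos[OF elim]] show ?thesis .
    qed
    ultimately have "((\<lambda>t. ln (cmod (G1 (x + t *\<^sub>R b))) - ln (cos (Im (G (x + t *\<^sub>R b)))))
        has_real_derivative Re (b * l (x + t *\<^sub>R b)) - - (tan (Im (G (x + t *\<^sub>R b))) * Im (b * G1 (x + t *\<^sub>R b)))) (at t)"
      by (rule DERIV_diff)
    then show ?case unfolding g_def by (simp only: diff_minus_eq_add)
  qed
  moreover have "(g has_real_derivative (Re (b\<^sup>2 * deriv l x) + (Im (b * G1 x))\<^sup>2 / (cos (Im (G x)))\<^sup>2
      + tan (Im (G x)) * Im (b\<^sup>2 * G2 x))) (at 0)"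
  proof -
    have "((\<lambda>t. P t + tan (F t) * Q t) has_real_derivative P' + Q 0 * Q 0 / (cos (F 0))\<^sup>2 + tan (F 0) * Q') (at 0)"
      if "(P has_real_derivative P') (at 0)" "(F has_real_derivative Q 0) (at 0)"
        "(Q has_real_derivative Q') (at 0)" "cos (F 0) > 0" for P F Q P' Q'
      using that by (auto intro!: derivative_eq_intros simp: power2_eq_square field_simps)
    from this[OF Rel ImG ImG1] cospos[OF x] x show ?thesis
      unfolding g_def by (simp add: power2_eq_square)
  qed
  ultimately show ?thesis unfolding line_deriv2_def G1_def G2_def l_def by (intro exI conjI)
qed

text \<open>The basis directions \<open>1\<close> and \<open>\<i>\<close> have squares
  \<open>1\<close> and \<open>- 1\<close>, so the terms linear in \<open>b\<^sup>2\<close> cancel.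
  The squares of \<open>Im (b * deriv G x)\<close> add up to the squared modulus of
  \<open>deriv G x\<close>.\<close>

lemma laplacian_strip:
  assumes D: "open D" and G: "G holomorphic_on D" and x: "x \<in> D"
    and strip: "\<And>z. z \<in> D \<Longrightarrow> \<bar>Im (G z)\<bar> < pi / 2" and nz: "\<And>z. z \<in> D \<Longrightarrow> deriv G z \<noteq> 0"
  defines "v \<equiv> \<lambda>z. ln (cmod (deriv G z)) - ln (cos (Im (G z)))"
  shows "laplacian v x = exp (2 * v x)"
proof -
  have L: "(deriv ^^ 2) (\<lambda>t. v (x + t *\<^sub>R b)) 0 =
      Re (b\<^sup>2 * deriv (\<lambda>z. deriv (deriv G) z / deriv G z) x) + (Im (b * deriv G x))\<^sup>2 / (cos (Im (G x)))\<^sup>2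
      + tan (Im (G x)) * Im (b\<^sup>2 * deriv (deriv G) x)" for b
    unfolding v_def by (rule line_deriv2_deriv[OF line_deriv2_strip[OF assms(1-5)]])
  have c: "cos (Im (G x)) > 0" using strip[OF x] by (intro cos_gt_zero_pi) auto
  have "(\<Sum>b\<in>Basis. (deriv ^^ 2) (\<lambda>t. v (x + t *\<^sub>R b)) 0) = (cmod (deriv G x))\<^sup>2 / (cos (Im (G x)))\<^sup>2"
    unfolding L by (simp add: Basis_complex_def cmod_power2 add_divide_distrib)
  also have "\<dots> = (exp (v x))\<^sup>2"
    using c nz[OF x] by (simp add: v_def exp_diff power_divide)
  also have "\<dots> = exp (2 * v x)" by (simp add: exp_double)
  finally show ?thesis by (simp add: laplacian_def)
qed

text \<open>As \<open>cnj w\<close> is the quotient of the squared modulus of \<open>w\<close> by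
  \<open>w\<close>, this exhibits \<open>lens_map\<close> as a positive multiple of the Moebius
  map.\<close>

lemma lens_map_factor:
  assumes b: "cmod b = 1"
  shows "lens_map q b \<kappa> z = (z - q) * cnj b * cnj (1 - of_real \<kappa> * ((z - q) * cnj b))"
proof -
  have "b * cnj b = 1" using b by (simp add: complex_norm_square[symmetric])
  then have "(z - q) * cnj b * cnj ((z - q) * cnj b) = (z - q) * cnj (z - q)"
    by (metis (no_types, lifting) complex_cnj_cnj complex_cnj_mult mult.assoc mult.commute mult.right_neutral)
  also have "\<dots> = of_real ((cmod (z - q))\<^sup>2)" by (rule complex_norm_square[symmetric])
  finally have *: "(z - q) * cnj b * cnj ((z - q) * cnj b) = of_real ((cmod (z - q))\<^sup>2)" .
  have "y * cnj (1 - of_real \<kappa> * y) = y - of_real \<kappa> * (y * cnj y)" for y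
    by (simp add: algebra_simps)
  from this[of "(z - q) * cnj b"] show ?thesis unfolding * by (simp add: lens_map_def)
qed

text \<open>In the lens, \<open>G = Ln (\<zeta> / (1 - \<kappa> * \<zeta>)) / \<mu>\<close> with \<open>\<zeta> = (z - q) * cnj b\<close> maps conformally onto the
  strip \<open>\<bar>Im w\<bar> < pi / 2\<close>.\<close>

lemma lens_sol_strip:
  fixes \<mu> \<kappa> :: real
  assumes \<mu>: "0 < \<mu>" "\<mu> < 2" and b: "cmod b = 1"
  obtains G where "G holomorphic_on lens \<mu> q b \<kappa>"
    "\<And>z. z \<in> lens \<mu> q b \<kappa> \<Longrightarrow> \<bar>Im (G z)\<bar> < pi / 2" "\<And>z. z \<in> lens \<mu> q b \<kappa> \<Longrightarrow> deriv G z \<noteq> 0"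
    "\<And>z. z \<in> lens \<mu> q b \<kappa> \<Longrightarrow> lens_sol \<mu> q b \<kappa> z = ln (cmod (deriv G z)) - ln (cos (Im (G z)))"
proof
  define \<zeta> where "\<zeta> z = (z - q) * cnj b" for z
  define T where "T z = \<zeta> z / (1 - of_real \<kappa> * \<zeta> z)" for z
  define G where "G z = Ln (T z) / of_real \<mu>" for z
  let ?D = "lens \<mu> q b \<kappa>"
  have b0: "cnj b \<noteq> 0" using b by auto
  have fac: "lens_map q b \<kappa> z = \<zeta> z * cnj (1 - of_real \<kappa> * \<zeta> z)" for z
    using lens_map_factor[OF b] by (simp add: \<zeta>_def)
  have W: "lens_map q b \<kappa> z \<in> wedge \<mu>" "lens_map q b \<kappa> z \<noteq> 0" "\<zeta> z \<noteq> 0" "1 - of_real \<kappa> * \<zeta> z \<noteq> 0"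
    if "z \<in> ?D" for z
  proof -
    show "lens_map q b \<kappa> z \<in> wedge \<mu>" using that by (simp add: lens_def)
    then show "lens_map q b \<kappa> z \<noteq> 0" using \<mu> by (simp add: wedge_iff_Arg)
    then have *: "\<zeta> z * cnj (1 - of_real \<kappa> * \<zeta> z) \<noteq> 0" unfolding fac .
    show "\<zeta> z \<noteq> 0" using * by (rule contrapos_nn) simp
    show "1 - of_real \<kappa> * \<zeta> z \<noteq> 0" using * by (rule contrapos_nn) simp
  qed
  have TW: "lens_map q b \<kappa> z = of_real ((cmod (1 - of_real \<kappa> * \<zeta> z))\<^sup>2) * T z" if "z \<in> ?D" for z
    using W(4)[OF that] unfolding fac T_def complex_norm_square by simp
  have ArgT: "Arg (lens_map q b \<kappa> z) = Arg (T z)" if "z \<in> ?D" for z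
    unfolding TW[OF that] using W(4)[OF that] by (subst Arg_times_of_real) auto
  have T0: "T z \<noteq> 0" if "z \<in> ?D" for z using W[OF that] by (simp add: T_def)
  have Tneg: "T z \<notin> \<real>\<^sub>\<le>\<^sub>0" if "z \<in> ?D" for z
  proof
    assume "T z \<in> \<real>\<^sub>\<le>\<^sub>0"
    then have "lens_map q b \<kappa> z \<in> \<real>\<^sub>\<le>\<^sub>0"
      unfolding TW[OF that] by (auto simp: complex_nonpos_Reals_iff mult_le_0_iff)
    then show False using wedge_not_neg_real[OF \<mu> W(1)[OF that]] by simp
  qed
  have dT: "(T has_field_derivative cnj b / (1 - of_real \<kappa> * \<zeta> z)\<^sup>2) (at z)" if "z \<in> ?D" for z
    using W(4)[OF that] unfolding T_def \<zeta>_def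
    by (auto intro!: derivative_eq_intros simp: power2_eq_square field_simps)
  have dG: "(G has_field_derivative cnj b / (of_real \<mu> * (\<zeta> z * (1 - of_real \<kappa> * \<zeta> z)))) (at z)"
    if "z \<in> ?D" for z
  proof -
    have "((\<lambda>z. Ln (T z)) has_field_derivative inverse (T z) * (cnj b / (1 - of_real \<kappa> * \<zeta> z)\<^sup>2)) (at z)"
      by (rule DERIV_chain2[OF has_field_derivative_Ln[OF Tneg[OF that]] dT[OF that]])
    then have "(G has_field_derivative inverse (T z) * (cnj b / (1 - of_real \<kappa> * \<zeta> z)\<^sup>2) / of_real \<mu>) (at z)"
      unfolding G_def by (rule DERIV_cdivide)
    moreover have "inverse (T z) * (cnj b / (1 - of_real \<kappa> * \<zeta> z)\<^sup>2) / of_real \<mu>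
        = cnj b / (of_real \<mu> * (\<zeta> z * (1 - of_real \<kappa> * \<zeta> z)))"
    proof -
      have "inverse (a / d) * (c / d\<^sup>2) / m = c / (m * (a * d))" if "a \<noteq> 0" "d \<noteq> 0" for a c d m :: complex
        using that by (simp add: power2_eq_square)
      from this[OF W(3,4)[OF that]] show ?thesis by (simp add: T_def)
    qed
    ultimately show ?thesis by simp
  qed
  show "G holomorphic_on ?D"
    unfolding holomorphic_on_open[OF open_lens] using dG by blast
  have ImG: "Im (G z) = Arg (lens_map q b \<kappa> z) / \<mu>" if "z \<in> ?D" for z
    using T0[OF that] ArgT[OF that] by (simp add: G_def Arg_eq_Im_Ln)
  show "\<bar>Im (G z)\<bar> < pi / 2" if "z \<in> ?D" for z
    using W(1)[OF that] \<mu> unfolding ImG[OF that] by (simp add: wedge_iff_Arg field_simps)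
  have G': "deriv G z = cnj b / (of_real \<mu> * (\<zeta> z * (1 - of_real \<kappa> * \<zeta> z)))" if "z \<in> ?D" for z
    using dG[OF that] by (rule DERIV_imp_deriv)
  show nz: "deriv G z \<noteq> 0" if "z \<in> ?D" for z
    using W[OF that] b0 \<mu> unfolding G'[OF that] by simp
  \<comment> \<open>The conjugation in \<open>lens_map\<close> does not change the modulus, so the
    denominator of \<open>deriv G\<close> and \<open>lens_map\<close> have the same size up to
    \<open>\<mu>\<close>.\<close>
  have G1: "cmod (deriv G z) = 1 / (\<mu> * cmod (lens_map q b \<kappa> z))" if "z \<in> ?D" for z
    using b \<mu> unfolding G'[OF that] fac by (simp add: norm_mult norm_divide del: complex_cnj_diff complex_cnj_mult)
  have cp: "0 < cos (Arg (lens_map q b \<kappa> z) / \<mu>)" if "z \<in> ?D" for z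
    by (rule wedge_weight_pos(1)[OF \<mu> W(1)[OF that]])
  show "lens_sol \<mu> q b \<kappa> z = ln (cmod (deriv G z)) - ln (cos (Im (G z)))" if "z \<in> ?D" for z
  proof -
    define m where "m = cmod (lens_map q b \<kappa> z)"
    define c where "c = cos (Arg (lens_map q b \<kappa> z) / \<mu>)"
    have "m > 0" using W(2)[OF that] by (simp add: m_def)
    moreover have "c > 0" using cp[OF that] by (simp add: c_def)
    moreover have "cmod (deriv G z) = 1 / (\<mu> * m)" using G1[OF that] by (simp add: m_def)
    ultimately show ?thesis using \<mu> ImG[OF that]
      by (simp add: lens_sol_def wedge_weight_def ln_mult ln_div m_def[symmetric] c_def[symmetric])
  qed
qed

lemma laplacian_lens_sol:
  assumes "0 < \<mu>" "\<mu> < 2" "cmod b = 1" "x \<in> lens \<mu> q b \<kappa>"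
  shows "laplacian (lens_sol \<mu> q b \<kappa>) x = exp (2 * lens_sol \<mu> q b \<kappa> x)"
    and "\<exists>d. line_deriv2 (lens_sol \<mu> q b \<kappa>) x c d"
proof -
  obtain G where G: "G holomorphic_on lens \<mu> q b \<kappa>"
    "\<And>z. z \<in> lens \<mu> q b \<kappa> \<Longrightarrow> \<bar>Im (G z)\<bar> < pi / 2" "\<And>z. z \<in> lens \<mu> q b \<kappa> \<Longrightarrow> deriv G z \<noteq> 0"
    and eq: "\<And>z. z \<in> lens \<mu> q b \<kappa> \<Longrightarrow> lens_sol \<mu> q b \<kappa> z = ln (cmod (deriv G z)) - ln (cos (Im (G z)))"
    using lens_sol_strip[OF assms(1-3)] by metis
  note strip = line_deriv2_strip[OF open_lens G(1) assms(4) G(2,3)]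
  note lens = line_deriv2_cong[OF strip open_lens assms(4) eq[symmetric]]
  show "\<exists>d. line_deriv2 (lens_sol \<mu> q b \<kappa>) x c d"
    using lens by blast
  have "laplacian (lens_sol \<mu> q b \<kappa>) x = laplacian (\<lambda>z. ln (cmod (deriv G z)) - ln (cos (Im (G z)))) x"
    unfolding laplacian_def by (simp add: line_deriv2_deriv[OF lens] line_deriv2_deriv[OF strip])
  then show "laplacian (lens_sol \<mu> q b \<kappa>) x = exp (2 * lens_sol \<mu> q b \<kappa> x)"
    using laplacian_strip[OF open_lens G(1) assms(4) G(2,3)] eq[OF assms(4)] by simp
qed

subsection \<open>Comparison of a solution with lens solutions\<close>

text \<open>At the vertex \<open>Arg\<close> jumps, but the weight is at most
  \<open>\<mu> * cmod w\<close>. At any other such point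
  \<open>\<bar>Arg W\<bar> = \<mu> * pi / 2 < pi\<close>, so the branch cut is avoided and the
  cosine vanishes.\<close>

lemma wedge_weight_frontier:
  assumes \<mu>: "0 < \<mu>" "\<mu> < 2" and W: "cos (\<mu> * pi / 2) * \<bar>Im W\<bar> = sin (\<mu> * pi / 2) * Re W"
  shows "(wedge_weight \<mu> \<longlongrightarrow> 0) (nhds W)"
proof (cases "W = 0")
  case True
  have "(wedge_weight \<mu> \<longlongrightarrow> 0) (nhds W)"
  proof (rule Lim_null_comparison)
    show "\<forall>\<^sub>F w in nhds W. norm (wedge_weight \<mu> w) \<le> \<mu> * cmod w"
      using \<mu> by (intro always_eventually) (auto simp: wedge_weight_def abs_mult intro!: mult_left_le)
    have "((\<lambda>w. \<mu> * cmod w) \<longlongrightarrow> \<mu> * cmod W) (nhds W)"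
      by (intro tendsto_intros filterlim_ident)
    then show "((\<lambda>w. \<mu> * cmod w) \<longlongrightarrow> 0) (nhds W)" using True by simp
  qed
  then show ?thesis .
next
  case False
  define A where "A = Arg W"
  define y where "y = \<mu> * pi / 2 - \<bar>A\<bar>"
  have mp: "\<mu> * pi / 2 < pi" "0 < \<mu> * pi / 2" using \<mu> by auto
  moreover have "\<bar>A\<bar> \<le> pi" using Arg_bounded[of W] by (auto simp: A_def)
  ultimately have y: "- pi < y" "y < pi" unfolding y_def by linarith+
  have "cmod W * sin y = 0" using wedge_polar[of \<mu> W] W by (simp add: y_def A_def)
  then have "sin y = 0" using False by simp
  then have "y = 0" using y sin_zero_pi_iff[of y] by auto
  then have A2: "\<bar>A\<bar> = \<mu> * pi / 2" by (simp add: y_def)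
  have "W \<notin> \<real>\<^sub>\<le>\<^sub>0"
  proof
    assume "W \<in> \<real>\<^sub>\<le>\<^sub>0"
    then have "Arg W = pi" using False by (auto simp: complex_nonpos_Reals_iff Arg_eq_pi complex_eq_iff)
    then show False using A2 mp by (simp add: A_def)
  qed
  then have "isCont (wedge_weight \<mu>) W"
    unfolding wedge_weight_def by (intro continuous_intros continuous_at_Arg) (use \<mu> in auto)
  moreover have "wedge_weight \<mu> W = 0"
  proof -
    have "\<bar>A / \<mu>\<bar> = pi / 2" using A2 \<mu> by (simp add: abs_div)
    then have "cos (A / \<mu>) = 0" by (metis cos_abs_real cos_pi_half)
    then show ?thesis by (simp add: wedge_weight_def A_def)
  qed
  ultimately show ?thesis
    using tendsto_at_iff_tendsto_nhds[of "wedge_weight \<mu>" W] by (simp add: isCont_def)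
qed

text \<open>With the new curvature the corners become \<open>q + s * b\<close> and
  \<open>q + b / \<kappa> - s * b\<close>: both move by \<open>s\<close> along their common axis. In
  the coordinate \<open>lens_map\<close> this is an affine change of the real part alone.\<close>

lemma lens_map_shift:
  assumes b: "cmod b = 1" and e: "1 - 2 * \<kappa> * s \<noteq> 0"
  shows "Re (lens_map (q + of_real s * b) b (\<kappa> / (1 - 2 * \<kappa> * s)) z) =
      (Re (lens_map q b \<kappa> z) - s + \<kappa> * s\<^sup>2) / (1 - 2 * \<kappa> * s)"
    and "Im (lens_map (q + of_real s * b) b (\<kappa> / (1 - 2 * \<kappa> * s)) z) = Im (lens_map q b \<kappa> z)"
proof -
  define \<zeta> where "\<zeta> = (z - q) * cnj b"
  have bb: "b * cnj b = 1" using b by (simp add: complex_norm_square[symmetric])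
  have 1: "(z - (q + of_real s * b)) * cnj b = \<zeta> - of_real s"
    using bb by (simp add: \<zeta>_def algebra_simps)
  have n1: "(cmod (z - q))\<^sup>2 = (cmod \<zeta>)\<^sup>2" using b by (simp add: \<zeta>_def norm_mult)
  have n2: "(cmod (z - (q + of_real s * b)))\<^sup>2 = (cmod (\<zeta> - of_real s))\<^sup>2"
    unfolding 1[symmetric] using b by (simp add: norm_mult)
  have n3: "(cmod (\<zeta> - of_real s))\<^sup>2 = (cmod \<zeta>)\<^sup>2 - 2 * s * Re \<zeta> + s\<^sup>2"
    by (simp only: cmod_power2) (simp add: power2_eq_square algebra_simps)
  show "Im (lens_map (q + of_real s * b) b (\<kappa> / (1 - 2 * \<kappa> * s)) z) = Im (lens_map q b \<kappa> z)"
    by (simp add: lens_map_def 1 \<zeta>_def[symmetric])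
  have "Re (lens_map (q + of_real s * b) b (\<kappa> / (1 - 2 * \<kappa> * s)) z)
      = Re \<zeta> - s - \<kappa> / (1 - 2 * \<kappa> * s) * ((cmod \<zeta>)\<^sup>2 - 2 * s * Re \<zeta> + s\<^sup>2)"
    by (simp add: lens_map_def 1 n2 n3)
  also have "\<dots> = (Re \<zeta> - \<kappa> * (cmod \<zeta>)\<^sup>2 - s + \<kappa> * s\<^sup>2) / (1 - 2 * \<kappa> * s)"
    using e by (simp add: field_simps) (simp add: power2_eq_square algebra_simps)
  also have "Re \<zeta> - \<kappa> * (cmod \<zeta>)\<^sup>2 = Re (lens_map q b \<kappa> z)"
    by (simp add: lens_map_def n1 \<zeta>_def[symmetric])
  finally show "Re (lens_map (q + of_real s * b) b (\<kappa> / (1 - 2 * \<kappa> * s)) z) =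
      (Re (lens_map q b \<kappa> z) - s + \<kappa> * s\<^sup>2) / (1 - 2 * \<kappa> * s)" .
qed

lemma lens_shift_iff:
  assumes b: "cmod b = 1" and e: "1 - 2 * \<kappa> * s > 0"
  shows "z \<in> lens \<mu> (q + of_real s * b) b (\<kappa> / (1 - 2 * \<kappa> * s)) \<longleftrightarrow>
    cos (\<mu> * pi / 2) * \<bar>Im (lens_map q b \<kappa> z)\<bar> * (1 - 2 * \<kappa> * s)
      < sin (\<mu> * pi / 2) * (Re (lens_map q b \<kappa> z) - s + \<kappa> * s\<^sup>2)"
  using e by (simp add: lens_def wedge_def lens_map_shift[OF b] pos_less_divide_eq)

text \<open>In coordinates: the closed shifted lens lies in the open original one. For
  \<open>C > 0\<close> the factor \<open>1 - 2 * \<kappa> * s\<close> loses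
  \<open>2 * \<kappa> * s * C * \<bar>y\<bar>\<close>. The shifted lens is bounded, which gives
  \<open>\<kappa> * C * \<bar>y\<bar> \<le> S / 3\<close>; so the loss is at most
  \<open>2 * s * S / 3\<close>, less than the gain of at least \<open>7 * s * S / 8\<close>.\<close>

lemma lens_shift_ineq:
  fixes C S \<kappa> s x y :: real
  assumes \<kappa>: "\<kappa> > 0" and s: "0 < s" "\<kappa> * s \<le> 1 / 8" and S: "S > 0"
    and le: "C * \<bar>y\<bar> * (1 - 2 * \<kappa> * s) \<le> S * (x - \<kappa> * (x\<^sup>2 + y\<^sup>2) - s + \<kappa> * s\<^sup>2)"
  shows "C * \<bar>y\<bar> < S * (x - \<kappa> * (x\<^sup>2 + y\<^sup>2))"
proof -
  have ss: "\<kappa> * s\<^sup>2 \<le> s / 8" using mult_right_mono[OF s(2), of s] s by (simp add: power2_eq_square)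
  show ?thesis
  proof (cases "C \<le> 0")
    case True
    have "C * \<bar>y\<bar> * (2 * \<kappa> * s) \<le> 0" using True \<kappa> s by (intro mult_nonpos_nonneg) auto
    then have "C * \<bar>y\<bar> \<le> C * \<bar>y\<bar> * (1 - 2 * \<kappa> * s)" by (simp add: algebra_simps)
    also have "\<dots> \<le> S * (x - \<kappa> * (x\<^sup>2 + y\<^sup>2) - s + \<kappa> * s\<^sup>2)" by (rule le)
    also have "\<dots> < S * (x - \<kappa> * (x\<^sup>2 + y\<^sup>2))" using S ss s by (intro mult_strict_left_mono) auto
    finally show ?thesis .
  next
    case False
    have "0 \<le> (2 * \<kappa> * x - 1)\<^sup>2" by simp
    then have q: "4 * \<kappa> * (x - \<kappa> * x\<^sup>2) \<le> 1" by (simp add: power2_eq_square algebra_simps)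
    have "C * \<bar>y\<bar> * (3 / 4) \<le> C * \<bar>y\<bar> * (1 - 2 * \<kappa> * s)" using False s by (intro mult_left_mono) auto
    also have "\<dots> \<le> S * (x - \<kappa> * (x\<^sup>2 + y\<^sup>2) - s + \<kappa> * s\<^sup>2)" by (rule le)
    also have "\<dots> \<le> S * (x - \<kappa> * x\<^sup>2)"
    proof (intro mult_left_mono)
      have "\<kappa> * y\<^sup>2 \<ge> 0" using \<kappa> by simp
      then show "x - \<kappa> * (x\<^sup>2 + y\<^sup>2) - s + \<kappa> * s\<^sup>2 \<le> x - \<kappa> * x\<^sup>2"
        unfolding distrib_left using ss s by linarith
    qed (use S in simp)
    finally have "C * \<bar>y\<bar> * (3 / 4) * (4 * \<kappa>) \<le> S * (x - \<kappa> * x\<^sup>2) * (4 * \<kappa>)"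
      using \<kappa> by (intro mult_right_mono) auto
    also have "\<dots> \<le> S" using mult_left_mono[OF q, of S] S by (simp add: algebra_simps)
    finally have *: "3 * (\<kappa> * (C * \<bar>y\<bar>)) \<le> S" by (simp add: algebra_simps)
    have "2 * s * (\<kappa> * (C * \<bar>y\<bar>)) \<le> 2 * s * (S / 3)" using s * by (intro mult_left_mono) auto
    moreover have "S * (\<kappa> * s\<^sup>2) \<le> S * (s / 8)" using S ss by (intro mult_left_mono) auto
    moreover have "S * s > 0" using S s by simp
    ultimately show ?thesis using le by (simp add: algebra_simps)
  qed
qed

lemma Re_lens_map:
  assumes "cmod b = 1"
  shows "Re (lens_map q b \<kappa> z) = Re ((z - q) * cnj b) - \<kappa> * ((Re ((z - q) * cnj b))\<^sup>2 + (Im ((z - q) * cnj b))\<^sup>2)"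
    "Im (lens_map q b \<kappa> z) = Im ((z - q) * cnj b)"
proof -
  have "(cmod (z - q))\<^sup>2 = (cmod ((z - q) * cnj b))\<^sup>2" using assms by (simp add: norm_mult)
  then show "Re (lens_map q b \<kappa> z) = Re ((z - q) * cnj b) - \<kappa> * ((Re ((z - q) * cnj b))\<^sup>2 + (Im ((z - q) * cnj b))\<^sup>2)"
    by (simp add: lens_map_def cmod_power2)
  show "Im (lens_map q b \<kappa> z) = Im ((z - q) * cnj b)" by (simp add: lens_map_def)
qed

lemma lens_sol_shift_tendsto:
  assumes \<mu>: "0 < \<mu>" "\<mu> < 2" and x: "x \<in> lens \<mu> q b \<kappa>"
  shows "((\<lambda>s. lens_sol \<mu> (q + of_real s * b) b (\<kappa> / (1 - 2 * \<kappa> * s)) x) \<longlongrightarrow> lens_sol \<mu> q b \<kappa> x) (at 0 within A)"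
proof -
  have W: "lens_map q b \<kappa> x \<in> wedge \<mu>" using x by (simp add: lens_def)
  have "((\<lambda>s. lens_map (q + of_real s * b) b (\<kappa> / (1 - 2 * \<kappa> * s)) x) \<longlongrightarrow>
      lens_map (q + of_real 0 * b) b (\<kappa> / (1 - 2 * \<kappa> * 0)) x) (at 0 within A)"
    unfolding lens_map_def by (intro tendsto_intros) auto
  then have "((\<lambda>s. lens_map (q + of_real s * b) b (\<kappa> / (1 - 2 * \<kappa> * s)) x) \<longlongrightarrow> lens_map q b \<kappa> x) (at 0 within A)"
    by simp
  from isCont_tendsto_compose[OF isCont_wedge_weight[OF \<mu> W] this]
  show ?thesis unfolding lens_sol_def using wedge_weight_pos(2)[OF \<mu> W] by (intro tendsto_intros) auto
qed

lemma isCont_lens_sol: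
  assumes \<mu>: "0 < \<mu>" "\<mu> < 2" and x: "x \<in> lens \<mu> q b \<kappa>"
  shows "isCont (lens_sol \<mu> q b \<kappa>) x"
proof -
  have W: "lens_map q b \<kappa> x \<in> wedge \<mu>" using x by (simp add: lens_def)
  have "isCont (lens_map q b \<kappa>) x" using continuous_lens_map[of UNIV] by (simp add: continuous_on_eq_continuous_at)
  from isCont_o2[OF this isCont_wedge_weight[OF \<mu> W]]
  show ?thesis unfolding lens_sol_def using wedge_weight_pos(2)[OF \<mu> W] by (intro continuous_intros) auto
qed

lemma lens_sol_at_frontier:
  assumes \<mu>: "0 < \<mu>" "\<mu> < 2" and z: "z \<in> frontier (lens \<mu> q b \<kappa>)"
  shows "filterlim (lens_sol \<mu> q b \<kappa>) at_top (at z within lens \<mu> q b \<kappa>)"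
proof -
  let ?D = "lens \<mu> q b \<kappa>"
  define W where "W = lens_map q b \<kappa> z"
  have "closed {z. cos (\<mu> * pi / 2) * \<bar>Im (lens_map q b \<kappa> z)\<bar> \<le> sin (\<mu> * pi / 2) * Re (lens_map q b \<kappa> z)}"
    by (intro closed_Collect_le continuous_intros)
  then have "closure ?D \<subseteq> {z. cos (\<mu> * pi / 2) * \<bar>Im (lens_map q b \<kappa> z)\<bar> \<le> sin (\<mu> * pi / 2) * Re (lens_map q b \<kappa> z)}"
    by (intro closure_minimal) (auto simp: lens_def wedge_def)
  moreover have "z \<in> closure ?D" "z \<notin> ?D" using z open_lens by (auto simp: frontier_def interior_open)
  ultimately have "cos (\<mu> * pi / 2) * \<bar>Im W\<bar> = sin (\<mu> * pi / 2) * Re W"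
    by (force simp: W_def lens_def wedge_def)
  note lim = wedge_weight_frontier[OF \<mu> this]
  have "(lens_map q b \<kappa> \<longlongrightarrow> W) (at z within ?D)"
    using continuous_lens_map[of UNIV q b \<kappa>] unfolding W_def
    by (simp add: continuous_on_eq_continuous_at continuous_at_imp_continuous_at_within continuous_within[symmetric])
  from filterlim_compose[OF lim this]
  have "((\<lambda>y. wedge_weight \<mu> (lens_map q b \<kappa> y)) \<longlongrightarrow> 0) (at z within ?D)" .
  moreover have "\<forall>\<^sub>F y in at z within ?D. wedge_weight \<mu> (lens_map q b \<kappa> y) \<in> {0<..}"
    unfolding eventually_at_filter by (intro always_eventually) (auto simp: lens_def intro!: wedge_weight_pos(2) \<mu>)
  ultimately have "filterlim (\<lambda>y. wedge_weight \<mu> (lens_map q b \<kappa> y)) (at_right 0) (at z within ?D)"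
    by (simp add: filterlim_at eventually_conj_iff eventually_mono)
  from filterlim_compose[OF ln_at_0 this]
  have "filterlim (\<lambda>y. ln (wedge_weight \<mu> (lens_map q b \<kappa> y))) at_bot (at z within ?D)" .
  then show ?thesis unfolding lens_sol_def by (simp add: filterlim_uminus_at_top)
qed

text \<open>The radius is the diameter of the circles that carry the two arcs; both pass through
  \<open>q\<close>.\<close>

lemma lens_bounded:
  assumes \<mu>: "0 < \<mu>" "\<mu> < 2" and b: "cmod b = 1" and \<kappa>: "\<kappa> > 0"
  shows "z \<in> lens \<mu> q b \<kappa> \<Longrightarrow> cmod (z - q) < 1 / (\<kappa> * sin (\<mu> * pi / 2))" "bounded (lens \<mu> q b \<kappa>)"
proof -
  have S: "sin (\<mu> * pi / 2) > 0" using \<mu> by (intro sin_gt_zero) auto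
  show *: "cmod (z - q) < 1 / (\<kappa> * sin (\<mu> * pi / 2))" if "z \<in> lens \<mu> q b \<kappa>" for z
  proof -
    define \<zeta> where "\<zeta> = (z - q) * cnj b"
    have n: "cmod \<zeta> = cmod (z - q)" using b by (simp add: \<zeta>_def norm_mult)
    have "cos (\<mu> * pi / 2) * \<bar>Im \<zeta>\<bar> < sin (\<mu> * pi / 2) * (Re \<zeta> - \<kappa> * (cmod \<zeta>)\<^sup>2)"
      using that unfolding lens_def wedge_def mem_Collect_eq Re_lens_map[OF b] \<zeta>_def[symmetric] cmod_power2 .
    then have 1: "\<kappa> * sin (\<mu> * pi / 2) * (cmod \<zeta>)\<^sup>2 < sin (\<mu> * pi / 2) * Re \<zeta> - cos (\<mu> * pi / 2) * \<bar>Im \<zeta>\<bar>"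
      by (simp add: algebra_simps)
    have "sin (\<mu> * pi / 2) * Re \<zeta> - cos (\<mu> * pi / 2) * \<bar>Im \<zeta>\<bar> \<le> cmod \<zeta>"
    proof -
      \<comment> \<open>The linear form is \<open>Re (c * w)\<close> with a unit vector
        \<open>c\<close>, so it is bounded by the modulus of \<open>\<zeta>\<close>.\<close>
      define c where "c = Complex (sin (\<mu> * pi / 2)) (cos (\<mu> * pi / 2))"
      define w where "w = Complex (Re \<zeta>) \<bar>Im \<zeta>\<bar>"
      have "Re (c * w) \<le> cmod (c * w)" by (rule complex_Re_le_cmod)
      moreover have "cmod c = 1" by (simp add: c_def cmod_def)
      moreover have "cmod w = cmod \<zeta>" by (simp add: w_def cmod_def)
      ultimately show ?thesis by (simp add: c_def w_def norm_mult)
    qed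
    with 1 have 2: "\<kappa> * sin (\<mu> * pi / 2) * (cmod \<zeta>)\<^sup>2 < cmod \<zeta>" by simp
    then have "cmod \<zeta> \<noteq> 0" by auto
    then have "cmod \<zeta> > 0" by simp
    with 2 have "\<kappa> * sin (\<mu> * pi / 2) * cmod \<zeta> < 1" by (simp add: power2_eq_square)
    then show ?thesis using \<kappa> S n by (simp add: pos_less_divide_eq mult.commute)
  qed
  have "lens \<mu> q b \<kappa> \<subseteq> ball q (1 / (\<kappa> * sin (\<mu> * pi / 2)))"
    using * by (auto simp: dist_norm norm_minus_commute)
  then show "bounded (lens \<mu> q b \<kappa>)" using bounded_ball bounded_subset by blast
qed

text \<open>The lens may reach the frontier of \<open>\<Omega>\<close>, where both functions blow
  up. The closure of the shrunk lens \<open>L s\<close> lies in \<open>\<Omega>\<close>, so there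
  \<open>u\<close> stays finite at the frontier; then \<open>s\<close> tends to 0 from the
  right.\<close>

proposition solution_le_lens_sol:
  assumes \<mu>: "0 < \<mu>" "\<mu> < 2" and b: "cmod b = 1" and \<kappa>: "\<kappa> > 0"
    and \<Omega>: "open \<Omega>" and u2: "C2_on u \<Omega>" and ul: "\<And>x. x \<in> \<Omega> \<Longrightarrow> laplacian u x = exp (2 * u x)"
    and sub: "lens \<mu> q b \<kappa> \<subseteq> \<Omega>" and x: "x \<in> lens \<mu> q b \<kappa>"
  shows "u x \<le> lens_sol \<mu> q b \<kappa> x"
proof -
  define L where "L s = lens \<mu> (q + of_real s * b) b (\<kappa> / (1 - 2 * \<kappa> * s))" for s
  define v where "v s = lens_sol \<mu> (q + of_real s * b) b (\<kappa> / (1 - 2 * \<kappa> * s))" for s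
  have S: "sin (\<mu> * pi / 2) > 0" using \<mu> by (intro sin_gt_zero) auto
  have uc: "continuous_on \<Omega> u" by (rule C2_on_continuous[OF u2])
  have le: "u x \<le> v s x" if s: "0 < s" "s \<le> 1 / (8 * \<kappa>)" and xs: "x \<in> L s" for s
  proof -
    have ks: "\<kappa> * s \<le> 1 / 8" using s \<kappa> by (simp add: field_simps)
    then have e: "1 - 2 * \<kappa> * s > 0" by simp
    then have k': "\<kappa> / (1 - 2 * \<kappa> * s) > 0" using \<kappa> by simp
    let ?K = "{z. cos (\<mu> * pi / 2) * \<bar>Im (lens_map q b \<kappa> z)\<bar> * (1 - 2 * \<kappa> * s)
      \<le> sin (\<mu> * pi / 2) * (Re (lens_map q b \<kappa> z) - s + \<kappa> * s\<^sup>2)}"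
    have "closed ?K" by (intro closed_Collect_le continuous_intros)
    then have "closure (L s) \<subseteq> ?K"
      by (intro closure_minimal) (auto simp: L_def lens_shift_iff[OF b e])
    also have "?K \<subseteq> lens \<mu> q b \<kappa>"
      using lens_shift_ineq[OF \<kappa> s(1) ks S] b by (auto simp: lens_def wedge_def Re_lens_map)
    finally have cl: "closure (L s) \<subseteq> \<Omega>" using sub by blast
    then have LO: "L s \<subseteq> \<Omega>" using closure_subset by blast
    have oL: "open (L s)" unfolding L_def by (rule open_lens)
    show ?thesis
    proof (rule liouville_comparison[of "L s"])
      show "open (L s)" "bounded (L s)"
        using oL lens_bounded[OF \<mu> b k'] by (auto simp: L_def)
      show "\<exists>d. line_deriv2 (v s) y c d" "laplacian (v s) y = exp (2 * v s y)" if "y \<in> L s" for y c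
        using laplacian_lens_sol[OF \<mu> b that[unfolded L_def]] by (auto simp: v_def)
      show "\<exists>d. line_deriv2 u y c d" "laplacian u y = exp (2 * u y)" if "y \<in> L s" for y c
        using C2_on_line_deriv2[OF u2 \<Omega>] ul LO that by auto
      show "continuous_on (L s) (v s)"
        using isCont_lens_sol[OF \<mu>] by (auto intro!: continuous_at_imp_continuous_on simp: v_def L_def)
      show "continuous_on (L s) u" using uc LO by (rule continuous_on_subset)
      show "x \<in> L s" by fact
      fix z assume z: "z \<in> frontier (L s)"
      then have "z \<in> \<Omega>" using cl by (auto simp: frontier_def)
      then have "isCont u z" using uc \<Omega> by (simp add: continuous_on_eq_continuous_at)
      then have "((\<lambda>y. - u y) \<longlongrightarrow> - u z) (at z within L s)"
        by (intro tendsto_intros) (simp add: continuous_at_imp_continuous_at_within continuous_within[symmetric])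
      moreover have "filterlim (v s) at_top (at z within L s)"
        using lens_sol_at_frontier[OF \<mu> z[unfolded L_def]] by (simp add: v_def L_def)
      ultimately have "filterlim (\<lambda>y. - u y + v s y) at_top (at z within L s)"
        by (rule filterlim_tendsto_add_at_top)
      then show "filterlim (\<lambda>y. v s y - u y) at_top (at z within L s)" by simp
    qed
  qed
  have "\<forall>\<^sub>F s in at_right 0. x \<in> L s"
  proof -
    let ?f = "\<lambda>s. sin (\<mu> * pi / 2) * (Re (lens_map q b \<kappa> x) - s + \<kappa> * s\<^sup>2)
        - cos (\<mu> * pi / 2) * \<bar>Im (lens_map q b \<kappa> x)\<bar> * (1 - 2 * \<kappa> * s)"
    have "(?f \<longlongrightarrow> ?f 0) (at_right 0)" by (intro tendsto_intros)
    moreover have "?f 0 > 0" using x by (simp add: lens_def wedge_def)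
    ultimately have "\<forall>\<^sub>F s in at_right 0. ?f s > 0" by (rule order_tendstoD)
    moreover have "((\<lambda>s. 1 - 2 * \<kappa> * s) \<longlongrightarrow> 1 - 2 * \<kappa> * 0) (at_right 0)" by (intro tendsto_intros)
    then have "\<forall>\<^sub>F s in at_right 0. 1 - 2 * \<kappa> * s > 0" by (rule order_tendstoD) simp
    ultimately show ?thesis by eventually_elim (simp add: L_def lens_shift_iff[OF b])
  qed
  moreover have "\<forall>\<^sub>F s in at_right 0. 0 < s \<and> s \<le> 1 / (8 * \<kappa>)"
    using \<kappa> unfolding eventually_at_right_field by (intro exI[of _ "1 / (8 * \<kappa>)"]) auto
  ultimately have "\<forall>\<^sub>F s in at_right 0. u x \<le> v s x"
    by eventually_elim (use le in blast)
  moreover have "((\<lambda>s. v s x) \<longlongrightarrow> lens_sol \<mu> q b \<kappa> x) (at_right 0)"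
    unfolding v_def by (rule lens_sol_shift_tendsto[OF \<mu> x])
  ultimately show ?thesis by (intro tendsto_lowerbound[of _ _ "at_right 0"]) auto
qed

text \<open>For \<open>\<kappa> < 0\<close> and \<open>s < 0\<close> the excluded lens shrinks, so
  \<open>L s\<close> contains the closure of \<open>\<Omega>\<close>. The lens solution is then
  finite on the frontier of \<open>\<Omega>\<close> while \<open>u\<close> blows up.\<close>

proposition lens_sol_le_solution:
  assumes \<mu>: "0 < \<mu>" "\<mu> < 2" and b: "cmod b = 1" and \<kappa>: "\<kappa> < 0"
    and \<Omega>: "open \<Omega>" "bounded \<Omega>" and u2: "C2_on u \<Omega>" and ul: "\<And>x. x \<in> \<Omega> \<Longrightarrow> laplacian u x = exp (2 * u x)"
    and ub: "\<And>z. z \<in> frontier \<Omega> \<Longrightarrow> filterlim u at_top (at z within \<Omega>)"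
    and sub: "\<And>z. z \<in> \<Omega> \<Longrightarrow> cos (\<mu> * pi / 2) * \<bar>Im (lens_map q b \<kappa> z)\<bar> \<le> sin (\<mu> * pi / 2) * Re (lens_map q b \<kappa> z)"
    and x: "x \<in> lens \<mu> q b \<kappa>" "x \<in> \<Omega>"
  shows "lens_sol \<mu> q b \<kappa> x \<le> u x"
proof -
  define L where "L s = lens \<mu> (q + of_real s * b) b (\<kappa> / (1 - 2 * \<kappa> * s))" for s
  define v where "v s = lens_sol \<mu> (q + of_real s * b) b (\<kappa> / (1 - 2 * \<kappa> * s))" for s
  have S: "sin (\<mu> * pi / 2) > 0" using \<mu> by (intro sin_gt_zero) auto
  have uc: "continuous_on \<Omega> u" by (rule C2_on_continuous[OF u2])
  have le: "v s x \<le> u x" if s: "s < 0" "s \<ge> 1 / (8 * \<kappa>)" for s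
  proof -
    have ks: "\<kappa> * s \<le> 1 / 8" using s \<kappa> by (simp add: field_simps)
    then have e: "1 - 2 * \<kappa> * s > 0" by simp
    let ?K = "{z. cos (\<mu> * pi / 2) * \<bar>Im (lens_map q b \<kappa> z)\<bar> \<le> sin (\<mu> * pi / 2) * Re (lens_map q b \<kappa> z)}"
    have "closed ?K" by (intro closed_Collect_le continuous_intros)
    then have "closure \<Omega> \<subseteq> ?K" using sub by (intro closure_minimal) auto
    also have "?K \<subseteq> L s"
    proof
      fix z assume z: "z \<in> ?K"
      define X where "X = Re ((z - q) * cnj b)"
      define Y where "Y = Im ((z - q) * cnj b)"
      show "z \<in> L s"
      proof (rule ccontr)
        assume "z \<notin> L s"
        \<comment> \<open>The excluded set is a lens of angle \<open>(2 - \<mu>) * pi\<close> on the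
          opposite ray. Changing the signs of the cosine, of \<open>X\<close>,
          \<open>\<kappa>\<close> and \<open>s\<close> brings it into the form of
          \<open>lens_shift_ineq\<close>.\<close>
        then have "- cos (\<mu> * pi / 2) * \<bar>Y\<bar> * (1 - 2 * (- \<kappa>) * (- s))
            \<le> sin (\<mu> * pi / 2) * (- X - (- \<kappa>) * ((- X)\<^sup>2 + Y\<^sup>2) - (- s) + (- \<kappa>) * (- s)\<^sup>2)"
          unfolding L_def lens_shift_iff[OF b e] Re_lens_map[OF b] X_def[symmetric] Y_def[symmetric]
          by (simp add: algebra_simps)
        from lens_shift_ineq[OF _ _ _ S this]
        have "- cos (\<mu> * pi / 2) * \<bar>Y\<bar> < sin (\<mu> * pi / 2) * (- X - (- \<kappa>) * ((- X)\<^sup>2 + Y\<^sup>2))"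
          using \<kappa> s ks by auto
        then show False using z unfolding mem_Collect_eq Re_lens_map[OF b] X_def[symmetric] Y_def[symmetric]
          by (simp add: algebra_simps)
      qed
    qed
    finally have cl: "closure \<Omega> \<subseteq> L s" .
    then have OL: "\<Omega> \<subseteq> L s" using closure_subset by blast
    show ?thesis
    proof (rule liouville_comparison[of \<Omega>])
      show "\<exists>d. line_deriv2 (v s) y c d" "laplacian (v s) y = exp (2 * v s y)" if "y \<in> \<Omega>" for y c
        using laplacian_lens_sol[OF \<mu> b] OL that by (auto simp: v_def L_def)
      show "\<exists>d. line_deriv2 u y c d" "laplacian u y = exp (2 * u y)" if "y \<in> \<Omega>" for y c
        using C2_on_line_deriv2[OF u2 \<Omega>(1)] ul that by auto
      show "continuous_on \<Omega> (v s)"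
        using isCont_lens_sol[OF \<mu>] OL by (auto intro!: continuous_at_imp_continuous_on simp: v_def L_def)
      fix z assume z: "z \<in> frontier \<Omega>"
      then have "z \<in> L s" using cl by (auto simp: frontier_def)
      then have "isCont (v s) z" using isCont_lens_sol[OF \<mu>] by (auto simp: v_def L_def)
      then have "((\<lambda>y. - v s y) \<longlongrightarrow> - v s z) (at z within \<Omega>)"
        by (intro tendsto_intros) (simp add: continuous_at_imp_continuous_at_within continuous_within[symmetric])
      from filterlim_tendsto_add_at_top[OF this ub[OF z]]
      show "filterlim (\<lambda>y. u y - v s y) at_top (at z within \<Omega>)" by simp
    qed fact+
  qed
  have "\<forall>\<^sub>F s in at_left 0. s < 0 \<and> s \<ge> 1 / (8 * \<kappa>)"
    using \<kappa> unfolding eventually_at_left_field by (intro exI[of _ "1 / (8 * \<kappa>)"]) auto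
  then have "\<forall>\<^sub>F s in at_left 0. v s x \<le> u x"
    by eventually_elim (use le in blast)
  moreover have "((\<lambda>s. v s x) \<longlongrightarrow> lens_sol \<mu> q b \<kappa> x) (at_left 0)"
    unfolding v_def by (rule lens_sol_shift_tendsto[OF \<mu> x(1)])
  ultimately show ?thesis by (intro tendsto_upperbound[of _ _ "at_left 0"]) auto
qed

subsection \<open>Estimates for the solution in a sector\<close>

lemma sin_ge_mult_cos:
  fixes x :: real
  assumes "0 \<le> x" "x \<le> pi"
  shows "x * cos x \<le> sin x"
proof (cases "x = 0")
  case False
  obtain z where z: "0 < z" "z < x" "sin x - sin 0 = (x - 0) * cos z"
    using MVT2[of 0 x sin cos] False assms by (auto intro: derivative_eq_intros)
  have "cos x \<le> cos z" using z assms by (intro cos_monotone_0_pi_le) auto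
  then have "x * cos x \<le> x * cos z" using assms by (intro mult_left_mono) auto
  then show ?thesis using z by simp
qed simp

text \<open>Each factor in \<open>2 * sin (y / 2) * cos (y / 2)\<close> contributes one constant
  \<open>cos (3 * pi / 8)\<close>. The range goes up to \<open>3 * pi / 4\<close> because angles up
  to \<open>pi / 2\<close> will be perturbed.\<close>

lemma sin_ge_linear:
  fixes y :: real
  assumes "0 \<le> y" "y \<le> 3 * pi / 4"
  shows "(cos (3 * pi / 8))\<^sup>2 * y \<le> sin y"
proof -
  define c where "c = cos (3 * pi / 8)"
  have c: "c > 0" unfolding c_def by (intro cos_gt_zero_pi) auto
  have cy: "c \<le> cos (y / 2)" unfolding c_def using assms by (intro cos_monotone_0_pi_le) auto
  have "y / 2 * c \<le> y / 2 * cos (y / 2)" using assms cy by (intro mult_left_mono) auto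
  also have "\<dots> \<le> sin (y / 2)" using assms by (intro sin_ge_mult_cos) auto
  finally have "2 * (y / 2 * c) * c \<le> 2 * sin (y / 2) * cos (y / 2)"
    using assms c cy sin_ge_zero[of "y / 2"] by (intro mult_mono) auto
  also have "\<dots> = sin y" using sin_double[of "y / 2"] by simp
  finally show ?thesis by (simp add: c_def power2_eq_square mult_ac)
qed

text \<open>The numerator \<open>sin y - y * cos y\<close> has derivative \<open>y * sin y\<close>
  and is of third order, while the denominator \<open>y * sin y\<close> is of second order.\<close>

lemma inverse_minus_cot_bound:
  fixes y :: real
  assumes "0 < y" "y \<le> 3 * pi / 4"
  shows "\<bar>1 / y - cos y / sin y\<bar> \<le> y / (cos (3 * pi / 8))\<^sup>2"
proof -
  define c where "c = (cos (3 * pi / 8))\<^sup>2"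
  have "cos (3 * pi / 8) > 0" by (intro cos_gt_zero_pi) auto
  then have c: "c > 0" by (simp add: c_def)
  have s: "c * y \<le> sin y" unfolding c_def using assms by (intro sin_ge_linear) auto
  then have sp: "sin y > 0" using c assms by (smt (verit) mult_pos_pos)
  obtain z where z: "0 < z" "z < y" "(sin y - y * cos y) - (sin 0 - 0 * cos 0) = (y - 0) * (z * sin z)"
  proof -
    have "((\<lambda>y. sin y - y * cos y) has_real_derivative x * sin x) (at x)" for x :: real
      by (auto intro!: derivative_eq_intros)
    from MVT2[OF assms(1) this] show ?thesis using that by blast
  qed
  have sz: "0 \<le> sin z" "sin z \<le> z" using z assms by (auto intro!: sin_ge_zero sin_x_le_x)
  have zz: "z * sin z \<le> y * y" using z sz by (intro mult_mono) auto
  have e: "1 / y - cos y / sin y = z * sin z / sin y"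
    using z assms sp by (simp add: field_simps)
  have "\<bar>1 / y - cos y / sin y\<bar> = z * sin z / sin y" unfolding e using z sz sp by simp
  also have "\<dots> \<le> (y * y) / (c * y)" using zz s sp c assms z sz by (intro frac_le) auto
  also have "\<dots> = y / c" using assms by simp
  finally show ?thesis by (simp add: c_def)
qed

text \<open>The logarithmic derivative of \<open>sin (x / \<mu>) / sin x\<close> is \<open>O(x)\<close>, because the poles \<open>1 / x\<close> of the two
  cotangents cancel.\<close>

lemma ln_sin_quotient_lipschitz:
  fixes \<mu> :: real
  assumes \<mu>: "0 < \<mu>"
  obtains K where "K > 0" "\<And>x y. 0 < x \<Longrightarrow> x \<le> 3 * pi / 4 \<Longrightarrow> x \<le> 3 * pi / 4 * \<mu> \<Longrightarrow>
      0 < y \<Longrightarrow> y \<le> 3 * pi / 4 \<Longrightarrow> y \<le> 3 * pi / 4 * \<mu> \<Longrightarrow>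
      \<bar>(ln (sin (x / \<mu>)) - ln (sin x)) - (ln (sin (y / \<mu>)) - ln (sin y))\<bar> \<le> K * max x y * \<bar>x - y\<bar>"
proof
  define c where "c = (cos (3 * pi / 8))\<^sup>2"
  have "cos (3 * pi / 8) > 0" by (intro cos_gt_zero_pi) auto
  then have c: "c > 0" by (simp add: c_def)
  define K where "K = (1 / \<mu>\<^sup>2 + 1) / c"
  show "K > 0" using c \<mu> by (simp add: K_def add_pos_pos)
  define g where "g x = ln (sin (x / \<mu>)) - ln (sin x)" for x
  define g' where "g' x = (1 / x - cos x / sin x) - (1 / (x / \<mu>) - cos (x / \<mu>) / sin (x / \<mu>)) / \<mu>" for x
  have der: "(g has_real_derivative g' z) (at z)" if "0 < z" "z \<le> 3 * pi / 4" "z \<le> 3 * pi / 4 * \<mu>" for z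
  proof -
    have "sin z > 0" using that by (intro sin_gt_zero) auto
    moreover have "sin (z / \<mu>) > 0"
    proof (intro sin_gt_zero)
      have "z / \<mu> \<le> 3 * pi / 4" using that \<mu> by (simp add: pos_divide_le_eq)
      then show "z / \<mu> < pi" using pi_gt_zero by linarith
    qed (use that \<mu> in simp)
    ultimately show ?thesis
      unfolding g_def g'_def using that \<mu>
      by (auto intro!: derivative_eq_intros simp: field_simps)
  qed
  have g'b: "\<bar>g' z\<bar> \<le> K * z" if "0 < z" "z \<le> 3 * pi / 4" "z \<le> 3 * pi / 4 * \<mu>" for z
  proof -
    have 1: "\<bar>1 / z - cos z / sin z\<bar> \<le> z / c" unfolding c_def using that by (intro inverse_minus_cot_bound)
    have 2: "\<bar>1 / (z / \<mu>) - cos (z / \<mu>) / sin (z / \<mu>)\<bar> \<le> (z / \<mu>) / c"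
      unfolding c_def using that \<mu> by (intro inverse_minus_cot_bound) (auto simp: pos_divide_le_eq)
    have "\<bar>g' z\<bar> \<le> \<bar>1 / z - cos z / sin z\<bar> + \<bar>(1 / (z / \<mu>) - cos (z / \<mu>) / sin (z / \<mu>)) / \<mu>\<bar>"
      unfolding g'_def by (rule abs_triangle_ineq4)
    also have "\<bar>(1 / (z / \<mu>) - cos (z / \<mu>) / sin (z / \<mu>)) / \<mu>\<bar> = \<bar>1 / (z / \<mu>) - cos (z / \<mu>) / sin (z / \<mu>)\<bar> / \<mu>"
      using \<mu> by (simp add: abs_div)
    also have "\<dots> \<le> (z / \<mu>) / c / \<mu>" using 2 \<mu> by (intro divide_right_mono) auto
    also have "\<bar>1 / z - cos z / sin z\<bar> + (z / \<mu>) / c / \<mu> \<le> z / c + (z / \<mu>) / c / \<mu>" using 1 by simp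
    also have "\<dots> = K * z" using c \<mu> by (simp add: K_def field_simps power2_eq_square)
    finally show ?thesis by simp
  qed
  have main: "\<bar>g y - g x\<bar> \<le> K * y * (y - x)"
    if "0 < x" "x < y" "y \<le> 3 * pi / 4" "y \<le> 3 * pi / 4 * \<mu>" for x y
  proof -
    obtain z where z: "x < z" "z < y" "g y - g x = (y - x) * g' z"
    proof -
      have "(g has_real_derivative g' z) (at z)" if "x \<le> z" "z \<le> y" for z
        using that \<open>0 < x\<close> \<open>y \<le> 3 * pi / 4\<close> \<open>y \<le> 3 * pi / 4 * \<mu>\<close> by (intro der) auto
      from MVT2[OF \<open>x < y\<close> this] show ?thesis using that by blast
    qed
    have "\<bar>g y - g x\<bar> = (y - x) * \<bar>g' z\<bar>" using z that by (simp add: abs_mult)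
    also have "\<dots> \<le> (y - x) * (K * z)" using g'b[of z] z that by (intro mult_left_mono) auto
    also have "\<dots> \<le> (y - x) * (K * y)" using z that \<open>K > 0\<close> by (intro mult_left_mono) auto
    finally show ?thesis by (simp add: mult_ac)
  qed
  show "\<bar>(ln (sin (x / \<mu>)) - ln (sin x)) - (ln (sin (y / \<mu>)) - ln (sin y))\<bar> \<le> K * max x y * \<bar>x - y\<bar>"
    if "0 < x" "x \<le> 3 * pi / 4" "x \<le> 3 * pi / 4 * \<mu>" "0 < y" "y \<le> 3 * pi / 4" "y \<le> 3 * pi / 4 * \<mu>" for x y
    unfolding g_def[symmetric]
    using main[of x y] main[of y x] that by (cases x y rule: linorder_cases) (auto simp: abs_minus_commute max_def)
qed

text \<open>Scaling \<open>A * cos A \<le> sin A\<close> by \<open>cmod w\<close> gives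
  \<open>\<bar>Arg w\<bar> * Re w \<le> \<bar>Im w\<bar>\<close>, and \<open>Re w\<close> is at
  least \<open>1 / 2\<close>.\<close>

lemma abs_Arg_le:
  assumes "cmod (w - 1) \<le> 1 / 2"
  shows "\<bar>Arg w\<bar> \<le> 2 * cmod (w - 1)" "w \<noteq> 0"
proof -
  have "\<bar>Re (w - 1)\<bar> \<le> cmod (w - 1)" "\<bar>Im (w - 1)\<bar> \<le> cmod (w - 1)"
    by (rule abs_Re_le_cmod abs_Im_le_cmod)+
  then have re: "Re w \<ge> 1 / 2" and im: "\<bar>Im w\<bar> \<le> cmod (w - 1)" using assms by auto
  then show "w \<noteq> 0" by auto
  define A where "A = \<bar>Arg w\<bar>"
  have A: "0 \<le> A" "A \<le> pi" using Arg_bounded[of w] by (auto simp: A_def)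
  have "Re w = cmod w * cos A" "\<bar>Im w\<bar> = cmod w * sin A"
  proof -
    have "sin A = \<bar>sin (Arg w)\<bar>" using A sin_ge_zero[of A] by (auto simp: A_def abs_if)
    moreover have "Re w = cmod w * cos (Arg w)" "Im w = cmod w * sin (Arg w)"
      using arg_cong[OF rcis_cmod_Arg[of w], of Re] arg_cong[OF rcis_cmod_Arg[of w], of Im] by simp_all
    ultimately show "Re w = cmod w * cos A" "\<bar>Im w\<bar> = cmod w * sin A"
      by (simp_all add: A_def abs_mult)
  qed
  moreover have "cmod w * (A * cos A) \<le> cmod w * sin A"
    using sin_ge_mult_cos[OF A] by (intro mult_left_mono) auto
  ultimately have "A * Re w \<le> \<bar>Im w\<bar>" by (simp add: mult_ac)
  moreover have "A * (1 / 2) \<le> A * Re w" using A re by (intro mult_left_mono) auto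
  ultimately show "\<bar>Arg w\<bar> \<le> 2 * cmod (w - 1)" using im by (simp add: A_def)
qed

text \<open>The angle is \<open>t\<close> plus the argument of the quotient of \<open>V\<close> by
  \<open>rcis r t\<close>. This quotient is near 1, so no branch problem arises even if
  \<open>t\<close> exceeds \<open>pi\<close>.\<close>

lemma polar_perturb:
  assumes r: "0 < r" and Br: "B * r \<le> 1 / 2" and V: "cmod (V - rcis r t) \<le> B * r\<^sup>2"
  obtains \<phi> where "V = rcis (cmod V) \<phi>" "\<bar>\<phi> - t\<bar> \<le> 2 * (B * r)" "\<bar>cmod V - r\<bar> \<le> B * r * r"
proof
  define w where "w = V / rcis r t"
  have nz: "rcis r t \<noteq> 0" using r by (simp add: rcis_def)
  have "w - 1 = (V - rcis r t) / rcis r t" using nz by (simp add: w_def diff_divide_distrib)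
  then have "cmod (w - 1) = cmod (V - rcis r t) / r" using r by (simp add: norm_divide)
  also have "\<dots> \<le> B * r\<^sup>2 / r" using V r by (intro divide_right_mono) auto
  finally have w: "cmod (w - 1) \<le> B * r" using r by (simp add: power2_eq_square)
  note A = abs_Arg_le[OF order_trans[OF w Br]]
  have "V = w * rcis r t" using nz by (simp add: w_def)
  also have "w = rcis (cmod w) (Arg w)" using rcis_cmod_Arg[of w] by simp
  finally have "V = rcis (cmod w * r) (Arg w + t)" by (simp add: rcis_mult)
  moreover from this have "cmod V = cmod w * r" using r by (simp add: abs_mult)
  ultimately show "V = rcis (cmod V) (t + Arg w)" by (simp add: add.commute)
  show "\<bar>t + Arg w - t\<bar> \<le> 2 * (B * r)" using A(1) w by simp
  have "\<bar>cmod V - cmod (rcis r t)\<bar> \<le> cmod (V - rcis r t)" by (rule norm_triangle_ineq3)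
  then show "\<bar>cmod V - r\<bar> \<le> B * r * r" using V r by (simp add: power2_eq_square mult.assoc)
qed

lemma wedge_weight_rcis:
  assumes \<mu>: "0 < \<mu>" "\<mu> < 2" and \<rho>: "\<rho> > 0" and \<phi>: "0 < \<phi>" "\<phi> < \<mu> * pi"
  shows "rcis \<rho> \<phi> * cis (- (\<mu> * pi / 2)) \<in> wedge \<mu>"
    and "wedge_weight \<mu> (rcis \<rho> \<phi> * cis (- (\<mu> * pi / 2))) = \<mu> * \<rho> * sin (\<phi> / \<mu>)"
proof -
  define W where "W = rcis \<rho> \<phi> * cis (- (\<mu> * pi / 2))"
  have W: "W = rcis \<rho> (\<phi> - \<mu> * pi / 2)" by (simp add: W_def rcis_def mult.assoc cis_mult)
  have "\<mu> * pi < 2 * pi" using \<mu> by simp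
  then have "\<phi> - \<mu> * pi / 2 \<in> {- pi<..pi}" using \<phi> unfolding greaterThanAtMost_iff by linarith
  then have A: "Arg W = \<phi> - \<mu> * pi / 2"
    unfolding W using \<rho> by (rule Arg_rcis)
  show "W \<in> wedge \<mu>" unfolding wedge_iff_Arg[OF \<mu>] A
  proof
    show "W \<noteq> 0" using \<rho> by (simp add: W)
    show "\<bar>\<phi> - \<mu> * pi / 2\<bar> < \<mu> * pi / 2" using \<phi> unfolding abs_less_iff by linarith
  qed
  have "(\<phi> - \<mu> * pi / 2) / \<mu> = \<phi> / \<mu> - pi / 2" using \<mu> by (simp add: field_simps)
  then have "cos ((\<phi> - \<mu> * pi / 2) / \<mu>) = sin (\<phi> / \<mu>)" by (simp add: cos_diff)
  then show "wedge_weight \<mu> W = \<mu> * \<rho> * sin (\<phi> / \<mu>)"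
    using \<rho> unfolding wedge_weight_def A by (simp add: W)
qed

lemma abs_ln_le:
  fixes x :: real
  assumes "\<bar>x - 1\<bar> \<le> 1 / 2"
  shows "\<bar>ln x\<bar> \<le> 2 * \<bar>x - 1\<bar>"
proof -
  define h where "h = x - 1"
  have "\<bar>ln (1 + h) - h\<bar> \<le> 2 * h\<^sup>2" using assms by (intro abs_ln_one_plus_x_minus_x_bound) (simp add: h_def)
  moreover have "2 * h\<^sup>2 \<le> \<bar>h\<bar>"
    using mult_right_mono[of "\<bar>h\<bar>" "1/2" "\<bar>h\<bar>"] assms by (simp add: h_def power2_eq_square)
  ultimately have "\<bar>ln (1 + h)\<bar> \<le> 2 * \<bar>h\<bar>" by linarith
  then show ?thesis by (simp add: h_def)
qed

text \<open>The weight is \<open>\<mu> * Im V * sin (\<phi> / \<mu>) / sin \<phi>\<close>. The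
  factor \<open>Im V\<close> is known to relative precision O(d) with \<open>d = r * sin t\<close>.
  The quotient has logarithmic derivative O(\<phi>): an angle error O(r) times an angle of size O(d
  / r) is O(d). This is why \<open>Im V\<close> is prescribed more precisely than
  \<open>V\<close>.\<close>

lemma wedge_weight_near_side:
  fixes \<mu> B :: real
  assumes \<mu>: "0 < \<mu>" "\<mu> < 2" and B: "B > 0"
  obtains \<delta> C where "\<delta> > 0" "C > 0" "\<And>r t V k. 0 < r \<Longrightarrow> r < \<delta> \<Longrightarrow> 0 < t \<Longrightarrow> t \<le> pi / 2 \<Longrightarrow> t \<le> 5 * pi / 8 * \<mu> \<Longrightarrow>
      \<bar>k\<bar> \<le> B \<Longrightarrow> cmod (V - rcis r t) \<le> B * r\<^sup>2 \<Longrightarrow> Im V = r * sin t + k * (r * sin t)\<^sup>2 \<Longrightarrow>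
      V * cis (- (\<mu> * pi / 2)) \<in> wedge \<mu> \<and>
      \<bar>ln (wedge_weight \<mu> (V * cis (- (\<mu> * pi / 2)))) - ln (\<mu> * r * sin (t / \<mu>))\<bar> \<le> C * (r * sin t)"
proof -
  define c where "c = (cos (3 * pi / 8))\<^sup>2"
  have "cos (3 * pi / 8) > 0" by (intro cos_gt_zero_pi) auto
  then have c: "c > 0" by (simp add: c_def)
  obtain K where K: "K > 0" "\<And>x y. 0 < x \<Longrightarrow> x \<le> 3 * pi / 4 \<Longrightarrow> x \<le> 3 * pi / 4 * \<mu> \<Longrightarrow>
      0 < y \<Longrightarrow> y \<le> 3 * pi / 4 \<Longrightarrow> y \<le> 3 * pi / 4 * \<mu> \<Longrightarrow>
      \<bar>(ln (sin (x / \<mu>)) - ln (sin x)) - (ln (sin (y / \<mu>)) - ln (sin y))\<bar> \<le> K * max x y * \<bar>x - y\<bar>"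
    using ln_sin_quotient_lipschitz[OF \<mu>(1)] by metis
  \<comment> \<open>The bounds \<open>pi / 8\<close> and \<open>\<mu> * pi / 8\<close> keep the
    perturbed angle below \<open>3 * pi / 4\<close> and \<open>3 * pi / 4 * \<mu>\<close>; the bound
    \<open>1 / 2\<close> serves \<open>polar_perturb\<close>.\<close>
  define \<epsilon> where "\<epsilon> = min (1 / 2) (min (pi / 8) (\<mu> * pi / 8))"
  have \<epsilon>: "\<epsilon> > 0" "\<epsilon> \<le> 1 / 2" "\<epsilon> \<le> pi / 8" "\<epsilon> \<le> \<mu> * pi / 8" using \<mu> by (auto simp: \<epsilon>_def)
  define \<delta> where "\<delta> = \<epsilon> / (2 * B)"
  define C where "C = 2 * B + 6 * K * B / c"
  show ?thesis
  proof (rule that)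
    show "\<delta> > 0" "C > 0" using \<epsilon> B K c by (auto simp: \<delta>_def C_def add_pos_pos)
    fix r t V k
    assume r: "0 < r" "r < \<delta>" and t: "0 < t" "t \<le> pi / 2" "t \<le> 5 * pi / 8 * \<mu>" and k: "\<bar>k\<bar> \<le> B"
      and V: "cmod (V - rcis r t) \<le> B * r\<^sup>2" and Im: "Im V = r * sin t + k * (r * sin t)\<^sup>2"
    define d where "d = r * sin t"
    have st: "sin t > 0" using t by (intro sin_gt_zero) auto
    have d: "0 < d" "d \<le> r" using st r by (auto simp: d_def mult_le_cancel_left1)
    have Br: "2 * (B * r) \<le> \<epsilon>" using r B by (simp add: \<delta>_def field_simps)
    have Br': "B * r \<le> 1 / 2" using Br \<epsilon> by linarith
    obtain \<phi> where \<phi>: "V = rcis (cmod V) \<phi>" "\<bar>\<phi> - t\<bar> \<le> 2 * (B * r)" "\<bar>cmod V - r\<bar> \<le> B * r * r"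
      using polar_perturb[OF r(1) Br' V] by metis
    have "B * r * r \<le> 1 / 2 * r" using Br' r by (intro mult_right_mono) auto
    then have Vr: "cmod V \<ge> r / 2" using \<phi>(3) by linarith
    then have V0: "cmod V > 0" using r by linarith
    have kd: "\<bar>k * d\<bar> \<le> B * d" using k d by (simp add: abs_mult mult_right_mono)
    have Bd: "B * d \<le> B * r" using d B by simp
    have kd2: "\<bar>k * d\<bar> \<le> 1 / 2" using kd Bd Br' by linarith
    have ImV: "Im V = d * (1 + k * d)" using Im by (simp add: d_def power2_eq_square algebra_simps)
    have ImV1: "Im V > 0" "Im V \<le> d * (3 / 2)"
      unfolding ImV using kd2 d by (auto intro!: mult_pos_pos mult_left_mono simp: abs_le_iff)
    have sv: "Im V = cmod V * sin \<phi>" by (subst \<phi>(1)) simp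
    then have s\<phi>: "sin \<phi> > 0" using ImV1 V0 by (simp add: zero_less_mult_iff)
    have \<phi>b: "\<phi> \<le> t + \<epsilon>" "\<phi> \<ge> t - \<epsilon>" using \<phi>(2) Br by (auto simp: abs_le_iff)
    \<comment> \<open>Closeness to \<open>t\<close> cannot give this, since \<open>t\<close> may be
      far smaller than the error. The sign comes from \<open>Im V > 0\<close>.\<close>
    have \<phi>0: "\<phi> > 0"
    proof (rule ccontr)
      assume "\<not> \<phi> > 0"
      then have "sin (- \<phi>) \<ge> 0" using \<phi>b t \<epsilon> pi_gt_zero by (intro sin_ge_zero) linarith+
      then show False using s\<phi> by simp
    qed
    have \<phi>1: "\<phi> \<le> 3 * pi / 4" using \<phi>b t \<epsilon> pi_gt_zero by linarith
    have \<phi>2: "\<phi> \<le> 3 * pi / 4 * \<mu>"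
    proof -
      have "\<phi> \<le> 5 * pi / 8 * \<mu> + \<mu> * pi / 8" using \<phi>b t \<epsilon> by linarith
      also have "\<dots> = 3 * pi / 4 * \<mu>" by (simp add: field_simps)
      finally show ?thesis .
    qed
    have t1: "t \<le> 3 * pi / 4" using t pi_gt_zero by linarith
    have t2: "t \<le> 3 * pi / 4 * \<mu>"
    proof -
      have "5 * pi / 8 * \<mu> \<le> 3 * pi / 4 * \<mu>" using \<mu> by simp
      with t show ?thesis by linarith
    qed
    have "\<phi> < \<mu> * pi"
    proof -
      have "3 * pi / 4 * \<mu> < \<mu> * pi" using \<mu> by simp
      with \<phi>2 show ?thesis by linarith
    qed
    note ww = wedge_weight_rcis[OF \<mu> V0 \<phi>0 this, folded \<phi>(1)]
    have pos: "sin (x / \<mu>) > 0" if "0 < x" "x \<le> 3 * pi / 4 * \<mu>" for x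
    proof (intro sin_gt_zero)
      have "x / \<mu> \<le> 3 * pi / 4" using that \<mu> by (simp add: pos_divide_le_eq)
      then show "x / \<mu> < pi" using pi_gt_zero by linarith
    qed (use that \<mu> in simp)
    define g where "g x = ln (sin (x / \<mu>)) - ln (sin x)" for x
    have l1: "ln (wedge_weight \<mu> (V * cis (- (\<mu> * pi / 2)))) = ln \<mu> + ln (Im V) + g \<phi>"
      unfolding ww(2) sv g_def using \<mu> V0 s\<phi> pos[OF \<phi>0 \<phi>2] by (simp add: ln_mult)
    have l2: "ln (\<mu> * r * sin (t / \<mu>)) = ln \<mu> + ln d + g t"
      unfolding d_def g_def using \<mu> r st pos[OF t(1) t2] by (simp add: ln_mult)
    have l3: "ln (Im V) = ln d + ln (1 + k * d)"
      unfolding ImV using d kd2 by (subst ln_mult) (auto simp: abs_le_iff)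
    have l4: "\<bar>ln (1 + k * d)\<bar> \<le> 2 * (B * d)"
      using abs_ln_le[of "1 + k * d"] kd kd2 by simp
    have t3: "t \<le> 3 * d / (r * c)"
    proof -
      have "c * t \<le> sin t" unfolding c_def using t t1 by (intro sin_ge_linear) auto
      then have "t \<le> d / (r * c)" using c r by (simp add: d_def field_simps)
      also have "\<dots> \<le> 3 * d / (r * c)" using c r d by (intro divide_right_mono) auto
      finally show ?thesis .
    qed
    have \<phi>3: "\<phi> \<le> 3 * d / (r * c)"
    proof -
      have "c * \<phi> \<le> sin \<phi>" unfolding c_def using \<phi>0 \<phi>1 by (intro sin_ge_linear) auto
      then have "cmod V * (c * \<phi>) \<le> Im V" unfolding sv using V0 by (intro mult_left_mono) auto
      moreover have "r / 2 * (c * \<phi>) \<le> cmod V * (c * \<phi>)" using Vr c \<phi>0 by (intro mult_right_mono) auto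
      ultimately have "r / 2 * (c * \<phi>) \<le> d * (3 / 2)" using ImV1 by linarith
      then show ?thesis using c r by (simp add: field_simps)
    qed
    have "\<bar>g \<phi> - g t\<bar> \<le> K * max \<phi> t * \<bar>\<phi> - t\<bar>"
      unfolding g_def using K(2) \<phi>0 \<phi>1 \<phi>2 t(1) t1 t2 by blast
    also have "\<dots> \<le> K * (3 * d / (r * c)) * (2 * (B * r))"
    proof (intro mult_mono)
      show "0 \<le> K * (3 * d / (r * c))" using K(1) d(1) r c by simp
    qed (use K(1) t3 \<phi>3 \<phi>(2) t in auto)
    also have "\<dots> = 6 * K * B / c * d" using r c by (simp add: field_simps)
    finally have l5: "\<bar>g \<phi> - g t\<bar> \<le> 6 * K * B / c * d" .
    have "\<bar>ln (wedge_weight \<mu> (V * cis (- (\<mu> * pi / 2)))) - ln (\<mu> * r * sin (t / \<mu>))\<bar> \<le> 2 * (B * d) + 6 * K * B / c * d"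
      unfolding l1 l2 l3 using l4 l5 by linarith
    also have "\<dots> = C * d" by (simp add: C_def algebra_simps)
    finally show "V * cis (- (\<mu> * pi / 2)) \<in> wedge \<mu> \<and>
      \<bar>ln (wedge_weight \<mu> (V * cis (- (\<mu> * pi / 2)))) - ln (\<mu> * r * sin (t / \<mu>))\<bar> \<le> C * (r * sin t)"
      using ww(1) by (simp add: d_def)
  qed
qed

text \<open>The perturbed angle divided by \<open>\<mu>\<close> stays at least
  \<open>pi / (4 * \<mu>)\<close> away from 0 and \<open>pi\<close>, where \<open>ln (sin y)\<close>
  is Lipschitz. The error O(r) is enough, because in this angular range the nearest boundary point
  will be the corner.\<close>

lemma wedge_weight_interior:
  fixes \<mu> B :: real
  assumes \<mu>: "1 \<le> \<mu>" "\<mu> < 2" and B: "B > 0"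
  obtains \<delta> C where "\<delta> > 0" "C > 0" "\<And>r t V. 0 < r \<Longrightarrow> r < \<delta> \<Longrightarrow> pi / 2 \<le> t \<Longrightarrow> t \<le> \<mu> * pi - pi / 2 \<Longrightarrow>
      cmod (V - rcis r t) \<le> B * r\<^sup>2 \<Longrightarrow>
      V * cis (- (\<mu> * pi / 2)) \<in> wedge \<mu> \<and>
      \<bar>ln (wedge_weight \<mu> (V * cis (- (\<mu> * pi / 2)))) - ln (\<mu> * r * sin (t / \<mu>))\<bar> \<le> C * r"
proof -
  have \<mu>': "0 < \<mu>" using \<mu> by simp
  define \<epsilon> where "\<epsilon> = min (1 / 2) (pi / 4)"
  have \<epsilon>: "\<epsilon> > 0" "\<epsilon> \<le> 1 / 2" "\<epsilon> \<le> pi / 4" by (auto simp: \<epsilon>_def)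
  define \<delta> where "\<delta> = \<epsilon> / (2 * B)"
  define m where "m = sin (pi / (4 * \<mu>))"
  have pm: "0 < pi / (4 * \<mu>)" "pi / (4 * \<mu>) \<le> pi / 4" using \<mu> by (auto simp: field_simps)
  have m: "m > 0" unfolding m_def using pm pi_gt_zero by (intro sin_gt_zero) linarith+
  define C where "C = 2 * B + 2 * B / (m * \<mu>)"
  have sin_ge: "m \<le> sin y" if "pi / (4 * \<mu>) \<le> y" "y \<le> pi - pi / (4 * \<mu>)" for y
  proof (cases "y \<le> pi / 2")
    case True
    then show ?thesis unfolding m_def using that pm pi_gt_zero by (intro sin_monotone_2pi_le) linarith+
  next
    case False
    have "m \<le> sin (pi - y)" unfolding m_def using that pm pi_gt_zero False by (intro sin_monotone_2pi_le) linarith+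
    then show ?thesis by simp
  qed
  have lnsin: "\<bar>ln (sin y) - ln (sin x)\<bar> \<le> (y - x) / m"
    if "pi / (4 * \<mu>) \<le> x" "x < y" "y \<le> pi - pi / (4 * \<mu>)" for x y
  proof -
    have "((\<lambda>z. ln (sin z)) has_real_derivative cos z / sin z) (at z)" if "x \<le> z" "z \<le> y" for z
      using sin_ge[of z] m that \<open>pi / (4 * \<mu>) \<le> x\<close> \<open>y \<le> pi - pi / (4 * \<mu>)\<close>
      by (auto intro!: derivative_eq_intros simp: field_simps)
    from MVT2[OF \<open>x < y\<close> this] obtain z where z: "x < z" "z < y" "ln (sin y) - ln (sin x) = (y - x) * (cos z / sin z)"
      by blast
    have sz: "m \<le> sin z" using sin_ge[of z] z that by auto
    have "\<bar>cos z / sin z\<bar> = \<bar>cos z\<bar> / sin z" using sz m by (simp add: abs_div)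
    also have "\<dots> \<le> 1 / m" using sz m by (intro frac_le) auto
    finally have "\<bar>cos z / sin z\<bar> \<le> 1 / m" .
    then have "(y - x) * \<bar>cos z / sin z\<bar> \<le> (y - x) * (1 / m)" using that by (intro mult_left_mono) auto
    then show ?thesis unfolding z(3) abs_mult using that by simp
  qed
  have lnsin': "\<bar>ln (sin y) - ln (sin x)\<bar> \<le> \<bar>y - x\<bar> / m"
    if "pi / (4 * \<mu>) \<le> x" "x \<le> pi - pi / (4 * \<mu>)" "pi / (4 * \<mu>) \<le> y" "y \<le> pi - pi / (4 * \<mu>)" for x y
    using lnsin[of x y] lnsin[of y x] that by (cases x y rule: linorder_cases) (auto simp: abs_minus_commute)
  show ?thesis
  proof (rule that)
    show "\<delta> > 0" "C > 0" using \<epsilon> B m \<mu>' by (auto simp: \<delta>_def C_def add_pos_pos)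
    fix r t V
    assume r: "0 < r" "r < \<delta>" and t: "pi / 2 \<le> t" "t \<le> \<mu> * pi - pi / 2"
      and V: "cmod (V - rcis r t) \<le> B * r\<^sup>2"
    have Br: "2 * (B * r) \<le> \<epsilon>" using r B by (simp add: \<delta>_def field_simps)
    have Br': "B * r \<le> 1 / 2" using Br \<epsilon> by linarith
    obtain \<phi> where \<phi>: "V = rcis (cmod V) \<phi>" "\<bar>\<phi> - t\<bar> \<le> 2 * (B * r)" "\<bar>cmod V - r\<bar> \<le> B * r * r"
      using polar_perturb[OF r(1) Br' V] by metis
    have "B * r * r \<le> 1 / 2 * r" using Br' r by (intro mult_right_mono) auto
    then have V0: "cmod V > 0" using \<phi>(3) r by linarith
    have \<phi>b: "\<phi> \<le> t + pi / 4" "\<phi> \<ge> t - pi / 4" using \<phi>(2) Br \<epsilon> by (auto simp: abs_le_iff)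
    then have \<phi>r: "pi / 4 \<le> \<phi>" "\<phi> \<le> \<mu> * pi - pi / 4" using t by linarith+
    have ww: "V * cis (- (\<mu> * pi / 2)) \<in> wedge \<mu>"
      "wedge_weight \<mu> (V * cis (- (\<mu> * pi / 2))) = \<mu> * cmod V * sin (\<phi> / \<mu>)"
      using wedge_weight_rcis[OF \<mu>' \<mu>(2) V0, of \<phi>] \<phi>r pi_gt_zero \<phi>(1) by auto
    have rng: "pi / (4 * \<mu>) \<le> x / \<mu>" "x / \<mu> \<le> pi - pi / (4 * \<mu>)"
      if "pi / 4 \<le> x" "x \<le> \<mu> * pi - pi / 4" for x
      using that \<mu>' by (simp_all add: field_simps)
    have tr: "pi / 4 \<le> t" "t \<le> \<mu> * pi - pi / 4" using t pi_gt_zero by linarith+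
    have sp: "sin (\<phi> / \<mu>) > 0" "sin (t / \<mu>) > 0"
      using sin_ge[OF rng[OF \<phi>r]] sin_ge[OF rng[OF tr]] m by linarith+
    have e: "ln (wedge_weight \<mu> (V * cis (- (\<mu> * pi / 2)))) - ln (\<mu> * r * sin (t / \<mu>))
        = ln (cmod V / r) + (ln (sin (\<phi> / \<mu>)) - ln (sin (t / \<mu>)))"
      unfolding ww(2) using \<mu>' V0 r sp by (simp add: ln_mult ln_div)
    have vr: "\<bar>cmod V / r - 1\<bar> \<le> B * r"
    proof -
      have "\<bar>cmod V / r - 1\<bar> = \<bar>cmod V - r\<bar> / r" using r by (simp add: field_simps abs_div)
      also have "\<dots> \<le> B * r" using \<phi>(3) r by (simp add: pos_divide_le_eq)
      finally show ?thesis .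
    qed
    have "\<bar>ln (cmod V / r)\<bar> \<le> 2 * (B * r)"
      by (rule order_trans[OF abs_ln_le[OF order_trans[OF vr Br']] mult_left_mono[OF vr]]) simp
    moreover have "\<bar>ln (sin (\<phi> / \<mu>)) - ln (sin (t / \<mu>))\<bar> \<le> 2 * (B * r) / \<mu> / m"
    proof -
      have "\<bar>ln (sin (\<phi> / \<mu>)) - ln (sin (t / \<mu>))\<bar> \<le> \<bar>\<phi> / \<mu> - t / \<mu>\<bar> / m"
        by (rule lnsin'[OF rng[OF tr] rng[OF \<phi>r]])
      also have "\<bar>\<phi> / \<mu> - t / \<mu>\<bar> = \<bar>\<phi> - t\<bar> / \<mu>" using \<mu>' by (simp add: diff_divide_distrib[symmetric] abs_div)
      also have "\<bar>\<phi> - t\<bar> / \<mu> / m \<le> 2 * (B * r) / \<mu> / m" using \<phi>(2) \<mu>' m by (intro divide_right_mono) auto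
      finally show ?thesis .
    qed
    ultimately have "\<bar>ln (wedge_weight \<mu> (V * cis (- (\<mu> * pi / 2)))) - ln (\<mu> * r * sin (t / \<mu>))\<bar>
        \<le> 2 * (B * r) + 2 * (B * r) / \<mu> / m"
      unfolding e by linarith
    also have "\<dots> = C * r" using \<mu>' m by (simp add: C_def field_simps)
    finally show "V * cis (- (\<mu> * pi / 2)) \<in> wedge \<mu> \<and>
      \<bar>ln (wedge_weight \<mu> (V * cis (- (\<mu> * pi / 2)))) - ln (\<mu> * r * sin (t / \<mu>))\<bar> \<le> C * r"
      using ww(1) by simp
  qed
qed

subsection \<open>Lenses along two curves\<close>

text \<open>Dividing the curvature by the sine gives both sides the same coefficient
  \<open>k\<close>: each expression vanishes on a circle of radius \<open>1 / (2 * k)\<close>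
  through \<open>q\<close> if \<open>k > 0\<close>. By the last identity, turning \<open>W\<close>
  so that the first side becomes real makes its imaginary part the equation of the first
  circle.\<close>

lemma lens_sides:
  fixes \<mu> k :: real and q e :: complex
  assumes \<mu>: "0 < \<mu>" "\<mu> < 2" and e: "cmod e = 1"
  defines "W z \<equiv> lens_map q (e * cis (\<mu> * pi / 2)) (k / sin (\<mu> * pi / 2)) z"
  shows "sin (\<mu> * pi / 2) * Re (W z) + cos (\<mu> * pi / 2) * Im (W z) = Im ((z - q) * cnj e) - k * (cmod (z - q))\<^sup>2"
    and "sin (\<mu> * pi / 2) * Re (W z) - cos (\<mu> * pi / 2) * Im (W z)
      = - Im ((z - q) * cnj e * cis (- (\<mu> * pi))) - k * (cmod (z - q))\<^sup>2"
    and "Im (W z * cis (\<mu> * pi / 2)) = Im ((z - q) * cnj e) - k * (cmod (z - q))\<^sup>2"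
proof -
  define S where "S = sin (\<mu> * pi / 2)"
  define C where "C = cos (\<mu> * pi / 2)"
  define X where "X = Re ((z - q) * cnj e)"
  define Y where "Y = Im ((z - q) * cnj e)"
  have S: "S > 0" unfolding S_def using \<mu> by (intro sin_gt_zero) auto
  have sc: "S * S = 1 - C * C" using sin_cos_squared_add[of "\<mu> * pi / 2"] by (simp add: S_def C_def power2_eq_square)
  have "(z - q) * cnj (e * cis (\<mu> * pi / 2)) = Complex X Y * cis (- (\<mu> * pi / 2))"
    unfolding X_def Y_def complex_surj by (simp add: cis_cnj)
  then have W: "W z = Complex X Y * cis (- (\<mu> * pi / 2)) - of_real (k / S * (cmod (z - q))\<^sup>2)"
    by (simp add: W_def lens_map_def S_def)
  have re: "Re (W z) = X * C + Y * S - k / S * (cmod (z - q))\<^sup>2" and im: "Im (W z) = Y * C - X * S"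
    by (simp_all add: W S_def C_def)
  have kS: "S * (k / S * (cmod (z - q))\<^sup>2) = k * (cmod (z - q))\<^sup>2" using S by simp
  have "S * Re (W z) + C * Im (W z) = Y * (S * S) + Y * (C * C) - S * (k / S * (cmod (z - q))\<^sup>2)"
    unfolding re im by (simp add: algebra_simps)
  then show 1: "S * Re (W z) + C * Im (W z) = Im ((z - q) * cnj e) - k * (cmod (z - q))\<^sup>2"
    unfolding kS sc Y_def[symmetric] by (simp add: algebra_simps)
  then show "Im (W z * cis (\<mu> * pi / 2)) = Im ((z - q) * cnj e) - k * (cmod (z - q))\<^sup>2"
    by (simp add: S_def C_def algebra_simps)
  have d: "sin (\<mu> * pi) = 2 * S * C" "cos (\<mu> * pi) = C * C - S * S"
    using sin_double[of "\<mu> * pi / 2"] cos_double[of "\<mu> * pi / 2"] by (simp_all add: S_def C_def power2_eq_square)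
  have eq: "(z - q) * cnj e * cis (- (\<mu> * pi)) = Complex X Y * cis (- (\<mu> * pi))"
    unfolding X_def Y_def complex_surj ..
  have "- Im (Complex X Y * cis (- (\<mu> * pi))) = X * sin (\<mu> * pi) - Y * cos (\<mu> * pi)" by simp
  then have "- Im ((z - q) * cnj e * cis (- (\<mu> * pi))) = X * (2 * S * C) + Y * (S * S) - Y * (C * C)"
    unfolding eq d by (simp add: algebra_simps)
  then show "S * Re (W z) - C * Im (W z) = - Im ((z - q) * cnj e * cis (- (\<mu> * pi))) - k * (cmod (z - q))\<^sup>2"
    unfolding re im kS[symmetric] by (simp add: algebra_simps)
qed

text \<open>With \<open>C = cos (\<mu> * pi / 2)\<close>, the term \<open>C * \<bar>y\<bar>\<close>
  is the maximum of \<open>C * y\<close> and \<open>- (C * y)\<close> if \<open>C \<ge> 0\<close>,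
  and the minimum otherwise. So an obtuse lens is a union and any other an intersection.\<close>

lemma mem_lens_iff_sides:
  fixes \<mu> k :: real and q e :: complex
  assumes \<mu>: "0 < \<mu>" "\<mu> < 2" and e: "cmod e = 1"
  defines "A z \<equiv> Im ((z - q) * cnj e) - k * (cmod (z - q))\<^sup>2"
    and "B z \<equiv> - Im ((z - q) * cnj e * cis (- (\<mu> * pi))) - k * (cmod (z - q))\<^sup>2"
  shows "z \<in> lens \<mu> q (e * cis (\<mu> * pi / 2)) (k / sin (\<mu> * pi / 2)) \<longleftrightarrow>
    (if \<mu> \<le> 1 then A z > 0 \<and> B z > 0 else A z > 0 \<or> B z > 0)"
proof -
  note s = lens_sides(1,2)[OF \<mu> e, where q = q and k = k and z = z]
  show ?thesis
  proof (cases "\<mu> \<le> 1")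
    case True
    have "cos (\<mu> * pi / 2) \<ge> 0" using True \<mu> by (intro cos_ge_zero) (auto intro: order_trans[of _ 0])
    then have "cos (\<mu> * pi / 2) * \<bar>y\<bar> = max (cos (\<mu> * pi / 2) * y) (- (cos (\<mu> * pi / 2) * y))" for y
      by (auto simp: abs_if max_def mult_le_0_iff zero_le_mult_iff)
    then show ?thesis using True s by (auto simp: lens_def wedge_def A_def B_def)
  next
    case False
    have "cos (\<mu> * pi / 2) < 0" using False \<mu> using cos_lt_zero_pi[of "\<mu> * pi / 2"] by simp
    then have "cos (\<mu> * pi / 2) * \<bar>y\<bar> = min (cos (\<mu> * pi / 2) * y) (- (cos (\<mu> * pi / 2) * y))" for y
      by (auto simp: abs_if min_def mult_le_0_iff zero_le_mult_iff)
    then show ?thesis using False s by (auto simp: lens_def wedge_def A_def B_def min_less_iff_disj)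
  qed
qed

text \<open>Completing the square: the disc touches the line through \<open>q\<close> in direction
  \<open>f\<close> from the left.\<close>

lemma half_plane_ball:
  fixes k :: real
  assumes f: "cmod f = 1" and k: "k > 0"
  shows "{z. Im ((z - q) * cnj f) - k * (cmod (z - q))\<^sup>2 > 0} = ball (q + \<i> * f / of_real (2 * k)) (1 / (2 * k))"
proof -
  have "(Im ((z - q) * cnj f) - k * (cmod (z - q))\<^sup>2 > 0) \<longleftrightarrow> z \<in> ball (q + \<i> * f / of_real (2 * k)) (1 / (2 * k))" for z
  proof -
    define v where "v = z - q"
    define g where "g = \<i> * f / of_real (2 * k)"
    have g: "cmod g = 1 / (2 * k)" using f k by (simp add: g_def norm_mult norm_divide)
    have gv: "Re v * Re g + Im v * Im g = Im (v * cnj f) / (2 * k)"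
      using k by (simp add: g_def Re_divide Im_divide power2_eq_square field_simps)
    have "(cmod (v - g))\<^sup>2 = (cmod v)\<^sup>2 - 2 * (Re v * Re g + Im v * Im g) + (cmod g)\<^sup>2"
      by (simp only: cmod_power2) (simp add: power2_eq_square algebra_simps)
    then have "(cmod (v - g))\<^sup>2 - (1 / (2 * k))\<^sup>2 = (k * (cmod v)\<^sup>2 - Im (v * cnj f)) / k"
      unfolding gv g using k by (simp add: field_simps)
    moreover have "cmod (v - g) < 1 / (2 * k) \<longleftrightarrow> (cmod (v - g))\<^sup>2 < (1 / (2 * k))\<^sup>2"
      using k by (auto intro: power_strict_mono dest: power_less_imp_less_base)
    ultimately have "cmod (v - g) < 1 / (2 * k) \<longleftrightarrow> (k * (cmod v)\<^sup>2 - Im (v * cnj f)) / k < 0"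
      by auto
    also have "\<dots> \<longleftrightarrow> Im (v * cnj f) - k * (cmod v)\<^sup>2 > 0" using k by (simp add: divide_less_0_iff)
    finally show ?thesis by (simp add: v_def g_def dist_norm norm_minus_commute algebra_simps)
  qed
  then show ?thesis by blast
qed

lemma connected_lens:
  fixes \<mu> k :: real
  assumes \<mu>: "0 < \<mu>" "\<mu> < 2" and e: "cmod e = 1" and k: "k > 0"
  shows "connected (lens \<mu> q (e * cis (\<mu> * pi / 2)) (k / sin (\<mu> * pi / 2)))"
proof -
  let ?L = "lens \<mu> q (e * cis (\<mu> * pi / 2)) (k / sin (\<mu> * pi / 2))"
  define A where "A = {z. Im ((z - q) * cnj e) - k * (cmod (z - q))\<^sup>2 > 0}"
  define B where "B = {z. - Im ((z - q) * cnj e * cis (- (\<mu> * pi))) - k * (cmod (z - q))\<^sup>2 > 0}"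
  define S where "S = sin (\<mu> * pi / 2)"
  have S: "S > 0" unfolding S_def using \<mu> by (intro sin_gt_zero) auto
  have A: "convex A" unfolding A_def half_plane_ball[OF e k] by (rule convex_ball)
  have "B = {z. Im ((z - q) * cnj (- (e * cis (\<mu> * pi)))) - k * (cmod (z - q))\<^sup>2 > 0}"
    by (simp add: B_def cis_cnj mult.assoc)
  also have "\<dots> = ball (q + \<i> * - (e * cis (\<mu> * pi)) / of_real (2 * k)) (1 / (2 * k))"
    by (rule half_plane_ball[OF _ k]) (simp add: norm_mult e)
  finally have B: "convex B" by (simp add: convex_ball)
  \<comment> \<open>The midpoint between the two corners lies in both discs.\<close>
  define w where "w = q + of_real (S / (2 * k)) * (e * cis (\<mu> * pi / 2))"
  have ee: "e * cnj e = 1" using e by (simp add: complex_norm_square[symmetric])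
  have wq: "(w - q) * cnj e = of_real (S / (2 * k)) * cis (\<mu> * pi / 2)"
    using ee by (simp add: w_def mult.assoc mult.left_commute)
  have nw: "cmod (w - q) = S / (2 * k)" using S k e by (simp add: w_def norm_mult norm_divide)
  have pos: "S / (2 * k) * S - k * (S / (2 * k))\<^sup>2 > 0" using S k by (simp add: power2_eq_square field_simps)
  have "w \<in> A" unfolding A_def mem_Collect_eq wq nw using pos by (simp add: S_def)
  moreover have "(w - q) * cnj e * cis (- (\<mu> * pi)) = of_real (S / (2 * k)) * cis (- (\<mu> * pi / 2))"
  proof -
    have "\<mu> * pi / 2 + - (\<mu> * pi) = - (\<mu> * pi / 2)" by simp
    then show ?thesis unfolding wq by (simp only: mult.assoc cis_mult)
  qed
  then have "w \<in> B" unfolding B_def mem_Collect_eq nw using pos by (simp add: S_def)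
  ultimately have AB: "A \<inter> B \<noteq> {}" by blast
  have "?L = (if \<mu> \<le> 1 then A \<inter> B else A \<union> B)"
    unfolding set_eq_iff mem_lens_iff_sides[OF \<mu> e] by (simp add: A_def B_def)
  moreover have "connected (A \<inter> B)" by (rule convex_connected[OF convex_Int[OF A B]])
  moreover have "connected (A \<union> B)"
    by (rule connected_Un[OF convex_connected[OF A] convex_connected[OF B] AB])
  ultimately show ?thesis by simp
qed

text \<open>These Taylor estimates are all that is used of the bound on the \<open>C\<^sup>2\<close>-norm of a curve.\<close>

definition tangent_graph :: "(real \<Rightarrow> real) \<Rightarrow> (real \<Rightarrow> real) \<Rightarrow> real \<Rightarrow> real \<Rightarrow> bool" where
  "tangent_graph \<phi> \<phi>' N R \<longleftrightarrow> \<phi> 0 = 0 \<and> (\<forall>a\<in>{0..R}. \<bar>\<phi>' a\<bar> \<le> N * a \<and>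
     (\<forall>t\<in>{0..R}. \<bar>\<phi> t - \<phi> a - \<phi>' a * (t - a)\<bar> \<le> N / 2 * (t - a)\<^sup>2))"

lemma tangent_graphD:
  assumes "tangent_graph \<phi> \<phi>' N R" "0 \<le> a" "a \<le> R"
  shows "\<phi> 0 = 0" "\<bar>\<phi>' a\<bar> \<le> N * a" "\<bar>\<phi> a\<bar> \<le> N / 2 * a\<^sup>2"
    "0 \<le> t \<Longrightarrow> t \<le> R \<Longrightarrow> \<bar>\<phi> t - \<phi> a - \<phi>' a * (t - a)\<bar> \<le> N / 2 * (t - a)\<^sup>2"
proof -
  show "\<phi> 0 = 0" "\<bar>\<phi>' a\<bar> \<le> N * a"
    "0 \<le> t \<Longrightarrow> t \<le> R \<Longrightarrow> \<bar>\<phi> t - \<phi> a - \<phi>' a * (t - a)\<bar> \<le> N / 2 * (t - a)\<^sup>2"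
    using assms by (auto simp: tangent_graph_def)
  have "\<bar>\<phi>' 0\<bar> \<le> N * 0" "\<bar>\<phi> a - \<phi> 0 - \<phi>' 0 * (a - 0)\<bar> \<le> N / 2 * (a - 0)\<^sup>2"
    using assms unfolding tangent_graph_def by force+
  then show "\<bar>\<phi> a\<bar> \<le> N / 2 * a\<^sup>2" using \<open>\<phi> 0 = 0\<close> by simp
qed

lemma tangent_graph_uminus:
  "tangent_graph \<phi> \<phi>' N R \<Longrightarrow> tangent_graph (\<lambda>t. - \<phi> t) (\<lambda>t. - \<phi>' t) N R"
proof -
  have "\<bar>- x - - y - - z * w\<bar> = \<bar>x - y - z * w\<bar>" for x y z w :: real
  proof -
    have "- x - - y - - z * w = - (x - y - z * w)" by simp
    then show ?thesis by (simp only: abs_minus_cancel)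
  qed
  then show "tangent_graph \<phi> \<phi>' N R \<Longrightarrow> tangent_graph (\<lambda>t. - \<phi> t) (\<lambda>t. - \<phi>' t) N R"
    unfolding tangent_graph_def by simp
qed

text \<open>\<open>R\<close> is the radius of the disc under consideration, \<open>M\<close> the size of the curvature of the comparison
  lenses, and \<open>\<epsilon>\<close> the angle by which a lens may be rotated against the tangent cone.\<close>

definition corner_scale :: "real \<Rightarrow> real \<Rightarrow> real \<Rightarrow> real \<Rightarrow> real \<Rightarrow> bool" where
  "corner_scale \<mu> N R M \<epsilon> \<longleftrightarrow> 0 < \<mu> \<and> \<mu> < 2 \<and> 0 < N \<and> 0 < R \<and> 0 < M \<and> 0 < \<epsilon> \<and>
     \<epsilon> \<le> sin (\<mu> * pi / 2) / 4 \<and> (\<mu> \<noteq> 1 \<longrightarrow> \<epsilon> \<le> \<bar>sin (\<mu> * pi)\<bar> / 2) \<and> N * R \<le> \<epsilon> \<and>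
     8 * N \<le> M * sin (\<mu> * pi / 2) \<and> 8 \<le> M * sin (\<mu> * pi / 2) * R"

text \<open>The sine of the half angle and the modulus of the sine of the full angle agree for
  supplementary openings, so the same scales serve the complement.\<close>

lemma corner_scale_supplement: "corner_scale \<mu> N R M \<epsilon> \<Longrightarrow> corner_scale (2 - \<mu>) N R M \<epsilon>"
proof -
  have "(2 - \<mu>) * pi / 2 = pi - \<mu> * pi / 2" by (simp add: field_simps)
  then have "sin ((2 - \<mu>) * pi / 2) = sin (\<mu> * pi / 2)" by (simp only: sin_pi_minus)
  moreover have "(2 - \<mu>) * pi = 2 * pi - \<mu> * pi" by (simp add: field_simps)
  then have "sin ((2 - \<mu>) * pi) = - sin (\<mu> * pi)" by (simp add: sin_diff)
  ultimately show "corner_scale \<mu> N R M \<epsilon> \<Longrightarrow> corner_scale (2 - \<mu>) N R M \<epsilon>"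
    by (auto simp: corner_scale_def)
qed

text \<open>The rotation \<open>Im e \<le> 0\<close> of the first side turns the second side into the wedge; this and the shift of
  the corner along the bisector keep the lens off both curves.\<close>

lemma lens_avoids_curves:
  fixes \<mu> k m :: real
  assumes sc: "corner_scale \<mu> N R M \<epsilon>"
    and e: "cmod e = 1" "Im e \<le> 0" "cmod (e - 1) \<le> \<epsilon>"
    and k: "N \<le> k" and m: "0 \<le> m" "k * m \<le> sin (\<mu> * pi / 2) / 2"
    and q: "q = of_real m * cis (\<mu> * pi / 2)"
    and \<phi>1: "tangent_graph \<phi>1 \<phi>1' N R" and \<phi>2: "tangent_graph \<phi>2 \<phi>2' N R"
    and t: "0 \<le> t" "t \<le> R"
    and A: "Im ((Complex t (\<phi>1 t) - q) * cnj e) - k * (cmod (Complex t (\<phi>1 t) - q))\<^sup>2 \<le> 0"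
  shows "Complex t (\<phi>1 t) \<notin> lens \<mu> q (e * cis (\<mu> * pi / 2)) (k / sin (\<mu> * pi / 2))"
    and "cis (\<mu> * pi) * Complex t (\<phi>2 t) \<notin> lens \<mu> q (e * cis (\<mu> * pi / 2)) (k / sin (\<mu> * pi / 2))"
proof -
  define S where "S = sin (\<mu> * pi / 2)"
  have \<mu>: "0 < \<mu>" "\<mu> < 2" and N: "0 < N" and \<epsilon>: "0 < \<epsilon>" "\<epsilon> \<le> S / 4" and NR: "N * R \<le> \<epsilon>"
    and \<epsilon>2: "\<mu> \<noteq> 1 \<Longrightarrow> \<epsilon> \<le> \<bar>sin (\<mu> * pi)\<bar> / 2"
    using sc by (auto simp: corner_scale_def S_def)
  have k0: "k > 0" using k N by simp
  have ce: "cmod (cnj e - 1) \<le> \<epsilon>"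
    using e(3) by (metis complex_cnj_diff complex_cnj_one complex_mod_cnj)
  have near: "\<bar>Im (y * cnj e) - Im y\<bar> \<le> cmod y * \<epsilon>" for y
  proof -
    have "\<bar>Im (y * cnj e - y)\<bar> \<le> cmod (y * cnj e - y)" by (rule abs_Im_le_cmod)
    also have "y * cnj e - y = y * (cnj e - 1)" by (simp add: algebra_simps)
    also have "cmod \<dots> \<le> cmod y * \<epsilon>" unfolding norm_mult using ce by (intro mult_left_mono) auto
    finally show ?thesis by (simp add: algebra_simps)
  qed
  have near_cis: "\<bar>Im (y * cnj e * cis s) - Im (y * cis s)\<bar> \<le> cmod y * \<epsilon>" for y s
    using near[of "y * cis s"] by (simp add: mult.assoc mult.left_commute norm_mult mult.commute[of "cis s"])
  have tt: "N / 2 * t\<^sup>2 \<le> \<epsilon> / 2 * t"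
  proof -
    have "N * t \<le> N * R" using t N by simp
    then have "N * t \<le> \<epsilon>" using NR by simp
    then have "N * t * (t / 2) \<le> \<epsilon> * (t / 2)" using t by (intro mult_right_mono) auto
    then show ?thesis by (simp add: power2_eq_square mult_ac)
  qed
  have \<phi>1t: "\<bar>\<phi>1 t\<bar> \<le> N / 2 * t\<^sup>2" and \<phi>2t: "\<bar>\<phi>2 t\<bar> \<le> N / 2 * t\<^sup>2"
    using tangent_graphD(3)[OF \<phi>1 t] tangent_graphD(3)[OF \<phi>2 t] .
  have cis_cancel: "cis (\<mu> * pi) * cis (- (\<mu> * pi)) = 1" "cis (\<mu> * pi / 2) * cis (- (\<mu> * pi)) = cis (- (\<mu> * pi / 2))"
  proof -
    have "\<mu> * pi / 2 + - (\<mu> * pi) = - (\<mu> * pi / 2)" by simp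
    then show "cis (\<mu> * pi / 2) * cis (- (\<mu> * pi)) = cis (- (\<mu> * pi / 2))" by (simp only: cis_mult)
  qed (simp add: cis_mult)
  \<comment> \<open>Measuring the distance from \<open>q\<close> instead of 0 costs
    \<open>k * m\<^sup>2\<close>, at most \<open>m * S / 2\<close>. The shift along the bisector
    gains this amount in the linear term, and \<open>N / 2 * t\<^sup>2\<close> is covered by
    \<open>k \<ge> N\<close>.\<close>
  have B2: "- Im ((cis (\<mu> * pi) * Complex t (\<phi>2 t) - q) * cnj e * cis (- (\<mu> * pi)))
      - k * (cmod (cis (\<mu> * pi) * Complex t (\<phi>2 t) - q))\<^sup>2 \<le> 0"
  proof -
    let ?w = "Complex t (\<phi>2 t)"
    have "(cis (\<mu> * pi) * ?w - q) * cnj e * cis (- (\<mu> * pi))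
        = ?w * cnj e * (cis (\<mu> * pi) * cis (- (\<mu> * pi)))
        - of_real m * (cnj e * (cis (\<mu> * pi / 2) * cis (- (\<mu> * pi))))"
      unfolding q by (simp add: algebra_simps)
    also have "\<dots> = ?w * cnj e - of_real m * (1 * cnj e * cis (- (\<mu> * pi / 2)))"
      unfolding cis_cancel by simp
    finally have eq: "Im ((cis (\<mu> * pi) * ?w - q) * cnj e * cis (- (\<mu> * pi)))
        = Im (?w * cnj e) - m * Im (1 * cnj e * cis (- (\<mu> * pi / 2)))" by simp
    have 1: "- Im (?w * cnj e) \<le> N / 2 * t\<^sup>2"
    proof -
      have "- Im (?w * cnj e) = - (\<phi>2 t * Re e) + t * Im e" by simp
      also have "\<dots> \<le> \<bar>\<phi>2 t\<bar> * \<bar>Re e\<bar>"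
      proof -
        have "t * Im e \<le> 0" using t e by (intro mult_nonneg_nonpos)
        moreover have "- (\<phi>2 t * Re e) \<le> \<bar>\<phi>2 t\<bar> * \<bar>Re e\<bar>" unfolding abs_mult[symmetric] by (rule abs_ge_minus_self)
        ultimately show ?thesis by linarith
      qed
      also have "\<dots> \<le> \<bar>\<phi>2 t\<bar> * 1" using abs_Re_le_cmod[of e] e by (intro mult_left_mono) auto
      finally show ?thesis using \<phi>2t by simp
    qed
    have "Im (1 * cnj e * cis (- (\<mu> * pi / 2))) \<le> - (S / 2)"
      using near_cis[of 1 "- (\<mu> * pi / 2)"] \<epsilon> by (simp add: S_def)
    then have 2: "m * Im (1 * cnj e * cis (- (\<mu> * pi / 2))) \<le> m * (- (S / 2))" using m by (intro mult_left_mono)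
    have 3: "(cmod (cis (\<mu> * pi) * ?w - q))\<^sup>2 \<ge> t\<^sup>2 / 2 - m\<^sup>2"
    proof -
      have "cmod (cis (\<mu> * pi) * ?w) - cmod q \<le> cmod (cis (\<mu> * pi) * ?w - q)" by (rule norm_triangle_ineq2)
      moreover have "t \<le> cmod ?w" using complex_Re_le_cmod[of ?w] by simp
      moreover have "cmod q = m" using m by (simp add: q norm_mult)
      ultimately have "t \<le> cmod (cis (\<mu> * pi) * ?w - q) + m" by (simp add: norm_mult)
      then have "t\<^sup>2 \<le> (cmod (cis (\<mu> * pi) * ?w - q) + m)\<^sup>2" using t by (intro power_mono)
      also have "\<dots> \<le> 2 * (cmod (cis (\<mu> * pi) * ?w - q))\<^sup>2 + 2 * m\<^sup>2"
        using sum_squares_bound[of "cmod (cis (\<mu> * pi) * ?w - q)" m] by (simp add: power2_sum)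
      finally show ?thesis by simp
    qed
    have 4: "k * (cmod (cis (\<mu> * pi) * ?w - q))\<^sup>2 \<ge> N * (t\<^sup>2 / 2) - m * (S / 2)"
    proof -
      have "k * (t\<^sup>2 / 2 - m\<^sup>2) \<le> k * (cmod (cis (\<mu> * pi) * ?w - q))\<^sup>2" using 3 k0 by (intro mult_left_mono) auto
      moreover have "N * (t\<^sup>2 / 2) \<le> k * (t\<^sup>2 / 2)" using k by (intro mult_right_mono) auto
      moreover have "k * m * m \<le> S / 2 * m" using m by (intro mult_right_mono) (auto simp: S_def)
      ultimately show ?thesis by (simp add: algebra_simps power2_eq_square)
    qed
    show ?thesis unfolding eq using 1 2 4 by simp
  qed
  \<comment> \<open>For \<open>\<mu> > 1\<close> the lens is a union, so each curve must also avoid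
    the disc of the other side. It leaves the half plane of that disc at the linear rate
    \<open>2 * \<epsilon> * t\<close>, which absorbs the rotation and the deviation from the
    ray.\<close>
  have big: "B \<le> 0" if "\<mu> > 1" and "B = Im (Complex t f * cnj e * cis s) + m * g - k * (cmod h)\<^sup>2"
    and "\<bar>f\<bar> \<le> N / 2 * t\<^sup>2" "sin s = sin (\<mu> * pi)" "g \<le> 0" for B f s g h
  proof -
    have sneg: "sin (\<mu> * pi) \<le> - 2 * \<epsilon>"
    proof -
      have "pi < \<mu> * pi" using \<open>\<mu> > 1\<close> by simp
      then have "sin (\<mu> * pi) < 0" using \<mu> by (intro sin_lt_zero) auto
      then show ?thesis using \<epsilon>2 \<open>\<mu> > 1\<close> by auto
    qed
    have "Im (Complex t f * cnj e * cis s) \<le> Im (Complex t f * cis s) + cmod (Complex t f) * \<epsilon>"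
      using near_cis[of "Complex t f" s] by linarith
    also have "Im (Complex t f * cis s) = t * sin (\<mu> * pi) + f * cos s" using that by simp
    also have "f * cos s \<le> \<bar>f\<bar>"
      using mult_left_le[of "\<bar>cos s\<bar>" "\<bar>f\<bar>"] abs_ge_self[of "f * cos s"] abs_cos_le_one[of s] by (simp add: abs_mult)
    also have "cmod (Complex t f) * \<epsilon> \<le> (t + \<bar>f\<bar>) * \<epsilon>"
      using cmod_le[of "Complex t f"] t \<epsilon> by (intro mult_right_mono) auto
    finally have "Im (Complex t f * cnj e * cis s) \<le> t * sin (\<mu> * pi) + \<bar>f\<bar> + (t + \<bar>f\<bar>) * \<epsilon>" by simp
    moreover have "\<bar>f\<bar> \<le> \<epsilon> / 2 * t" using that tt by linarith
    moreover have "S \<le> 1" by (simp add: S_def)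
    then have "\<epsilon> \<le> 1 / 4" using \<epsilon> by linarith
    then have "\<bar>f\<bar> * \<epsilon> \<le> \<bar>f\<bar> * 1" by (intro mult_left_mono) auto
    moreover have "t * sin (\<mu> * pi) \<le> t * (- 2 * \<epsilon>)" using sneg t by (intro mult_left_mono)
    moreover have "m * g \<le> 0" using m that by (intro mult_nonneg_nonpos)
    moreover have "k * (cmod h)\<^sup>2 \<ge> 0" using k0 by simp
    ultimately show ?thesis unfolding that(2) by (simp add: algebra_simps)
  qed
  have Imce: "Im (1 * cnj e * cis (- (\<mu> * pi / 2))) \<le> 0" "- Im (1 * cnj e * cis (\<mu> * pi / 2)) \<le> 0"
    using near_cis[of 1 "- (\<mu> * pi / 2)"] near_cis[of 1 "\<mu> * pi / 2"] \<epsilon> by (auto simp: S_def)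
  have B1: "- Im ((Complex t (\<phi>1 t) - q) * cnj e * cis (- (\<mu> * pi))) - k * (cmod (Complex t (\<phi>1 t) - q))\<^sup>2 \<le> 0"
    if "\<mu> > 1"
  \<comment> \<open>Since \<open>cis (pi - x) = - cis (- x)\<close>, the outer minus sign moves into
    the angle; the sine of \<open>pi - \<mu> * pi\<close> is still that of
    \<open>\<mu> * pi\<close>.\<close>
  proof (rule big[OF that, where f = "\<phi>1 t" and s = "pi - \<mu> * pi" and g = "Im (1 * cnj e * cis (- (\<mu> * pi / 2)))"])
    have "cis (pi - \<mu> * pi) = - cis (- (\<mu> * pi))" by (simp add: complex_eq_iff cos_diff sin_diff)
    moreover have "q * cis (- (\<mu> * pi)) = of_real m * cis (- (\<mu> * pi / 2))"
      by (simp add: q mult.assoc cis_cancel)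
    then have "(Complex t (\<phi>1 t) - q) * cnj e * cis (- (\<mu> * pi))
       = Complex t (\<phi>1 t) * cnj e * cis (- (\<mu> * pi)) - of_real m * (1 * cnj e * cis (- (\<mu> * pi / 2)))"
      by (simp add: algebra_simps)
    ultimately show "- Im ((Complex t (\<phi>1 t) - q) * cnj e * cis (- (\<mu> * pi))) - k * (cmod (Complex t (\<phi>1 t) - q))\<^sup>2
      = Im (Complex t (\<phi>1 t) * cnj e * cis (pi - \<mu> * pi)) + m * Im (1 * cnj e * cis (- (\<mu> * pi / 2)))
        - k * (cmod (Complex t (\<phi>1 t) - q))\<^sup>2"
      by simp
  qed (use \<phi>1t Imce in \<open>auto simp: sin_diff\<close>)
  have A2: "Im ((cis (\<mu> * pi) * Complex t (\<phi>2 t) - q) * cnj e) - k * (cmod (cis (\<mu> * pi) * Complex t (\<phi>2 t) - q))\<^sup>2 \<le> 0"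
    if "\<mu> > 1"
  proof (rule big[OF that, where f = "\<phi>2 t" and s = "\<mu> * pi" and g = "- Im (1 * cnj e * cis (\<mu> * pi / 2))"])
    have "(cis (\<mu> * pi) * Complex t (\<phi>2 t) - q) * cnj e
       = Complex t (\<phi>2 t) * cnj e * cis (\<mu> * pi) - of_real m * (1 * cnj e * cis (\<mu> * pi / 2))"
      by (simp add: q algebra_simps)
    then show "Im ((cis (\<mu> * pi) * Complex t (\<phi>2 t) - q) * cnj e) - k * (cmod (cis (\<mu> * pi) * Complex t (\<phi>2 t) - q))\<^sup>2
      = Im (Complex t (\<phi>2 t) * cnj e * cis (\<mu> * pi)) + m * - Im (1 * cnj e * cis (\<mu> * pi / 2))
        - k * (cmod (cis (\<mu> * pi) * Complex t (\<phi>2 t) - q))\<^sup>2"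
      by (simp add: right_diff_distrib)
  qed (use \<phi>2t Imce in auto)
  show "Complex t (\<phi>1 t) \<notin> lens \<mu> q (e * cis (\<mu> * pi / 2)) (k / sin (\<mu> * pi / 2))"
    unfolding mem_lens_iff_sides[OF \<mu> e(1)] using A B1 by auto
  show "cis (\<mu> * pi) * Complex t (\<phi>2 t) \<notin> lens \<mu> q (e * cis (\<mu> * pi / 2)) (k / sin (\<mu> * pi / 2))"
    unfolding mem_lens_iff_sides[OF \<mu> e(1)] using B2 A2 by auto
qed

text \<open>A circle meets a chord at equal angles at both ends, so the tangent \<open>e\<close> at
  \<open>q\<close> is the reflection of \<open>\<tau>\<close> in the chord from \<open>q\<close> to
  \<open>p\<close>. The value of \<open>k\<close> is the one for which the circle tangent to
  \<open>\<tau>\<close> at \<open>p\<close> passes through \<open>q\<close>.\<close>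

lemma arc_through_tangent_point:
  fixes p q \<tau> z :: complex
  assumes "p \<noteq> q"
  defines "e \<equiv> (p - q)\<^sup>2 * cnj \<tau> / of_real ((cmod (p - q))\<^sup>2)" and "k \<equiv> Im (\<tau> * cnj (p - q)) / (cmod (p - q))\<^sup>2"
  shows "Im ((z - q) * cnj e) - k * (cmod (z - q))\<^sup>2 = Im ((z - p) * cnj \<tau>) - k * (cmod (z - p))\<^sup>2"
proof -
  define u where "u = z - p"
  define P where "P = p - q"
  define n where "n = (cmod P)\<^sup>2"
  have n: "n > 0" using assms(1) by (simp add: n_def P_def)
  have zq: "z - q = u + P" by (simp add: u_def P_def)
  have 1: "n * Im ((u + P) * cnj e) = Im ((u + P) * (cnj P)\<^sup>2 * \<tau>)"
  proof -
    have "(u + P) * cnj e = (u + P) * (cnj P)\<^sup>2 * \<tau> / of_real n"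
      by (simp add: e_def P_def[symmetric] n_def)
    then show ?thesis using n by simp
  qed
  have 2: "n * (k * x) = Im (\<tau> * cnj P) * x" for x using n by (simp add: k_def P_def[symmetric] n_def[symmetric])
  have nn: "n = (Re P)\<^sup>2 + (Im P)\<^sup>2" by (simp add: n_def cmod_power2)
  have "n * (Im ((u + P) * cnj e) - k * (cmod (u + P))\<^sup>2) = n * (Im (u * cnj \<tau>) - k * (cmod u)\<^sup>2)"
    unfolding right_diff_distrib 1 2 unfolding nn
    by (simp only: cmod_power2) (simp add: power2_eq_square algebra_simps)
  then show ?thesis using n by (simp add: zq u_def[symmetric])
qed

text \<open>Relative to the tangent at \<open>p\<close> the corner \<open>q\<close> has height about
  \<open>M * a\<^sup>2 * S\<close> and distance about \<open>a\<close>, so \<open>k\<close> is about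
  \<open>M * S\<close>. The slopes that occur are O(M * a), which bounds the rotation
  \<open>e\<close>.\<close>

lemma tangent_lens:
  fixes \<mu> N R M \<epsilon> a :: real
  assumes sc: "corner_scale \<mu> N R M \<epsilon>" and tg: "tangent_graph \<phi> \<phi>' N R"
    and a: "0 < a" "a \<le> R" "20 * (M * a) \<le> 1"
  defines "p \<equiv> Complex a (\<phi> a)" and "\<tau> \<equiv> sgn (Complex 1 (\<phi>' a))"
    and "q \<equiv> of_real (M * a\<^sup>2) * cis (\<mu> * pi / 2)" and "S \<equiv> sin (\<mu> * pi / 2)"
  obtains e k where "cmod e = 1" "Im e \<le> 0" "cmod (e - 1) \<le> 3 * (M * a)" "M * S / 2 \<le> k" "k \<le> 2 * (M * S)"
    "\<And>z. Im ((z - q) * cnj e) - k * (cmod (z - q))\<^sup>2 = Im ((z - p) * cnj \<tau>) - k * (cmod (z - p))\<^sup>2"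
proof -
  have \<mu>: "0 < \<mu>" "\<mu> < 2" and N: "0 < N" and M: "0 < M" and NM: "8 * N \<le> M * S"
    using sc by (auto simp: corner_scale_def S_def)
  define C where "C = cos (\<mu> * pi / 2)"
  have S: "S > 0" "S \<le> 1" unfolding S_def using \<mu> by (auto intro!: sin_gt_zero)
  have C: "\<bar>C\<bar> \<le> 1" by (simp add: C_def)
  define h where "h = M * a"
  have h: "0 < h" "h \<le> 1 / 20" using M a by (auto simp: h_def)
  \<comment> \<open>Coordinates of the chord divided by \<open>a\<close>: \<open>X\<close> is near 1
    and \<open>Y\<close> near \<open>- h * S\<close>, as the graph itself contributes at most
    \<open>h * S / 16\<close>.\<close>
  define X where "X = 1 - h * C"
  define Y where "Y = \<phi> a / a - h * S"
  define s where "s = \<phi>' a"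
  define T where "T = Complex 1 s"
  define w where "w = cmod T"
  define Z where "Z = Complex X Y"
  have Na: "N * a \<le> h * S / 8"
  proof -
    have "8 * N * a \<le> M * S * a" using NM a by (intro mult_right_mono) auto
    then show ?thesis by (simp add: h_def mult_ac)
  qed
  have hS: "0 < h * S" "h * S \<le> 1 / 20"
    using h S mult_mono[of h "1/20" S 1] by auto
  have s: "\<bar>s\<bar> \<le> h * S / 8" using tangent_graphD(2)[OF tg, of a] a Na by (simp add: s_def)
  have \<phi>a: "\<bar>\<phi> a / a\<bar> \<le> h * S / 16"
  proof -
    have "\<bar>\<phi> a\<bar> \<le> N / 2 * a\<^sup>2" using tangent_graphD(3)[OF tg, of a] a by simp
    then have "\<bar>\<phi> a\<bar> / a \<le> N / 2 * a\<^sup>2 / a" using a by (intro divide_right_mono) auto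
    then have "\<bar>\<phi> a / a\<bar> \<le> N / 2 * a\<^sup>2 / a" using a by (simp only: abs_divide abs_of_pos)
    also have "\<dots> = N * a / 2" using a by (simp add: power2_eq_square)
    finally show ?thesis using Na by linarith
  qed
  have hC: "\<bar>h * C\<bar> \<le> 1 / 20" using h C mult_mono[of h "1/20" "\<bar>C\<bar>" 1] by (simp add: abs_mult)
  have X: "19 / 20 \<le> X" "X \<le> 21 / 20" using hC unfolding X_def by linarith+
  have Y: "- Y \<ge> 15 / 16 * (h * S)" "- Y \<le> 17 / 16 * (h * S)" using \<phi>a unfolding Y_def by linarith+
  have Yb: "\<bar>Y\<bar> \<le> 17 / 16 * (h * S)" using Y hS unfolding abs_le_iff by linarith
  have Xsq: "X * X \<ge> 19/20 * (19/20)" "X * X \<le> 21/20 * (21/20)"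
    using mult_mono[OF X(1) X(1)] mult_mono[OF X(2) X(2)] X by linarith+
  have Ysq: "Y * Y \<le> 1/16 * (1/16)"
  proof -
    have "\<bar>Y\<bar> \<le> 1/16" using Yb hS by linarith
    from mult_mono[OF this this] show ?thesis by simp
  qed
  define n where "n = X\<^sup>2 + Y\<^sup>2"
  have n: "9 / 10 \<le> n" "n \<le> 11 / 10 + 1 / 100"
    using Xsq Ysq zero_le_square[of Y] unfolding n_def power2_eq_square by linarith+
  have nZ: "n = (cmod Z)\<^sup>2" by (simp add: n_def Z_def cmod_power2)
  have w: "1 \<le> w" "w \<le> 1 + \<bar>s\<bar>" 
    using complex_Re_le_cmod[of T] cmod_le[of T] by (auto simp: w_def T_def)
  have w': "w \<le> 101 / 100" using w s hS by linarith
  have \<tau>: "\<tau> = T / of_real w" by (simp add: \<tau>_def T_def w_def s_def sgn_eq)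
  have n\<tau>: "cmod \<tau> = 1" using w by (simp add: \<tau> norm_divide w_def[symmetric])
  have P: "p - q = of_real a * Z"
    using a by (simp add: p_def q_def Z_def X_def Y_def h_def C_def S_def complex_eq_iff power2_eq_square field_simps)
  have Z0: "Z \<noteq> 0" using X by (auto simp: Z_def complex_eq_iff)
  have nP: "(cmod (p - q))\<^sup>2 = a\<^sup>2 * n" unfolding P nZ norm_mult power_mult_distrib using a by simp
  have "p \<noteq> q" using P Z0 a by auto
  note arc = arc_through_tangent_point[OF this, of _ \<tau>]
  define e where "e = (p - q)\<^sup>2 * cnj \<tau> / of_real ((cmod (p - q))\<^sup>2)"
  define k where "k = Im (\<tau> * cnj (p - q)) / (cmod (p - q))\<^sup>2"
  have e: "e = Z\<^sup>2 * cnj \<tau> / of_real n"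
    unfolding e_def nP unfolding P using a by (simp add: power_mult_distrib)
  have k: "k = (s * X - Y) / (w * n * a)"
  proof -
    have "Im (\<tau> * cnj (p - q)) = a * (s * X - Y) / w"
      unfolding P \<tau> by (simp add: T_def Z_def Im_divide_of_real) (simp add: algebra_simps)
    then show ?thesis unfolding k_def nP using a by (simp add: power2_eq_square)
  qed
  have sX: "\<bar>s * X\<bar> \<le> 21 / 160 * (h * S)"
    unfolding abs_mult using mult_mono[OF s, of "\<bar>X\<bar>" "21/20"] X hS by simp
  have num: "4 / 5 * (h * S) \<le> s * X - Y" "s * X - Y \<le> 6 / 5 * (h * S)"
    using sX Y hS unfolding abs_le_iff by linarith+
  have D: "9 / 10 * a \<le> w * n * a" "w * n * a \<le> 6 / 5 * a"
  proof -
    have "1 * (9 / 10) \<le> w * n" using w n by (intro mult_mono) auto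
    then show "9 / 10 * a \<le> w * n * a" using a by (intro mult_right_mono) auto
    have "w * n \<le> 101 / 100 * (11 / 10 + 1 / 100)" using w w' n by (intro mult_mono) auto
    then have "w * n \<le> 6 / 5" by simp
    then show "w * n * a \<le> 6 / 5 * a" using a by (intro mult_right_mono) auto
  qed
  have D0: "w * n * a > 0" using D a by linarith
  have MSa: "M * S * a = h * S" by (simp add: h_def)
  have MS: "M * S > 0" using M S by simp
  show ?thesis
  proof (rule that[of e k])
    show "cmod e = 1" unfolding e norm_divide norm_mult using n\<tau> n by (simp add: norm_power nZ[symmetric])
    have "Im e = (2 * X * Y - s * (X\<^sup>2 - Y\<^sup>2)) / (w * n)"
      unfolding e \<tau> by (simp add: T_def Z_def Im_divide_of_real power2_eq_square algebra_simps)
    \<comment> \<open>The shift of the corner makes \<open>Y\<close> close to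
      \<open>- h * S\<close>, whereas the slope \<open>s\<close> is at most
      \<open>h * S / 8\<close>; so the sign is that of \<open>Y\<close>.\<close>
    moreover have "2 * X * Y - s * (X\<^sup>2 - Y\<^sup>2) \<le> 0"
    proof -
      have "19/20 * (15 / 16 * (h * S)) \<le> X * (- Y)" using X Y hS by (intro mult_mono) auto
      moreover have "\<bar>s * (X\<^sup>2 - Y\<^sup>2)\<bar> \<le> h * S / 8 * 2"
        unfolding abs_mult
      proof (rule mult_mono[OF s])
        show "\<bar>X\<^sup>2 - Y\<^sup>2\<bar> \<le> 2" using Xsq Ysq zero_le_square[of Y] unfolding power2_eq_square abs_le_iff by linarith
      qed (use hS in auto)
      ultimately show ?thesis using hS unfolding abs_le_iff by linarith
    qed
    ultimately show "Im e \<le> 0" using w n by (simp add: divide_nonpos_pos)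
    show "cmod (e - 1) \<le> 3 * (M * a)"
    proof -
      have "of_real n = Z * cnj Z" unfolding nZ by (rule complex_norm_square)
      then have "e - 1 = (Z * cnj \<tau> - cnj Z) / cnj Z"
        unfolding e using Z0 by (simp add: power2_eq_square field_simps)
      also have "cmod \<dots> = cmod (Z * (cnj \<tau> - 1) + (Z - cnj Z)) / cmod Z"
        by (simp add: norm_divide algebra_simps)
      also have "\<dots> \<le> (cmod Z * cmod (\<tau> - 1) + 2 * \<bar>Y\<bar>) / cmod Z"
      proof (intro divide_right_mono order_trans[OF norm_triangle_ineq] add_mono)
        show "cmod (Z * (cnj \<tau> - 1)) \<le> cmod Z * cmod (\<tau> - 1)"
          unfolding norm_mult by (metis complex_cnj_diff complex_cnj_one complex_mod_cnj order_refl)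
        show "cmod (Z - cnj Z) \<le> 2 * \<bar>Y\<bar>"
          using cmod_le[of "Z - cnj Z"] by (simp add: Z_def)
      qed simp
      also have "\<dots> = cmod (\<tau> - 1) + 2 * \<bar>Y\<bar> / cmod Z" using Z0 by (simp add: add_divide_distrib)
      also have "2 * \<bar>Y\<bar> / cmod Z \<le> 2 * (17 / 16 * (h * S)) / (19 / 20)"
      proof (rule frac_le)
        show "19 / 20 \<le> cmod Z" using X complex_Re_le_cmod[of Z] by (simp add: Z_def)
      qed (use Yb hS in linarith)+
      also have "cmod (\<tau> - 1) \<le> 2 * \<bar>s\<bar>"
      proof -
        have "\<tau> - 1 = (T - of_real w) / of_real w" using w by (simp add: \<tau> diff_divide_distrib)
        then have "cmod (\<tau> - 1) = cmod ((T - 1) - of_real (w - 1)) / w" using w by (simp add: norm_divide)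
        also have "\<dots> \<le> cmod ((T - 1) - of_real (w - 1)) / 1" using w by (intro divide_left_mono) auto
        also have "\<dots> \<le> cmod (T - 1) + cmod (of_real (w - 1))" using norm_triangle_ineq4[of "T - 1" "of_real (w - 1)"] by simp
        also have "cmod (T - 1) \<le> \<bar>s\<bar>" using cmod_le[of "T - 1"] by (simp add: T_def)
        also have "cmod (of_real (w - 1)) = w - 1" unfolding norm_of_real using w by simp
        finally show ?thesis using w by simp
      qed
      also have "2 * \<bar>s\<bar> + 2 * (17 / 16 * (h * S)) / (19 / 20) \<le> 3 * (h * S)"
      proof -
        have "2 * \<bar>s\<bar> + 2 * (17 / 16 * y) / (19 / 20) \<le> 3 * y" if "\<bar>s\<bar> \<le> y / 8" "0 < y" for y
          using that by simp
        from this[OF s hS(1)] show ?thesis .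
      qed
      also have "\<dots> \<le> 3 * h" using h S by simp
      finally show ?thesis by (simp add: h_def)
    qed
    show "M * S / 2 \<le> k"
    proof -
      have "M * S / 2 * (w * n * a) \<le> M * S / 2 * (6 / 5 * a)" using D MS by (intro mult_left_mono) auto
      also have "\<dots> = 3 / 5 * (h * S)" by (simp add: h_def)
      also have "\<dots> \<le> s * X - Y" using num hS by linarith
      finally show ?thesis unfolding k using D0 by (simp add: pos_le_divide_eq)
    qed
    show "k \<le> 2 * (M * S)"
    proof -
      have "s * X - Y \<le> 9 / 5 * (h * S)" using num hS by linarith
      also have "\<dots> = 2 * (M * S) * (9 / 10 * a)" by (simp add: h_def)
      also have "\<dots> \<le> 2 * (M * S) * (w * n * a)" using D MS by (intro mult_left_mono) auto
      finally show ?thesis unfolding k using D0 by (simp add: pos_divide_le_eq)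
    qed
    show "Im ((z - q) * cnj e) - k * (cmod (z - q))\<^sup>2 = Im ((z - p) * cnj \<tau>) - k * (cmod (z - p))\<^sup>2" for z
      using arc[of z] unfolding e_def k_def .
  qed
qed

text \<open>The lens is connected, lies in the ball, avoids both curves and meets the bisector; so
  one point on the bisector decides on which side of the curves it lies. Nothing refers to a domain,
  hence it applies to the interior and to the mirrored exterior.\<close>

proposition corner_lens:
  fixes \<mu> N R M \<epsilon> a :: real
  assumes sc: "corner_scale \<mu> N R M \<epsilon>" and tg1: "tangent_graph \<phi>1 \<phi>1' N R" and tg2: "tangent_graph \<phi>2 \<phi>2' N R"
    and a: "0 \<le> a" "a \<le> R" "20 * (M * a) \<le> 1" "3 * (M * a) \<le> \<epsilon>"
  defines "p \<equiv> Complex a (\<phi>1 a)" and "\<tau> \<equiv> sgn (Complex 1 (\<phi>1' a))" and "S \<equiv> sin (\<mu> * pi / 2)"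
  obtains e k q where "cmod e = 1" "cmod (e - 1) \<le> 3 * (M * a)" "cmod q \<le> M * a\<^sup>2" "0 < k" "k \<le> 2 * (M * S)"
    "\<And>z. Im ((z - q) * cnj e) - k * (cmod (z - q))\<^sup>2 = Im ((z - p) * cnj \<tau>) - k * (cmod (z - p))\<^sup>2"
    "lens \<mu> q (e * cis (\<mu> * pi / 2)) (k / S) \<subseteq> ball 0 R"
    "connected (lens \<mu> q (e * cis (\<mu> * pi / 2)) (k / S))"
    "\<exists>s. 0 < s \<and> s < R \<and> of_real s * cis (\<mu> * pi / 2) \<in> lens \<mu> q (e * cis (\<mu> * pi / 2)) (k / S)"
    "\<And>t. 0 \<le> t \<Longrightarrow> t \<le> R \<Longrightarrow> Complex t (\<phi>1 t) \<notin> lens \<mu> q (e * cis (\<mu> * pi / 2)) (k / S)"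
    "\<And>t. 0 \<le> t \<Longrightarrow> t \<le> R \<Longrightarrow> cis (\<mu> * pi) * Complex t (\<phi>2 t) \<notin> lens \<mu> q (e * cis (\<mu> * pi / 2)) (k / S)"
proof -
  have \<mu>: "0 < \<mu>" "\<mu> < 2" and N: "0 < N" and M: "0 < M" and R: "0 < R" and NM: "8 * N \<le> M * S"
    and MR: "8 \<le> M * S * R" and \<epsilon>: "0 < \<epsilon>" "\<epsilon> \<le> S / 4"
    using sc by (auto simp: corner_scale_def S_def)
  have S: "S > 0" "S \<le> 1" unfolding S_def using \<mu> by (auto intro!: sin_gt_zero)
  define m where "m = M * a\<^sup>2"
  define q where "q = of_real m * cis (\<mu> * pi / 2)"
  have m: "0 \<le> m" using M by (simp add: m_def)
  obtain e k where e: "cmod e = 1" "Im e \<le> 0" "cmod (e - 1) \<le> 3 * (M * a)" and k: "M * S / 2 \<le> k" "k \<le> 2 * (M * S)"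
    and id: "\<And>z. Im ((z - q) * cnj e) - k * (cmod (z - q))\<^sup>2 = Im ((z - p) * cnj \<tau>) - k * (cmod (z - p))\<^sup>2"
  proof (cases "a = 0")
    \<comment> \<open>The foot is the corner, so there is no chord; with \<open>p = q = 0\<close>
      and \<open>\<tau> = 1\<close> the unrotated lens with \<open>k = M * S\<close> serves.\<close>
    case True
    have "\<phi>1 0 = 0" "\<phi>1' 0 = 0" using tangent_graphD(1,2)[OF tg1, of 0] R by auto
    then have "p = 0" "\<tau> = 1" "q = 0" using True
      by (auto simp: p_def \<tau>_def q_def m_def sgn_eq complex_eq_iff Complex_eq)
    then show thesis using that[of 1 "M * S"] M S True by simp
  next
    case False
    then have "0 < a" using a by simp
    from tangent_lens[OF sc tg1 this a(2,3)] show thesis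
      using that unfolding p_def \<tau>_def q_def m_def S_def by metis
  qed
  have MS: "M * S > 0" using M S by simp
  have k0: "k > 0" using k(1) MS by simp
  have kN: "2 * N \<le> k" using k NM N by simp
  have mR: "m \<le> R / 20"
  proof -
    have "m = M * a * a" by (simp add: m_def power2_eq_square)
    also have "\<dots> \<le> 1 / 20 * R" using a M by (intro mult_mono) auto
    finally show ?thesis by simp
  qed
  have km: "k * m \<le> S / 2"
  proof -
    have "k * m \<le> 2 * (M * S) * m" using k m by (intro mult_right_mono) auto
    also have "\<dots> = 2 * S * (M * a * (M * a))" by (simp add: m_def power2_eq_square)
    also have "M * a * (M * a) \<le> 1 / 20 * (1 / 20)" using a M by (intro mult_mono) auto
    finally show ?thesis using S by (simp add: mult_left_mono)
  qed
  \<comment> \<open>The diameter of the circles is at most \<open>R / 4\<close>, which together with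
    the small shift keeps the lens in the ball.\<close>
  have kR: "1 / k \<le> R / 4"
  proof -
    have "4 \<le> R * (M * S / 2)" using MR by (simp add: mult_ac)
    also have "\<dots> \<le> R * k" using k R by (intro mult_left_mono) auto
    finally show ?thesis using k0 by (simp add: field_simps)
  qed
  have nq: "cmod q = m" using m by (simp add: q_def norm_mult)
  let ?L = "lens \<mu> q (e * cis (\<mu> * pi / 2)) (k / S)"
  have b: "cmod (e * cis (\<mu> * pi / 2)) = 1" by (simp add: norm_mult e)
  show thesis
  proof (rule that[of e q k])
    show "cmod e = 1" "cmod (e - 1) \<le> 3 * (M * a)" "0 < k" "k \<le> 2 * (M * S)" by fact+
    show "cmod q \<le> M * a\<^sup>2" by (simp add: nq m_def)
    show "Im ((z - q) * cnj e) - k * (cmod (z - q))\<^sup>2 = Im ((z - p) * cnj \<tau>) - k * (cmod (z - p))\<^sup>2" for z by fact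
    show "?L \<subseteq> ball 0 R"
    proof
      fix z assume z: "z \<in> ?L"
      have "cmod (z - q) < 1 / (k / S * sin (\<mu> * pi / 2))"
        by (rule lens_bounded(1)[OF \<mu> b _ z]) (use k0 S in auto)
      then have "cmod (z - q) < 1 / k" using S by (simp add: S_def[symmetric])
      moreover have "cmod z \<le> cmod (z - q) + cmod q" by (metis diff_add_cancel norm_triangle_ineq)
      ultimately show "z \<in> ball 0 R" using kR mR nq R by simp
    qed
    show "connected ?L" unfolding S_def by (rule connected_lens[OF \<mu> e(1) k0])
    show "\<exists>s. 0 < s \<and> s < R \<and> of_real s * cis (\<mu> * pi / 2) \<in> ?L"
    proof (intro exI conjI)
      \<comment> \<open>The point is \<open>q\<close> moved by \<open>s\<close> along the bisector
        of the tangent cone, not of the rotated lens, since \<open>\<Omega>\<close> is known only on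
        the former. The quadratic term is \<open>s * S / 4\<close>, below the linear one of at least
        \<open>3 * s * S / 4\<close>.\<close>
      define s where "s = S / (4 * k)"
      have s: "s > 0" using S k0 by (simp add: s_def)
      have ks: "k * s = S / 4" using k0 by (simp add: s_def)
      show "0 < m + s" using m s by simp
      have "s = S * (1 / k) / 4" by (simp add: s_def)
      also have "\<dots> \<le> 1 * (R / 4) / 4" using S kR k0 by (intro divide_right_mono mult_mono) auto
      finally show "m + s < R" using mR R by simp
      define z where "z = of_real (m + s) * cis (\<mu> * pi / 2)"
      have zq: "z - q = of_real s * cis (\<mu> * pi / 2)" by (simp add: z_def q_def algebra_simps)
      have nz: "cmod (z - q) = s" using s by (simp add: zq norm_mult)
      have near: "\<bar>Im (cis y * cnj e) - sin y\<bar> \<le> \<epsilon>" for y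
      proof -
        have "\<bar>Im (cis y * cnj e - cis y)\<bar> \<le> cmod (cis y * cnj e - cis y)" by (rule abs_Im_le_cmod)
        also have "cis y * cnj e - cis y = cis y * cnj (e - 1)" by (simp add: algebra_simps)
        also have "cmod \<dots> = cmod (e - 1)" by (simp add: norm_mult del: complex_cnj_diff)
        also have "\<dots> \<le> \<epsilon>" using e(3) a(4) by simp
        finally show ?thesis by (simp add: algebra_simps)
      qed
      have A: "Im ((z - q) * cnj e) \<ge> s * (3 / 4 * S)"
      proof -
        have "Im ((z - q) * cnj e) = s * Im (cis (\<mu> * pi / 2) * cnj e)" unfolding zq mult.assoc by simp
        moreover have "3 / 4 * S \<le> Im (cis (\<mu> * pi / 2) * cnj e)"
          using near[of "\<mu> * pi / 2"] \<epsilon> unfolding S_def[symmetric] by linarith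
        ultimately show ?thesis using s by (simp add: mult_left_mono)
      qed
      have B: "- Im ((z - q) * cnj e * cis (- (\<mu> * pi))) \<ge> s * (3 / 4 * S)"
      proof -
        have "\<mu> * pi / 2 + - (\<mu> * pi) = - (\<mu> * pi / 2)" by simp
        then have "cis (\<mu> * pi / 2) * cis (- (\<mu> * pi)) = cis (- (\<mu> * pi / 2))" by (simp only: cis_mult)
        then have eq: "(z - q) * cnj e * cis (- (\<mu> * pi)) = of_real s * (cis (- (\<mu> * pi / 2)) * cnj e)"
          unfolding zq by (simp add: mult_ac)
        have "- Im ((z - q) * cnj e * cis (- (\<mu> * pi))) = s * (- Im (cis (- (\<mu> * pi / 2)) * cnj e))"
          unfolding eq by (simp only: times_complex.sel Re_complex_of_real Im_complex_of_real mult_zero_left add_0_right mult_minus_right)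
        moreover have "3 / 4 * S \<le> - Im (cis (- (\<mu> * pi / 2)) * cnj e)"
          using near[of "- (\<mu> * pi / 2)"] \<epsilon> unfolding sin_minus S_def[symmetric] by linarith
        ultimately show ?thesis using s by (simp only: mult_left_mono)
      qed
      have "k * s\<^sup>2 = s * (S / 4)" unfolding ks[symmetric] by (simp add: power2_eq_square)
      moreover have "s * (S / 4) < s * (3 / 4 * S)" using s S by simp
      ultimately have "Im ((z - q) * cnj e) - k * (cmod (z - q))\<^sup>2 > 0"
        "- Im ((z - q) * cnj e * cis (- (\<mu> * pi))) - k * (cmod (z - q))\<^sup>2 > 0"
        unfolding nz using A B by linarith+
      then show "z \<in> ?L" unfolding S_def mem_lens_iff_sides[OF \<mu> e(1)] by (simp only: if_cancel simp_thms)
    qed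
    fix t assume t: "0 \<le> t" "t \<le> R"
    \<comment> \<open>Seen from \<open>p\<close>, the graph deviates from its tangent by at most
      \<open>N / 2 * (t - a)\<^sup>2\<close>, while the circle bends away with the larger
      coefficient \<open>k\<close>.\<close>
    have sides: "Im ((Complex t (\<phi>1 t) - q) * cnj e) - k * (cmod (Complex t (\<phi>1 t) - q))\<^sup>2 \<le> 0"
    proof -
      define s where "s = \<phi>1' a"
      define w where "w = cmod (Complex 1 s)"
      have w: "w \<ge> 1" using complex_Re_le_cmod[of "Complex 1 s"] by (simp add: w_def)
      define g where "g = \<phi>1 t - \<phi>1 a - s * (t - a)"
      have g: "\<bar>g\<bar> \<le> N / 2 * (t - a)\<^sup>2"
        using tangent_graphD(4)[OF tg1 a(1,2) t] by (simp add: g_def s_def)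
      have \<tau>: "\<tau> = Complex 1 s / of_real w" by (simp add: \<tau>_def s_def w_def sgn_eq)
      have "Im ((Complex t (\<phi>1 t) - p) * cnj \<tau>) = g / w"
        unfolding \<tau> using w by (simp add: p_def g_def Im_divide_of_real field_simps)
      also have "\<dots> \<le> \<bar>g\<bar> / 1" using w by (intro frac_le) auto
      also have "\<dots> \<le> k * (t - a)\<^sup>2"
        using g mult_right_mono[of "N / 2" k "(t - a)\<^sup>2"] kN N by simp
      also have "(t - a)\<^sup>2 \<le> (cmod (Complex t (\<phi>1 t) - p))\<^sup>2"
        by (simp add: p_def cmod_power2)
      then have "k * (t - a)\<^sup>2 \<le> k * (cmod (Complex t (\<phi>1 t) - p))\<^sup>2" using k0 by (intro mult_left_mono) auto
      finally show ?thesis unfolding id by simp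
    qed
    note avoid = lens_avoids_curves[OF sc e(1,2) order_trans[OF e(3) a(4)] _ m km[unfolded S_def] q_def tg1 tg2 t sides]
    show "Complex t (\<phi>1 t) \<notin> ?L" "cis (\<mu> * pi) * Complex t (\<phi>2 t) \<notin> ?L"
      unfolding S_def using avoid kN N by auto
  qed
qed

subsection \<open>Lenses inside and outside the domain\<close>

text \<open>The part of the hypotheses on \<open>\<Omega>\<close> that the construction of comparison domains uses, in coordinates
  where the tangent ray of \<open>\<sigma>1\<close> is the positive real axis. In contrast to a condition on the frontier
  it is visibly invariant under reflections.\<close>

definition corner_domain ::
  "real \<Rightarrow> real \<Rightarrow> real \<Rightarrow> complex set \<Rightarrow> complex set \<Rightarrow> complex set \<Rightarrow> (real \<Rightarrow> real) \<Rightarrow> (real \<Rightarrow> real) \<Rightarrow>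
    (real \<Rightarrow> real) \<Rightarrow> (real \<Rightarrow> real) \<Rightarrow> bool" where
  "corner_domain \<mu> N R \<Omega> \<sigma>1 \<sigma>2 \<phi>1 \<phi>1' \<phi>2 \<phi>2' \<longleftrightarrow>
     tangent_graph \<phi>1 \<phi>1' N R \<and> tangent_graph \<phi>2 \<phi>2' N R \<and>
     closed \<sigma>1 \<and> closed \<sigma>2 \<and>
     (\<forall>z\<in>\<sigma>1. cmod z < R \<longrightarrow> (\<exists>t\<in>{0..R}. z = Complex t (\<phi>1 t))) \<and>
     (\<forall>z\<in>\<sigma>2. cmod z < R \<longrightarrow> (\<exists>t\<in>{0..R}. z = cis (\<mu> * pi) * Complex t (\<phi>2 t))) \<and>
     (\<forall>t\<in>{0..R / 2}. Complex t (\<phi>1 t) \<in> \<sigma>1 \<and> cis (\<mu> * pi) * Complex t (\<phi>2 t) \<in> \<sigma>2) \<and>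
     (\<forall>A. connected A \<longrightarrow> A \<subseteq> ball 0 R \<longrightarrow> A \<inter> (\<sigma>1 \<union> \<sigma>2) = {} \<longrightarrow> A \<inter> \<Omega> \<noteq> {} \<longrightarrow> A \<subseteq> \<Omega>) \<and>
     (\<forall>z\<in>\<Omega>. cmod z < R \<longrightarrow> z \<notin> \<sigma>1 \<union> \<sigma>2) \<and>
     (\<exists>\<rho>>0. \<forall>s. 0 < s \<longrightarrow> s < \<rho> \<longrightarrow> of_real s * cis (\<mu> * pi / 2) \<in> \<Omega> \<and> - (of_real s * cis (\<mu> * pi / 2)) \<notin> \<Omega>)"

lemma corner_domainD:
  assumes "corner_domain \<mu> N R \<Omega> \<sigma>1 \<sigma>2 \<phi>1 \<phi>1' \<phi>2 \<phi>2'"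
  shows "tangent_graph \<phi>1 \<phi>1' N R" "tangent_graph \<phi>2 \<phi>2' N R" "closed \<sigma>1" "closed \<sigma>2"
    "\<And>z. z \<in> \<sigma>1 \<Longrightarrow> cmod z < R \<Longrightarrow> \<exists>t. 0 \<le> t \<and> t \<le> R \<and> z = Complex t (\<phi>1 t)"
    "\<And>z. z \<in> \<sigma>2 \<Longrightarrow> cmod z < R \<Longrightarrow> \<exists>t. 0 \<le> t \<and> t \<le> R \<and> z = cis (\<mu> * pi) * Complex t (\<phi>2 t)"
    "\<And>t. 0 \<le> t \<Longrightarrow> t \<le> R / 2 \<Longrightarrow> Complex t (\<phi>1 t) \<in> \<sigma>1"
    "\<And>t. 0 \<le> t \<Longrightarrow> t \<le> R / 2 \<Longrightarrow> cis (\<mu> * pi) * Complex t (\<phi>2 t) \<in> \<sigma>2"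
    "\<And>A. connected A \<Longrightarrow> A \<subseteq> ball 0 R \<Longrightarrow> A \<inter> (\<sigma>1 \<union> \<sigma>2) = {} \<Longrightarrow> A \<inter> \<Omega> \<noteq> {} \<Longrightarrow> A \<subseteq> \<Omega>"
    "\<And>z. z \<in> \<Omega> \<Longrightarrow> cmod z < R \<Longrightarrow> z \<notin> \<sigma>1 \<union> \<sigma>2"
    "\<exists>\<rho>>0. \<forall>s. 0 < s \<longrightarrow> s < \<rho> \<longrightarrow> of_real s * cis (\<mu> * pi / 2) \<in> \<Omega> \<and> - (of_real s * cis (\<mu> * pi / 2)) \<notin> \<Omega>"
  using assms unfolding corner_domain_def by (simp_all add: Bex_def)

lemma tangent_graph_off_ray:
  fixes s t \<beta> :: real
  assumes tg: "tangent_graph \<phi> \<phi>' N R" and t: "0 \<le> t" "t \<le> R" and NR: "0 \<le> N" "N * R \<le> \<bar>sin \<beta>\<bar>" "sin \<beta> \<noteq> 0" and s: "s \<noteq> 0"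
  shows "Complex t (\<phi> t) \<noteq> of_real s * cis \<beta>"
proof
  assume eq: "Complex t (\<phi> t) = of_real s * cis \<beta>"
  have re: "t = s * cos \<beta>" and im: "\<phi> t = s * sin \<beta>"
    using arg_cong[OF eq, of Re] arg_cong[OF eq, of Im] by simp_all
  have "\<phi> t * cos \<beta> = t * sin \<beta>" unfolding im using re by simp
  then have "t * \<bar>sin \<beta>\<bar> = \<bar>\<phi> t\<bar> * \<bar>cos \<beta>\<bar>" using t by (metis abs_mult abs_of_nonneg)
  also have "\<dots> \<le> \<bar>\<phi> t\<bar> * 1" by (intro mult_left_mono) auto
  also have "\<dots> \<le> N / 2 * t\<^sup>2" using tangent_graphD(3)[OF tg t] by simp
  also have "\<dots> = t * (N * t) / 2" by (simp add: power2_eq_square)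
  also have "\<dots> \<le> t * \<bar>sin \<beta>\<bar> / 2"
  proof -
    have "N * t \<le> N * R" using t NR by (intro mult_left_mono) auto
    then have "N * t \<le> \<bar>sin \<beta>\<bar>" using NR by simp
    then show ?thesis using t by (intro divide_right_mono mult_left_mono) auto
  qed
  finally have "t * \<bar>sin \<beta>\<bar> \<le> 0" by simp
  then have "t = 0" using t NR by (simp add: mult_le_0_iff)
  then have "\<phi> t = 0" using tangent_graphD(1)[OF tg, of 0] t by simp
  then show False using im s NR by simp
qed

lemma bisector_avoids_curves:
  assumes sc: "corner_scale \<mu> N R M \<epsilon>" and cd: "corner_domain \<mu> N R \<Omega> \<sigma>1 \<sigma>2 \<phi>1 \<phi>1' \<phi>2 \<phi>2'"
    and s: "s \<noteq> 0" "\<bar>s\<bar> < R"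
  shows "of_real s * cis (\<mu> * pi / 2) \<notin> \<sigma>1 \<union> \<sigma>2"
proof
  let ?z = "of_real s * cis (\<mu> * pi / 2)"
  assume z: "?z \<in> \<sigma>1 \<union> \<sigma>2"
  have nz: "cmod ?z < R" using s by (simp add: norm_mult)
  have \<mu>: "0 < \<mu>" "\<mu> < 2" and N: "0 < N" and "N * R \<le> sin (\<mu> * pi / 2) / 4"
    using sc by (auto simp: corner_scale_def)
  moreover have S: "sin (\<mu> * pi / 2) > 0" using \<mu> by (intro sin_gt_zero) auto
  ultimately have NR: "N * R \<le> \<bar>sin (\<mu> * pi / 2)\<bar>" "N * R \<le> \<bar>sin (- (\<mu> * pi / 2))\<bar>" by auto
  from z show False
  proof
    assume "?z \<in> \<sigma>1"
    then obtain t where "0 \<le> t" "t \<le> R" "?z = Complex t (\<phi>1 t)" using corner_domainD(5)[OF cd] nz by blast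
    then show False
      using tangent_graph_off_ray[OF corner_domainD(1)[OF cd], of t "\<mu> * pi / 2" s] NR N S s by auto
  next
    assume "?z \<in> \<sigma>2"
    then obtain t where t: "0 \<le> t" "t \<le> R" "?z = cis (\<mu> * pi) * Complex t (\<phi>2 t)"
      using corner_domainD(6)[OF cd] nz by blast
    then have "Complex t (\<phi>2 t) = ?z * cis (- (\<mu> * pi))" by (simp add: mult_ac cis_mult)
    also have "\<dots> = of_real s * cis (- (\<mu> * pi / 2))"
    proof -
      have "\<mu> * pi / 2 + - (\<mu> * pi) = - (\<mu> * pi / 2)" by simp
      then show ?thesis by (simp only: mult.assoc cis_mult)
    qed
    finally show False
      using tangent_graph_off_ray[OF corner_domainD(2)[OF cd] t(1,2), of "- (\<mu> * pi / 2)" s] NR N S s by auto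
  qed
qed

text \<open>The cone condition speaks only of points very close to 0. Each open half of the bisector
  line inside the ball is connected and avoids the curves, so it lies entirely inside or entirely
  outside \<open>\<Omega>\<close>.\<close>

lemma bisector_mem:
  assumes sc: "corner_scale \<mu> N R M \<epsilon>" and cd: "corner_domain \<mu> N R \<Omega> \<sigma>1 \<sigma>2 \<phi>1 \<phi>1' \<phi>2 \<phi>2'"
    and s: "0 < s" "s < R"
  shows "of_real s * cis (\<mu> * pi / 2) \<in> \<Omega>" "- (of_real s * cis (\<mu> * pi / 2)) \<notin> \<Omega>"
proof -
  obtain \<rho> where \<rho>: "\<rho> > 0" "\<And>s. 0 < s \<Longrightarrow> s < \<rho> \<Longrightarrow> of_real s * cis (\<mu> * pi / 2) \<in> \<Omega> \<and> - (of_real s * cis (\<mu> * pi / 2)) \<notin> \<Omega>"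
    using corner_domainD(11)[OF cd] by blast
  define s0 where "s0 = min \<rho> R / 2"
  have s0: "0 < s0" "s0 < \<rho>" "s0 < R" using \<rho>(1) s by (auto simp: s0_def)
  define A where "A = (\<lambda>s. of_real s * cis (\<mu> * pi / 2)) ` {0<..<R}"
  define B where "B = (\<lambda>s. - (of_real s * cis (\<mu> * pi / 2))) ` {0<..<R}"
  have conn: "connected A" "connected B"
    unfolding A_def B_def by (intro connected_continuous_image continuous_intros connected_Ioo)+
  have sub: "A \<subseteq> ball 0 R" "B \<subseteq> ball 0 R" by (auto simp: A_def B_def norm_mult)
  have avoid: "A \<inter> (\<sigma>1 \<union> \<sigma>2) = {}" "B \<inter> (\<sigma>1 \<union> \<sigma>2) = {}"
  proof -
    show "A \<inter> (\<sigma>1 \<union> \<sigma>2) = {}" using bisector_avoids_curves[OF sc cd] unfolding A_def by force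
    have "- (of_real t * cis (\<mu> * pi / 2)) \<notin> \<sigma>1 \<union> \<sigma>2" if "0 < t" "t < R" for t
      using bisector_avoids_curves[OF sc cd, of "- t"] that by simp
    then show "B \<inter> (\<sigma>1 \<union> \<sigma>2) = {}" unfolding B_def by force
  qed
  have "of_real s0 * cis (\<mu> * pi / 2) \<in> A \<inter> \<Omega>" using \<rho>(2)[OF s0(1,2)] s0 by (auto simp: A_def)
  then have "A \<subseteq> \<Omega>" using corner_domainD(9)[OF cd conn(1) sub(1) avoid(1)] by blast
  then show "of_real s * cis (\<mu> * pi / 2) \<in> \<Omega>" using s by (auto simp: A_def)
  have "- (of_real s0 * cis (\<mu> * pi / 2)) \<in> B" "- (of_real s0 * cis (\<mu> * pi / 2)) \<notin> \<Omega>"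
    using \<rho>(2)[OF s0(1,2)] s0 by (auto simp: B_def)
  then have "\<not> B \<subseteq> \<Omega>" by blast
  then have "B \<inter> \<Omega> = {}" using corner_domainD(9)[OF cd conn(2) sub(2) avoid(2)] by blast
  moreover have "- (of_real s * cis (\<mu> * pi / 2)) \<in> B"
    unfolding B_def by (rule image_eqI[of _ _ s]) (use s in auto)
  ultimately show "- (of_real s * cis (\<mu> * pi / 2)) \<notin> \<Omega>" by blast
qed

proposition corner_lens_inside:
  fixes \<mu> N R M \<epsilon> a :: real
  assumes sc: "corner_scale \<mu> N R M \<epsilon>" and cd: "corner_domain \<mu> N R \<Omega> \<sigma>1 \<sigma>2 \<phi>1 \<phi>1' \<phi>2 \<phi>2'"
    and a: "0 \<le> a" "a \<le> R" "20 * (M * a) \<le> 1" "3 * (M * a) \<le> \<epsilon>"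
  defines "p \<equiv> Complex a (\<phi>1 a)" and "\<tau> \<equiv> sgn (Complex 1 (\<phi>1' a))" and "S \<equiv> sin (\<mu> * pi / 2)"
  obtains e k q where "cmod e = 1" "cmod (e - 1) \<le> 3 * (M * a)" "cmod q \<le> M * a\<^sup>2" "0 < k" "k \<le> 2 * (M * S)"
    "\<And>z. Im ((z - q) * cnj e) - k * (cmod (z - q))\<^sup>2 = Im ((z - p) * cnj \<tau>) - k * (cmod (z - p))\<^sup>2"
    "lens \<mu> q (e * cis (\<mu> * pi / 2)) (k / S) \<subseteq> \<Omega>"
proof -
  obtain e k q where ekq: "cmod e = 1" "cmod (e - 1) \<le> 3 * (M * a)" "cmod q \<le> M * a\<^sup>2" "0 < k" "k \<le> 2 * (M * S)"
    "\<And>z. Im ((z - q) * cnj e) - k * (cmod (z - q))\<^sup>2 = Im ((z - p) * cnj \<tau>) - k * (cmod (z - p))\<^sup>2"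
    and L: "lens \<mu> q (e * cis (\<mu> * pi / 2)) (k / S) \<subseteq> ball 0 R"
    "connected (lens \<mu> q (e * cis (\<mu> * pi / 2)) (k / S))"
    "\<exists>s. 0 < s \<and> s < R \<and> of_real s * cis (\<mu> * pi / 2) \<in> lens \<mu> q (e * cis (\<mu> * pi / 2)) (k / S)"
    "\<And>t. 0 \<le> t \<Longrightarrow> t \<le> R \<Longrightarrow> Complex t (\<phi>1 t) \<notin> lens \<mu> q (e * cis (\<mu> * pi / 2)) (k / S)"
    "\<And>t. 0 \<le> t \<Longrightarrow> t \<le> R \<Longrightarrow> cis (\<mu> * pi) * Complex t (\<phi>2 t) \<notin> lens \<mu> q (e * cis (\<mu> * pi / 2)) (k / S)"
    using corner_lens[OF sc corner_domainD(1,2)[OF cd] a] unfolding p_def \<tau>_def S_def by metis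
  let ?L = "lens \<mu> q (e * cis (\<mu> * pi / 2)) (k / S)"
  have "?L \<inter> (\<sigma>1 \<union> \<sigma>2) = {}"
  proof (rule ccontr)
    assume "?L \<inter> (\<sigma>1 \<union> \<sigma>2) \<noteq> {}"
    then obtain z where z: "z \<in> ?L" "z \<in> \<sigma>1 \<union> \<sigma>2" by blast
    then have "cmod z < R" using L(1) by auto
    then show False using z corner_domainD(5,6)[OF cd, of z] L(4,5) by blast
  qed
  moreover have "?L \<inter> \<Omega> \<noteq> {}" using L(3) bisector_mem(1)[OF sc cd] by blast
  ultimately have "?L \<subseteq> \<Omega>" using corner_domainD(9)[OF cd L(2,1)] by blast
  with ekq show thesis by (rule that)
qed

text \<open>Complex conjugation exchanges an exterior lens for opening \<open>\<mu>\<close> with the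
  complement of an interior lens for opening \<open>2 - \<mu>\<close>; the minus sign exchanges the
  two wedges.\<close>

lemma lens_map_cnj:
  "lens_map q (e * cis ((2 - \<mu>) * pi / 2)) \<kappa> (cnj z) = - cnj (lens_map (cnj q) (cnj e * cis (\<mu> * pi / 2)) (- \<kappa>) z)"
proof -
  have "cis (- ((2 - \<mu>) * pi / 2)) = - cis (\<mu> * pi / 2)"
  proof -
    have "- ((2 - \<mu>) * pi / 2) = \<mu> * pi / 2 - pi" by (simp add: field_simps)
    then show ?thesis by (simp only:) (simp add: complex_eq_iff cos_diff sin_diff)
  qed
  moreover have "cmod (cnj z - q) = cmod (z - cnj q)"
    by (metis complex_cnj_cnj complex_cnj_diff complex_mod_cnj)
  ultimately show ?thesis by (simp add: lens_map_def cis_cnj)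
qed

text \<open>The conjugate of the complement has opening \<open>(2 - \<mu>) * pi\<close>, keeps its
  first side along the positive real axis and has the negated graphs as sides. The lens obtained
  there contains a point of the ray opposite to the bisector, hence is disjoint from
  \<open>\<Omega>\<close>; its complement contains all of \<open>\<Omega>\<close>.\<close>

proposition corner_lens_outside:
  fixes \<mu> N R M \<epsilon> a :: real
  assumes sc: "corner_scale \<mu> N R M \<epsilon>" and cd: "corner_domain \<mu> N R \<Omega> \<sigma>1 \<sigma>2 \<phi>1 \<phi>1' \<phi>2 \<phi>2'"
    and a: "0 \<le> a" "a \<le> R" "20 * (M * a) \<le> 1" "3 * (M * a) \<le> \<epsilon>"
  defines "p \<equiv> Complex a (\<phi>1 a)" and "\<tau> \<equiv> sgn (Complex 1 (\<phi>1' a))" and "S \<equiv> sin (\<mu> * pi / 2)"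
  obtains e k q where "cmod e = 1" "cmod (e - 1) \<le> 3 * (M * a)" "cmod q \<le> M * a\<^sup>2" "0 < k" "k \<le> 2 * (M * S)"
    "\<And>z. Im ((z - q) * cnj e) + k * (cmod (z - q))\<^sup>2 = Im ((z - p) * cnj \<tau>) + k * (cmod (z - p))\<^sup>2"
    "\<And>z. z \<in> \<Omega> \<Longrightarrow> cos (\<mu> * pi / 2) * \<bar>Im (lens_map q (e * cis (\<mu> * pi / 2)) (- (k / S)) z)\<bar>
      \<le> S * Re (lens_map q (e * cis (\<mu> * pi / 2)) (- (k / S)) z)"
proof -
  define \<mu>' where "\<mu>' = 2 - \<mu>"
  have half: "\<mu>' * pi / 2 = pi - \<mu> * pi / 2" and full: "\<mu>' * pi = 2 * pi - \<mu> * pi" by (simp_all add: \<mu>'_def field_simps)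
  have S': "sin (\<mu>' * pi / 2) = S" and C': "cos (\<mu>' * pi / 2) = - cos (\<mu> * pi / 2)"
    unfolding half by (simp_all add: S_def)
  have cis': "cis (\<mu>' * pi) = cnj (cis (\<mu> * pi))" unfolding full by (simp add: complex_eq_iff cos_diff sin_diff)
  have cish: "cis (\<mu>' * pi / 2) = - cnj (cis (\<mu> * pi / 2))" unfolding half by (simp add: complex_eq_iff)
  have sc': "corner_scale \<mu>' N R M \<epsilon>" using corner_scale_supplement[OF sc] by (simp add: \<mu>'_def)
  note tg = tangent_graph_uminus[OF corner_domainD(1)[OF cd]] tangent_graph_uminus[OF corner_domainD(2)[OF cd]]
  have p': "Complex a (- \<phi>1 a) = cnj p" by (simp add: p_def complex_eq_iff)
  have "Complex 1 (- \<phi>1' a) = cnj (Complex 1 (\<phi>1' a))" by (simp add: complex_eq_iff)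
  then have \<tau>': "sgn (Complex 1 (- \<phi>1' a)) = cnj \<tau>" by (simp add: \<tau>_def sgn_eq)
  obtain e k q where ekq: "cmod e = 1" "cmod (e - 1) \<le> 3 * (M * a)" "cmod q \<le> M * a\<^sup>2" "0 < k" "k \<le> 2 * (M * S)"
    "\<And>z. Im ((z - q) * cnj e) - k * (cmod (z - q))\<^sup>2 = Im ((z - cnj p) * cnj (cnj \<tau>)) - k * (cmod (z - cnj p))\<^sup>2"
    and L: "lens \<mu>' q (e * cis (\<mu>' * pi / 2)) (k / S) \<subseteq> ball 0 R"
    "connected (lens \<mu>' q (e * cis (\<mu>' * pi / 2)) (k / S))"
    "\<exists>s. 0 < s \<and> s < R \<and> of_real s * cis (\<mu>' * pi / 2) \<in> lens \<mu>' q (e * cis (\<mu>' * pi / 2)) (k / S)"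
    "\<And>t. 0 \<le> t \<Longrightarrow> t \<le> R \<Longrightarrow> Complex t (- \<phi>1 t) \<notin> lens \<mu>' q (e * cis (\<mu>' * pi / 2)) (k / S)"
    "\<And>t. 0 \<le> t \<Longrightarrow> t \<le> R \<Longrightarrow> cis (\<mu>' * pi) * Complex t (- \<phi>2 t) \<notin> lens \<mu>' q (e * cis (\<mu>' * pi / 2)) (k / S)"
    using corner_lens[OF sc' tg a] unfolding p' \<tau>' S' by metis
  let ?L = "lens \<mu>' q (e * cis (\<mu>' * pi / 2)) (k / S)"
  define L' where "L' = cnj ` ?L"
  have mem: "z \<in> L' \<longleftrightarrow> cnj z \<in> ?L" for z
    unfolding L'_def by (metis (no_types, lifting) complex_cnj_cnj image_iff)
  have "connected L'" unfolding L'_def by (intro connected_continuous_image continuous_intros L(2))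
  moreover have L'b: "L' \<subseteq> ball 0 R"
  proof
    fix z assume "z \<in> L'"
    then have "cnj z \<in> ball 0 R" using mem L(1) by blast
    then show "z \<in> ball 0 R" by simp
  qed
  moreover have "L' \<inter> (\<sigma>1 \<union> \<sigma>2) = {}"
  proof (rule ccontr)
    assume "L' \<inter> (\<sigma>1 \<union> \<sigma>2) \<noteq> {}"
    then obtain z where z: "cnj z \<in> ?L" "z \<in> \<sigma>1 \<union> \<sigma>2" "z \<in> L'" using mem by blast
    then have "cmod z < R" using L'b by auto
    then consider t where "0 \<le> t" "t \<le> R" "z = Complex t (\<phi>1 t)"
      | t where "0 \<le> t" "t \<le> R" "z = cis (\<mu> * pi) * Complex t (\<phi>2 t)"
      using corner_domainD(5,6)[OF cd, of z] z(2) by blast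
    then show False
    proof cases
      case 1
      then have "cnj z = Complex t (- \<phi>1 t)" by (simp add: complex_eq_iff)
      then show False using L(4) 1 z(1) by simp
    next
      case 2
      have "cnj (Complex t (\<phi>2 t)) = Complex t (- \<phi>2 t)" by (simp add: complex_eq_iff)
      then have "cnj z = cis (\<mu>' * pi) * Complex t (- \<phi>2 t)" unfolding cis' 2(3) by simp
      then show False using L(5) 2 z(1) by simp
    qed
  qed
  moreover have "\<not> L' \<subseteq> \<Omega>"
  proof -
    obtain s where s: "0 < s" "s < R" "of_real s * cis (\<mu>' * pi / 2) \<in> ?L" using L(3) by blast
    have "of_real s * cis (\<mu>' * pi / 2) = cnj (- (of_real s * cis (\<mu> * pi / 2)))" unfolding cish by simp
    then have "- (of_real s * cis (\<mu> * pi / 2)) \<in> L'" using s(3) mem by simp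
    then show ?thesis using bisector_mem(2)[OF sc cd s(1,2)] by blast
  qed
  ultimately have disj: "L' \<inter> \<Omega> = {}" using corner_domainD(9)[OF cd] by blast
  have idc: "Im ((z - cnj q) * cnj (cnj e)) + k * (cmod (z - cnj q))\<^sup>2 = Im ((z - p) * cnj \<tau>) + k * (cmod (z - p))\<^sup>2" for z
  proof -
    have 1: "(cnj z - q) * cnj e = cnj ((z - cnj q) * cnj (cnj e))" "(cnj z - cnj p) * cnj (cnj \<tau>) = cnj ((z - p) * cnj \<tau>)"
      by simp_all
    have 2: "cmod (cnj z - q) = cmod (z - cnj q)" "cmod (cnj z - cnj p) = cmod (z - p)"
      by (metis complex_cnj_cnj complex_cnj_diff complex_mod_cnj)+
    have "Im A + x = Im B + y" if "Im (cnj A) - x = Im (cnj B) - y" for A B x y using that by simp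
    from this[OF ekq(6)[of "cnj z", unfolded 1 2]] show ?thesis .
  qed
  have out: "cos (\<mu> * pi / 2) * \<bar>Im (lens_map (cnj q) (cnj e * cis (\<mu> * pi / 2)) (- (k / S)) z)\<bar>
      \<le> S * Re (lens_map (cnj q) (cnj e * cis (\<mu> * pi / 2)) (- (k / S)) z)" if "z \<in> \<Omega>" for z
  proof -
    have "cnj z \<notin> ?L" using disj that mem by blast
    then show ?thesis
      by (simp add: lens_def wedge_def lens_map_cnj[of q e \<mu> "k / S" z, folded \<mu>'_def] S' C')
  qed
  show thesis
  proof (rule that[OF _ _ _ ekq(4,5) idc out])
    show "cmod (cnj e) = 1" "cmod (cnj q) \<le> M * a\<^sup>2" using ekq by simp_all
    show "cmod (cnj e - 1) \<le> 3 * (M * a)"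
      using ekq(2) by (metis complex_cnj_diff complex_cnj_one complex_mod_cnj)
  qed
qed

subsection \<open>The nearest boundary point\<close>

text \<open>The scalar product of \<open>x - p\<close> with the tangent is the first-order part of
  the squared distance, and the Taylor bound controls the rest by \<open>K * \<eta>\<^sup>2\<close>.
  At \<open>a = 0\<close> only forward variations exist, which leaves an inequality.\<close>

lemma foot_first_order:
  fixes a b :: real
  assumes tg: "tangent_graph \<phi> \<phi>' N R" and a: "0 \<le> a" "a < b" "b \<le> R" and N: "N \<ge> 0"
    and min: "\<And>t. 0 \<le> t \<Longrightarrow> t \<le> b \<Longrightarrow> cmod (x - Complex a (\<phi> a)) \<le> cmod (x - Complex t (\<phi> t))"
  defines "g \<equiv> Re ((x - Complex a (\<phi> a)) * cnj (Complex 1 (\<phi>' a)))"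
  shows "g \<le> 0" "0 < a \<Longrightarrow> g = 0"
proof -
  define p where "p = Complex a (\<phi> a)"
  define s where "s = \<phi>' a"
  define K where "K = N * cmod (x - p) + (1 + \<bar>s\<bar> + N / 2)\<^sup>2"
  have K: "K > 0" unfolding K_def using N by (intro add_nonneg_pos) (auto intro!: zero_less_power)
  have key: "2 * (\<eta> * g) \<le> K * \<eta>\<^sup>2" if \<eta>: "0 \<le> a + \<eta>" "a + \<eta> \<le> b" "\<bar>\<eta>\<bar> \<le> 1" for \<eta>
  proof -
    define E where "E = \<phi> (a + \<eta>) - \<phi> a - s * \<eta>"
    have E: "\<bar>E\<bar> \<le> N / 2 * \<eta>\<^sup>2"
      using tangent_graphD(4)[OF tg a(1), of "a + \<eta>"] a \<eta> by (simp add: E_def s_def)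
    define v where "v = Complex \<eta> (s * \<eta> + E)"
    have P: "Complex (a + \<eta>) (\<phi> (a + \<eta>)) = p + v" by (simp add: p_def v_def E_def complex_eq_iff)
    define y where "y = x - p"
    have "(cmod y)\<^sup>2 \<le> (cmod (y - v))\<^sup>2"
      using min[of "a + \<eta>"] \<eta> unfolding P by (intro power_mono) (auto simp: y_def p_def algebra_simps)
    also have "\<dots> = (cmod y)\<^sup>2 - 2 * Re (y * cnj v) + (cmod v)\<^sup>2"
      by (simp only: cmod_power2) (simp add: power2_eq_square algebra_simps)
    finally have 1: "2 * Re (y * cnj v) \<le> (cmod v)\<^sup>2" by simp
    have 2: "Re (y * cnj v) = \<eta> * g + E * Im y"
      by (simp add: v_def g_def y_def p_def s_def algebra_simps)
    have 3: "- (2 * (E * Im y)) \<le> N * \<eta>\<^sup>2 * cmod y"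
    proof -
      have "- (E * Im y) \<le> \<bar>E\<bar> * \<bar>Im y\<bar>" unfolding abs_mult[symmetric] by (rule abs_ge_minus_self)
      also have "\<dots> \<le> N / 2 * \<eta>\<^sup>2 * cmod y" using E abs_Im_le_cmod[of y] N by (intro mult_mono) auto
      finally show ?thesis by simp
    qed
    have 4: "cmod v \<le> \<bar>\<eta>\<bar> * (1 + \<bar>s\<bar> + N / 2)"
    proof -
      have "cmod v \<le> \<bar>\<eta>\<bar> + \<bar>s * \<eta> + E\<bar>" using cmod_le[of v] by (simp add: v_def)
      also have "\<bar>s * \<eta> + E\<bar> \<le> \<bar>s\<bar> * \<bar>\<eta>\<bar> + \<bar>E\<bar>" by (metis abs_mult abs_triangle_ineq)
      also have "\<bar>E\<bar> \<le> N / 2 * \<bar>\<eta>\<bar>"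
      proof -
        have "\<eta>\<^sup>2 \<le> \<bar>\<eta>\<bar>" using \<eta>(3) mult_left_le[of "\<bar>\<eta>\<bar>" "\<bar>\<eta>\<bar>"] by (simp add: power2_eq_square abs_mult[symmetric])
        then have "N / 2 * \<eta>\<^sup>2 \<le> N / 2 * \<bar>\<eta>\<bar>" using N by (intro mult_left_mono) auto
        then show ?thesis using E by linarith
      qed
      finally show ?thesis by (simp add: algebra_simps)
    qed
    have "(cmod v)\<^sup>2 \<le> (\<bar>\<eta>\<bar> * (1 + \<bar>s\<bar> + N / 2))\<^sup>2" using 4 by (intro power_mono) auto
    also have "\<dots> = \<eta>\<^sup>2 * (1 + \<bar>s\<bar> + N / 2)\<^sup>2" by (simp add: power_mult_distrib)
    finally show ?thesis using 1 2 3 by (simp add: K_def y_def algebra_simps)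
  qed
  show g0: "g \<le> 0"
  proof (rule ccontr)
    assume "\<not> g \<le> 0"
    \<comment> \<open>With \<open>\<eta> \<le> g / K\<close> the quadratic term is at most half of
      the linear one, which contradicts \<open>key\<close>.\<close>
    define \<eta> where "\<eta> = min (min 1 (b - a)) (g / K)"
    have \<eta>: "0 < \<eta>" "\<eta> \<le> 1" "a + \<eta> \<le> b" "\<eta> \<le> g / K" using a K \<open>\<not> g \<le> 0\<close> by (auto simp: \<eta>_def)
    have "\<eta> * (2 * g) \<le> \<eta> * (K * \<eta>)" using key[of \<eta>] \<eta> a by (simp add: power2_eq_square mult_ac)
    then have "2 * g \<le> K * \<eta>" using \<eta> by simp
    also have "\<dots> \<le> g" using \<eta>(4) K by (simp add: field_simps)
    finally show False using \<open>\<not> g \<le> 0\<close> by simp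
  qed
  show "g = 0" if "0 < a"
  proof (rule ccontr)
    assume "g \<noteq> 0"
    then have "- g > 0" using g0 by simp
    define \<eta> where "\<eta> = min (min 1 a) (- g / K)"
    have \<eta>: "0 < \<eta>" "\<eta> \<le> 1" "\<eta> \<le> a" "\<eta> \<le> - g / K" using that K \<open>- g > 0\<close> by (auto simp: \<eta>_def divide_neg_pos)
    have "\<eta> * (2 * (- g)) \<le> \<eta> * (K * \<eta>)" using key[of "- \<eta>"] \<eta> a by (simp add: power2_eq_square mult_ac)
    then have "2 * (- g) \<le> K * \<eta>" using \<eta>(1) by (simp only: mult_le_cancel_left_pos)
    also have "\<dots> \<le> - g" using \<eta>(4) K by (simp add: field_simps)
    finally show False using \<open>- g > 0\<close> by simp
  qed
qed

text \<open>Both points lie on the circle of radius \<open>r\<close>, and their heights differ by at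
  most \<open>N * a\<^sup>2\<close>. Factoring differences of squares compares the real parts, whose
  sum is at least \<open>a / 2\<close>; the quotient stays O(N * r * a) even if \<open>a\<close> is
  tiny compared with \<open>r\<close>.\<close>

lemma foot_polar:
  fixes a d r f s N :: real
  defines "x \<equiv> Complex a f + of_real d * (\<i> * sgn (Complex 1 s))"
  assumes r: "cmod x = r" "0 < r" and a: "0 < a" "a \<le> 2 * r" and d: "0 \<le> d" "d \<le> r"
    and f: "\<bar>f\<bar> \<le> N / 2 * a\<^sup>2" and s: "\<bar>s\<bar> \<le> N * a" and N: "0 \<le> N" "N * r \<le> 1 / 4"
  shows "cmod (x - rcis r (arcsin (d / r))) \<le> 12 * N * r\<^sup>2"
proof -
  define w where "w = cmod (Complex 1 s)"
  have w: "1 \<le> w" "w \<le> 1 + \<bar>s\<bar>"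
    using complex_Re_le_cmod[of "Complex 1 s"] cmod_le[of "Complex 1 s"] by (auto simp: w_def)
  have w2: "w\<^sup>2 = 1 + s\<^sup>2" by (simp add: w_def cmod_power2)
  define X where "X = a - d * s / w"
  define Y where "Y = f + d / w"
  have x: "x = Complex X Y"
    by (simp add: x_def X_def Y_def sgn_eq w_def[symmetric] complex_eq_iff Re_divide_of_real Im_divide_of_real)
  have XY: "X\<^sup>2 + Y\<^sup>2 = r\<^sup>2" using r(1) by (metis cmod_power2 complex.sel x)
  have Na: "N * a \<le> 1 / 2" using mult_left_mono[OF a(2) N(1)] N by simp
  have Xa: "\<bar>X - a\<bar> \<le> N * r * a"
  proof -
    have "\<bar>X - a\<bar> = d * \<bar>s\<bar> / w" using d w by (simp add: X_def abs_mult)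
    also have "\<dots> \<le> d * \<bar>s\<bar> / 1" using w d by (intro frac_le) auto
    also have "\<dots> \<le> r * (N * a)" unfolding div_by_1 using d s r by (intro mult_mono) auto
    finally show ?thesis by (simp add: mult_ac)
  qed
  have "N * r * a \<le> 1 / 4 * a" using N a by (intro mult_right_mono) auto
  then have Xpos: "X \<ge> a / 2" using Xa a by linarith
  have Yd: "\<bar>Y - d\<bar> \<le> N * a\<^sup>2"
  proof -
    have "0 \<le> 1 - 1 / w" "1 - 1 / w \<le> s\<^sup>2 / 2"
    proof -
      show "0 \<le> 1 - 1 / w" using w by simp
      have "(w - 1) * 2 \<le> (w - 1) * (w + 1)" using w by (intro mult_left_mono) auto
      also have "\<dots> = s\<^sup>2" using w2 by (simp add: power2_eq_square algebra_simps)
      finally have *: "(w - 1) / 1 \<le> s\<^sup>2 / 2" by simp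
      have "1 - 1 / w = (w - 1) / w" using w by (simp add: field_simps)
      also have "\<dots> \<le> (w - 1) / 1" using w by (intro frac_le) auto
      also note *
      finally show "1 - 1 / w \<le> s\<^sup>2 / 2" .
    qed
    then have "\<bar>d / w - d\<bar> \<le> d * (s\<^sup>2 / 2)"
    proof -
      have "d / w - d = - (d * (1 - 1 / w))" by (simp add: algebra_simps)
      then have "\<bar>d / w - d\<bar> = d * (1 - 1 / w)" using d \<open>0 \<le> 1 - 1 / w\<close> by (simp add: abs_mult)
      then show ?thesis using mult_left_mono[OF \<open>1 - 1 / w \<le> s\<^sup>2 / 2\<close> d(1)] by simp
    qed
    also have "d * (s\<^sup>2 / 2) \<le> r * ((N * a)\<^sup>2 / 2)"
    proof (intro mult_mono divide_right_mono)
      show "s\<^sup>2 \<le> (N * a)\<^sup>2" using power_mono[OF s, of 2] by simp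
    qed (use d r in auto)
    also have "\<dots> = (N * r) * (N / 2 * a\<^sup>2)" by (simp add: power2_eq_square)
    also have "\<dots> \<le> 1 * (N / 2 * a\<^sup>2)" using N by (intro mult_right_mono) auto
    finally have "\<bar>d / w - d\<bar> \<le> N / 2 * a\<^sup>2" by simp
    moreover have "Y - d = f + (d / w - d)" by (simp add: Y_def)
    ultimately show ?thesis using f by linarith
  qed
  define X' where "X' = r * cos (arcsin (d / r))"
  have dr: "0 \<le> d / r" "d / r \<le> 1" using d r by auto
  have sin: "r * sin (arcsin (d / r)) = d" using dr r by (subst sin_arcsin) auto
  have X'0: "X' \<ge> 0"
    unfolding X'_def using dr r arcsin_bounded[of "d / r"] by (intro mult_nonneg_nonneg cos_ge_zero) auto
  have X'2: "X'\<^sup>2 = r\<^sup>2 - d\<^sup>2"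
  proof -
    have "X'\<^sup>2 + d\<^sup>2 = r\<^sup>2 * ((cos (arcsin (d / r)))\<^sup>2 + (sin (arcsin (d / r)))\<^sup>2)"
    proof -
      have "d\<^sup>2 = (r * sin (arcsin (d / r)))\<^sup>2" by (simp only: sin)
      then show ?thesis unfolding X'_def by (simp only: power_mult_distrib distrib_left)
    qed
    then show ?thesis by simp
  qed
  have XX': "\<bar>X' - X\<bar> \<le> 4 * N * r * a"
  proof -
    have "(X' - X) * (X' + X) = (Y - d) * (Y + d)"
      using X'2 XY by (simp add: power2_eq_square algebra_simps)
    then have "\<bar>X' - X\<bar> * \<bar>X' + X\<bar> = \<bar>Y - d\<bar> * \<bar>Y + d\<bar>" by (metis abs_mult)
    also have "\<dots> \<le> (N * a\<^sup>2) * (2 * r)"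
    proof (rule mult_mono[OF Yd])
      have "\<bar>Y\<bar> \<le> r" using abs_Im_le_cmod[of x] r x by simp
      then show "\<bar>Y + d\<bar> \<le> 2 * r" using d by linarith
    qed (use N in auto)
    finally have 1: "\<bar>X' - X\<bar> * \<bar>X' + X\<bar> \<le> (N * a\<^sup>2) * (2 * r)" .
    have "\<bar>X' - X\<bar> * (a / 2) \<le> \<bar>X' - X\<bar> * \<bar>X' + X\<bar>"     proof (rule mult_left_mono)
      show "a / 2 \<le> \<bar>X' + X\<bar>" using Xpos X'0 by linarith
    qed simp
    with 1 have "(a / 2) * \<bar>X' - X\<bar> \<le> (a / 2) * (4 * N * r * a)" by (simp add: power2_eq_square mult_ac)
    then show ?thesis by (rule mult_left_le_imp_le) (use a in simp)
  qed
  have "cmod (x - rcis r (arcsin (d / r))) \<le> \<bar>X - X'\<bar> + \<bar>Y - d\<bar>"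
    using cmod_le[of "x - rcis r (arcsin (d / r))"] by (simp add: x X'_def sin)
  also have "\<dots> \<le> 4 * N * r * a + N * a\<^sup>2" using XX' Yd by (simp add: abs_minus_commute)
  also have "\<dots> \<le> 4 * N * r * (2 * r) + N * (2 * r)\<^sup>2"
    using a N r by (intro add_mono mult_left_mono power_mono) auto
  also have "\<dots> = 12 * N * r\<^sup>2" by (simp add: power2_eq_square)
  finally show ?thesis .
qed

text \<open>A direction beyond \<open>5 / 8\<close> of the opening angle is closer to the second ray
  by a fixed proportion. This gives the angle bound that \<open>wedge_weight_near_side\<close>
  requires.\<close>

lemma nearer_side_angle_gap:
  fixes \<mu> :: real
  assumes \<mu>: "0 < \<mu>"
  obtains c where "c > 0" "\<And>t. 5 * pi / 8 * \<mu> < t \<Longrightarrow> t \<le> pi / 2 \<Longrightarrow>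
    \<bar>sin (\<mu> * pi - t)\<bar> + c \<le> sin t \<and> 0 \<le> cos (\<mu> * pi - t)"
proof (cases "5 * pi / 8 * \<mu> < pi / 2")
  case False
  show thesis by (rule that[of 1]) (use False in auto)
next
  case True
  define h where "h = \<mu> * pi / 2"
  have h: "0 < h" "5 * h / 4 < pi / 2" using \<mu> True by (auto simp: h_def)
  \<comment> \<open>With \<open>y = t - h\<close>, the sines of \<open>t\<close> and
    \<open>2 * h - t\<close> have difference \<open>2 * cos h * sin y\<close> and sum
    \<open>2 * sin h * cos y\<close>; the entries are lower bounds of these.\<close>
  define c where "c = min (2 * cos h * sin (h / 4)) (2 * sin h * sin h)"
  have "cos h > 0" using h by (intro cos_gt_zero) auto
  moreover have "sin h > 0" "sin (h / 4) > 0" using h by (auto intro!: sin_gt_zero)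
  ultimately have c: "c > 0" by (simp add: c_def)
  have "\<bar>sin (\<mu> * pi - t)\<bar> + c \<le> sin t \<and> 0 \<le> cos (\<mu> * pi - t)"
    if t: "5 * pi / 8 * \<mu> < t" "t \<le> pi / 2" for t
  proof -
    have "5 * h / 4 = 5 * pi / 8 * \<mu>" by (simp add: h_def)
    then have t': "5 * h / 4 < t" using t by simp
    have 2: "\<mu> * pi = 2 * h" by (simp add: h_def)
    define y where "y = t - h"
    have y: "h / 4 \<le> y" "y \<le> pi / 2 - h" using t t' by (auto simp: y_def)
    have e1: "sin t = sin h * cos y + cos h * sin y" using sin_add[of h y] by (simp add: y_def)
    have e2: "sin (2 * h - t) = sin h * cos y - cos h * sin y"
      using sin_diff[of h y] by (simp add: y_def algebra_simps)
    have "sin (h / 4) \<le> sin y" using y h by (intro sin_monotone_2pi_le) auto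
    then have s: "2 * cos h * sin (h / 4) \<le> 2 * cos h * sin y" using \<open>cos h > 0\<close> by (intro mult_left_mono) auto
    have "cos (pi / 2 - h) \<le> cos y" using y h by (intro cos_monotone_0_pi_le) auto
    then have "sin h \<le> cos y" by (simp add: cos_diff)
    then have "2 * sin h * sin h \<le> 2 * sin h * cos y" using \<open>sin h > 0\<close> by (intro mult_left_mono) auto
    with s have "c \<le> 2 * (cos h * sin y)" "c \<le> 2 * (sin h * cos y)" unfolding c_def by linarith+
    then have "\<bar>sin (2 * h - t)\<bar> + c \<le> sin t" unfolding e1 e2 by linarith
    moreover have "0 \<le> cos (2 * h - t)" using t t' h by (intro cos_ge_zero) auto
    ultimately show ?thesis by (simp add: 2)
  qed
  with c show thesis by (rule that)
qed

text \<open>The 18 consists of 6 from the rotation \<open>e\<close>, 4 from the shift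
  \<open>q\<close> and 8 from the curvature term.\<close>

lemma lens_map_near_identity:
  assumes e: "cmod e = 1" "cmod (e - 1) \<le> 3 * (M * a)" and q: "cmod q \<le> M * a\<^sup>2" and \<kappa>: "\<bar>\<kappa>\<bar> \<le> 2 * M"
    and a: "0 \<le> a" "a \<le> 2 * r" and x: "cmod x \<le> r" and r: "4 * (M * r) \<le> 1" and M: "0 \<le> M"
  shows "cmod (lens_map q (e * cis h) \<kappa> x * cis h - x) \<le> 18 * M * r\<^sup>2"
proof -
  have r0: "0 \<le> r" using a by simp
  have "lens_map q (e * cis h) \<kappa> x * cis h = (x - q) * cnj e * (cis (- h) * cis h) - of_real (\<kappa> * (cmod (x - q))\<^sup>2) * cis h"
    by (simp add: lens_map_def cis_cnj algebra_simps)
  also have "cis (- h) * cis h = 1" by (simp add: cis_mult)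
  finally have eq: "lens_map q (e * cis h) \<kappa> x * cis h - x
      = x * (cnj e - 1) - (q * cnj e + of_real (\<kappa> * (cmod (x - q))\<^sup>2) * cis h)"
    by (simp add: algebra_simps)
  have q': "cmod q \<le> 4 * M * r\<^sup>2"
  proof -
    have "M * a\<^sup>2 \<le> M * (2 * r)\<^sup>2" using a M by (intro mult_left_mono power_mono) auto
    then show ?thesis using q by (simp add: power_mult_distrib)
  qed
  have "4 * M * r\<^sup>2 = 4 * (M * r) * r" by (simp add: power2_eq_square)
  also have "\<dots> \<le> 1 * r" using r r0 by (intro mult_right_mono) auto
  finally have xq: "cmod (x - q) \<le> 2 * r" using norm_triangle_ineq4[of x q] x q' by linarith
  have ce: "cmod (cnj e - 1) = cmod (e - 1)" by (metis complex_cnj_diff complex_cnj_one complex_mod_cnj)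
  have 1: "cmod (x * (cnj e - 1)) \<le> r * (3 * (M * (2 * r)))"
  proof -
    have "cmod (x * (cnj e - 1)) \<le> r * (3 * (M * a))"
      unfolding norm_mult ce using x e r0 by (intro mult_mono) auto
    also have "\<dots> \<le> r * (3 * (M * (2 * r)))" using r0 a M by (intro mult_left_mono) auto
    finally show ?thesis .
  qed
  have 2: "cmod (of_real (\<kappa> * (cmod (x - q))\<^sup>2) * cis h) \<le> 2 * M * (2 * r)\<^sup>2"
  proof -
    have "cmod (of_real (\<kappa> * (cmod (x - q))\<^sup>2) * cis h) = \<bar>\<kappa>\<bar> * (cmod (x - q))\<^sup>2"
      by (simp only: norm_mult norm_of_real norm_cis abs_mult) simp
    also have "\<dots> \<le> 2 * M * (2 * r)\<^sup>2" using \<kappa> xq M by (intro mult_mono power_mono) auto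
    finally show ?thesis .
  qed
  have 3: "cmod (q * cnj e) \<le> 4 * M * r\<^sup>2" using q' e by (simp add: norm_mult)
  have "cmod (lens_map q (e * cis h) \<kappa> x * cis h - x)
      \<le> cmod (x * (cnj e - 1)) + (cmod (q * cnj e) + cmod (of_real (\<kappa> * (cmod (x - q))\<^sup>2) * cis h))"
    unfolding eq by (intro order_trans[OF norm_triangle_ineq4] add_left_mono norm_triangle_ineq)
  also have "\<dots> \<le> r * (3 * (M * (2 * r))) + (4 * M * r\<^sup>2 + 2 * M * (2 * r)\<^sup>2)" using 1 2 3 by linarith
  also have "\<dots> = 18 * M * r\<^sup>2" by (simp add: power2_eq_square)
  finally show ?thesis .
qed

text \<open>A point just across the curve at its foot lies on the wrong side of the first arc of the
  exterior lens, which touches the curve there. Its lens coordinate lies slightly below the first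
  side of the wedge, so it cannot belong to \<open>\<Omega>\<close>.\<close>

lemma foot_on_outer_side:
  fixes \<mu> N R M \<epsilon> a d :: real
  assumes sc: "corner_scale \<mu> N R M \<epsilon>" and cd: "corner_domain \<mu> N R \<Omega> \<sigma>1 \<sigma>2 \<phi>1 \<phi>1' \<phi>2 \<phi>2'"
    and a: "0 < a" "a \<le> R" "100 * (M * a) \<le> 1" "3 * (M * a) \<le> \<epsilon>" and d: "0 < d"
    and ball: "\<And>\<eta>. 0 < \<eta> \<Longrightarrow> \<eta> \<le> d \<Longrightarrow> Complex a (\<phi>1 a) - of_real \<eta> * (\<i> * sgn (Complex 1 (\<phi>1' a))) \<in> \<Omega>"
  shows False
proof -
  define p where "p = Complex a (\<phi>1 a)"
  define \<tau> where "\<tau> = sgn (Complex 1 (\<phi>1' a))"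
  define S where "S = sin (\<mu> * pi / 2)"
  define C where "C = cos (\<mu> * pi / 2)"
  have \<mu>: "0 < \<mu>" "\<mu> < 2" and M: "0 < M" and N: "0 < N" and NR: "N * R \<le> \<epsilon>" and \<epsilon>: "\<epsilon> \<le> S / 4"
    using sc by (auto simp: corner_scale_def S_def)
  have S: "S > 0" "S \<le> 1" unfolding S_def using \<mu> by (auto intro!: sin_gt_zero)
  have CS: "C * C + S * S = 1" using sin_cos_squared_add2[of "\<mu> * pi / 2"] by (simp add: C_def S_def power2_eq_square)
  have "Complex 1 (\<phi>1' a) \<noteq> 0" by (simp add: complex_eq_iff)
  then have \<tau>: "cmod \<tau> = 1" unfolding \<tau>_def by (simp add: norm_sgn)
  obtain e k q where e: "cmod e = 1" "cmod (e - 1) \<le> 3 * (M * a)" and q: "cmod q \<le> M * a\<^sup>2"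
    and k: "0 < k" "k \<le> 2 * (M * S)"
    and id: "\<And>z. Im ((z - q) * cnj e) + k * (cmod (z - q))\<^sup>2 = Im ((z - p) * cnj \<tau>) + k * (cmod (z - p))\<^sup>2"
    and out: "\<And>z. z \<in> \<Omega> \<Longrightarrow> C * \<bar>Im (lens_map q (e * cis (\<mu> * pi / 2)) (- (k / S)) z)\<bar>
      \<le> S * Re (lens_map q (e * cis (\<mu> * pi / 2)) (- (k / S)) z)"
  proof -
    have "0 \<le> a" "20 * (M * a) \<le> 1" using a by auto
    from corner_lens_outside[OF sc cd this(1) a(2) this(2) a(4)] show thesis
      using that unfolding p_def \<tau>_def S_def C_def by metis
  qed
  \<comment> \<open>The bound \<open>1 / (2 * k)\<close> keeps the quadratic term below half of the
    linear one; \<open>a * S / 8\<close> keeps the point near the first side, which fixes the sign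
    of \<open>Im W\<close>.\<close>
  define \<eta> where "\<eta> = min d (min (a * S / 8) (1 / (2 * k)))"
  have \<eta>: "0 < \<eta>" "\<eta> \<le> d" "\<eta> \<le> a * S / 8" "\<eta> \<le> 1 / (2 * k)" using d a S k by (auto simp: \<eta>_def)
  define z where "z = p - of_real \<eta> * (\<i> * \<tau>)"
  have z\<Omega>: "z \<in> \<Omega>" using ball[OF \<eta>(1,2)] by (simp add: z_def p_def \<tau>_def)
  define W where "W = lens_map q (e * cis (\<mu> * pi / 2)) (- (k / S)) z"
  define V where "V = W * cis (\<mu> * pi / 2)"
  have aS: "a * S / 8 \<le> a / 8" using a S by simp
  have ImV: "Im V = - \<eta> + k * \<eta>\<^sup>2"
  proof -
    have "Im V = Im ((z - q) * cnj e) - (- k) * (cmod (z - q))\<^sup>2"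
      unfolding V_def W_def S_def using lens_sides(3)[OF \<mu> e(1), of q "- k" z] by simp
    also have "\<dots> = Im ((z - p) * cnj \<tau>) + k * (cmod (z - p))\<^sup>2" using id[of z] by simp
    also have "(z - p) * cnj \<tau> = - of_real \<eta> * \<i> * (\<tau> * cnj \<tau>)" by (simp add: z_def)
    also have "\<tau> * cnj \<tau> = 1" using \<tau> by (simp add: complex_norm_square[symmetric])
    also have "cmod (z - p) = \<eta>"
    proof -
      have "z - p = - (of_real \<eta> * (\<i> * \<tau>))" by (simp add: z_def)
      then show ?thesis using \<eta>(1) by (simp only: norm_minus_cancel norm_mult norm_of_real norm_ii \<tau> abs_of_pos mult_1_right)
    qed
    finally show ?thesis by simp
  qed
  define B where "B = \<eta> - k * \<eta>\<^sup>2"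
  have B: "0 < B" "B \<le> \<eta>"
  proof -
    have "\<eta> * (k * \<eta>) \<le> \<eta> * (1 / 2)" using \<eta> k by (intro mult_left_mono) (auto simp: field_simps)
    then show "0 < B" using \<eta>(1) by (simp add: B_def power2_eq_square mult_ac)
    show "B \<le> \<eta>" using k by (simp add: B_def)
  qed
  have Na: "N * a \<le> 1 / 4"
  proof -
    have "N * a \<le> N * R" using a N by simp
    then show ?thesis using NR \<epsilon> S by linarith
  qed
  have f: "\<bar>\<phi>1 a\<bar> \<le> a / 8"
  proof -
    have "\<bar>\<phi>1 a\<bar> \<le> N / 2 * a\<^sup>2" using tangent_graphD(3)[OF corner_domainD(1)[OF cd], of a] a by simp
    also have "\<dots> = N * a * (a / 2)" by (simp add: power2_eq_square)
    also have "\<dots> \<le> 1 / 4 * (a / 2)" using Na a by (intro mult_right_mono) auto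
    finally show ?thesis by simp
  qed
  have za: "cmod (z - of_real a) \<le> a / 4"
  proof -
    have "z - of_real a = Complex 0 (\<phi>1 a) - of_real \<eta> * (\<i> * \<tau>)" by (simp add: z_def p_def complex_eq_iff)
    also have "cmod \<dots> \<le> cmod (Complex 0 (\<phi>1 a)) + cmod (of_real \<eta> * (\<i> * \<tau>))" by (rule norm_triangle_ineq4)
    also have "cmod (of_real \<eta> * (\<i> * \<tau>)) = \<eta>"
      using \<eta>(1) by (simp only: norm_mult norm_of_real norm_ii \<tau> abs_of_pos mult_1_right)
    also have "cmod (Complex 0 (\<phi>1 a)) = \<bar>\<phi>1 a\<bar>" by (simp add: cmod_def)
    finally show ?thesis using f \<eta> aS by linarith
  qed
  have zn: "cmod z \<le> 5 / 4 * a"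
  proof -
    have "cmod z \<le> cmod (z - of_real a) + cmod (of_real a :: complex)" by (metis diff_add_cancel norm_triangle_ineq)
    then show ?thesis using za a by simp
  qed
  have \<kappa>: "\<bar>- (k / S)\<bar> \<le> 2 * M" using k S by (simp add: field_simps)
  have "cmod (V - z) \<le> 18 * M * (5 / 4 * a)\<^sup>2"
    unfolding V_def W_def
    by (rule lens_map_near_identity[OF e q \<kappa>]) (use a zn M in auto)
  also have "\<dots> = 225 / 8 * (M * a) * a" by (simp add: power2_eq_square)
  also have "\<dots> \<le> 225 / 800 * a" using a by (intro mult_right_mono) auto
  finally have Vz: "cmod (V - z) \<le> 225 / 800 * a" .
  have A: "Re V \<ge> a / 4"
  proof -
    have "\<bar>Re (V - z)\<bar> \<le> cmod (V - z)" "\<bar>Re (z - of_real a)\<bar> \<le> cmod (z - of_real a)" by (rule abs_Re_le_cmod)+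
    then show ?thesis using Vz za a by simp
  qed
  have W: "W = V * cis (- (\<mu> * pi / 2))" by (simp add: V_def mult.assoc cis_mult)
  have V: "V = Complex (Re V) (- B)" using ImV by (simp add: B_def complex_eq_iff)
  have reW: "Re W = Re V * C - B * S" and imW: "Im W = - (Re V * S + B * C)"
    unfolding W by (subst V, simp add: C_def S_def)+
  have "Re V * S + B * C \<ge> 0"
  proof -
    have "a / 4 * S \<le> Re V * S" using A S by (intro mult_right_mono) auto
    moreover have "B * \<bar>C\<bar> \<le> a * S / 8 * 1" using B \<eta> by (intro mult_mono) (auto simp: C_def)
    moreover have "- (B * C) \<le> B * \<bar>C\<bar>" using B by (metis abs_ge_minus_self abs_mult abs_of_pos)
    moreover have "a * S > 0" using a S by simp
    ultimately show ?thesis by linarith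
  qed
  then have "\<bar>Im W\<bar> = Re V * S + B * C" using imW by simp
  then have "C * (Re V * S + B * C) \<le> S * (Re V * C - B * S)"
    using out[OF z\<Omega>] reW by (simp add: W_def)
  then have "B * (C * C + S * S) \<le> 0" by (simp add: algebra_simps)
  then show False using CS B by simp
qed

subsection \<open>Bracketing by lens solutions\<close>

text \<open>The geometric half of the estimate, free of \<open>u\<close>: reflections and rotations
  can be applied without transforming the differential equation.\<close>

definition bracketed :: "real \<Rightarrow> complex set \<Rightarrow> complex \<Rightarrow> real \<Rightarrow> real \<Rightarrow> bool" where
  "bracketed \<mu> \<Omega> x F E \<longleftrightarrow>
     (\<exists>q b \<kappa>. cmod b = 1 \<and> \<kappa> > 0 \<and> lens \<mu> q b \<kappa> \<subseteq> \<Omega> \<and> x \<in> lens \<mu> q b \<kappa> \<and> \<bar>lens_sol \<mu> q b \<kappa> x - F\<bar> \<le> E) \<and>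
     (\<exists>q b \<kappa>. cmod b = 1 \<and> \<kappa> < 0 \<and>
        (\<forall>z\<in>\<Omega>. cos (\<mu> * pi / 2) * \<bar>Im (lens_map q b \<kappa> z)\<bar> \<le> sin (\<mu> * pi / 2) * Re (lens_map q b \<kappa> z)) \<and>
        x \<in> lens \<mu> q b \<kappa> \<and> \<bar>lens_sol \<mu> q b \<kappa> x - F\<bar> \<le> E)"

text \<open>The foot satisfies \<open>a \<le> 2 * r\<close>, so these bounds are the conditions on
  \<open>a\<close> in the lens constructions with doubled factors.\<close>

definition small_radius :: "real \<Rightarrow> real \<Rightarrow> real \<Rightarrow> real \<Rightarrow> real \<Rightarrow> bool" where
  "small_radius N R M \<epsilon> r \<longleftrightarrow> 0 < r \<and> 8 * r \<le> R \<and> 200 * (M * r) \<le> 1 \<and> 6 * (M * r) \<le> \<epsilon> \<and> 4 * (N * r) \<le> 1"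

lemma small_radiusD:
  assumes "small_radius N R M \<epsilon> r"
  shows "0 < r" "8 * r \<le> R" "200 * (M * r) \<le> 1" "6 * (M * r) \<le> \<epsilon>" "4 * (N * r) \<le> 1"
  using assms by (auto simp: small_radius_def)

lemma eventually_small_radius:
  assumes "corner_scale \<mu> N R M \<epsilon>"
  obtains \<delta> where "\<delta> > 0" "\<And>r. 0 < r \<Longrightarrow> r < \<delta> \<Longrightarrow> small_radius N R M \<epsilon> r"
proof -
  have pos: "0 < N" "0 < R" "0 < M" "0 < \<epsilon>" using assms by (auto simp: corner_scale_def)
  define \<delta> where "\<delta> = min (min (R / 8) (1 / (200 * M))) (min (\<epsilon> / (6 * M)) (1 / (4 * N)))"
  have "small_radius N R M \<epsilon> r" if "0 < r" "r < \<delta>" for r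
    using that pos unfolding small_radius_def \<delta>_def by (simp add: field_simps)
  moreover have "\<delta> > 0" using pos by (simp add: \<delta>_def)
  ultimately show thesis using that by blast
qed

section \<open>Feet on the two curves and the resulting barriers\<close>

lemma obtain_foot:
  fixes x :: complex
  assumes "closed \<sigma>" "0 \<in> \<sigma>"
  obtains p where "p \<in> \<sigma>" "infdist x \<sigma> = cmod (x - p)" "cmod p \<le> 2 * cmod x"
proof -
  have "\<sigma> \<noteq> {}" using assms by blast
  then obtain p where p: "p \<in> \<sigma>" "infdist x \<sigma> = dist x p"
    using infdist_attains_inf[OF assms(1)] by metis
  have "infdist x \<sigma> \<le> dist x 0" using assms by (intro infdist_le)
  then have "cmod p \<le> 2 * cmod x" using p norm_triangle_ineq4[of x "x - p"] by (simp add: dist_norm)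
  then show thesis using p that by (simp add: dist_norm)
qed

lemma zero_mem_curves:
  assumes "corner_scale \<mu> N R M \<epsilon>" "corner_domain \<mu> N R \<Omega> \<sigma>1 \<sigma>2 \<phi>1 \<phi>1' \<phi>2 \<phi>2'"
  shows "0 \<in> \<sigma>1" "0 \<in> \<sigma>2"
proof -
  have R: "R > 0" using assms(1) by (simp add: corner_scale_def)
  have "\<phi>1 0 = 0" "\<phi>2 0 = 0" using tangent_graphD(1)[of _ _ _ _ 0] corner_domainD(1,2)[OF assms(2)] R by force+
  moreover have "Complex 0 (\<phi>1 0) \<in> \<sigma>1" "cis (\<mu> * pi) * Complex 0 (\<phi>2 0) \<in> \<sigma>2"
    using corner_domainD(7,8)[OF assms(2), of 0] R by auto
  ultimately show "0 \<in> \<sigma>1" "0 \<in> \<sigma>2" by (simp_all add: zero_complex.code[symmetric])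
qed

text \<open>The inequality \<open>d < cmod x\<close> keeps the foot off the corner, so
  \<open>x\<close> lies on its normal line. That it lies on the inner side is a global fact,
  excluded otherwise by \<open>foot_on_outer_side\<close>.\<close>

lemma nearer_foot:
  assumes sc: "corner_scale \<mu> N R M \<epsilon>" and cd: "corner_domain \<mu> N R \<Omega> \<sigma>1 \<sigma>2 \<phi>1 \<phi>1' \<phi>2 \<phi>2'"
    and x: "x \<in> \<Omega>" and r: "small_radius N R M \<epsilon> (cmod x)"
    and d: "d = infdist x \<sigma>1" "d \<le> infdist x \<sigma>2" "d < cmod x"
  obtains a where "0 < a" "a \<le> 2 * cmod x" "x = Complex a (\<phi>1 a) + of_real d * (\<i> * sgn (Complex 1 (\<phi>1' a)))"
    "0 < d" "cmod (x - rcis (cmod x) (arcsin (d / cmod x))) \<le> 12 * N * (cmod x)\<^sup>2"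
proof -
  have N: "0 < N" and M: "0 < M" and R: "0 < R" using sc by (auto simp: corner_scale_def)
  note r = small_radiusD[OF r]
  note zero = zero_mem_curves[OF sc cd]
  obtain p where p: "p \<in> \<sigma>1" "d = cmod (x - p)" "cmod p \<le> 2 * cmod x"
    using obtain_foot[OF corner_domainD(3)[OF cd] zero(1), of x] d(1) by metis
  have "cmod p < R" using p(3) r by linarith
  then obtain a where a: "0 \<le> a" "a \<le> R" "p = Complex a (\<phi>1 a)" using corner_domainD(5)[OF cd p(1)] by blast
  have "a \<noteq> 0"
  proof
    assume "a = 0"
    then have "p = 0" using a tangent_graphD(1)[OF corner_domainD(1)[OF cd], of 0] R by (simp add: complex_eq_iff)
    then show False using p(2) d(3) by simp
  qed
  then have a0: "0 < a" using a by simp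
  have a2: "a \<le> 2 * cmod x" using p(3) complex_Re_le_cmod[of p] a(3) by simp
  have aR: "a < R / 2" using a2 r by linarith
  have xR: "cmod x < R" using r by linarith
  have dpos: "0 < d"
  proof -
    have "x \<notin> \<sigma>1" using corner_domainD(10)[OF cd x xR] by blast
    then have "infdist x \<sigma>1 \<noteq> 0" using in_closed_iff_infdist_zero[OF corner_domainD(3)[OF cd]] zero by blast
    then show ?thesis using d(1) infdist_nonneg[of x \<sigma>1] by simp
  qed
  define T where "T = Complex 1 (\<phi>1' a)"
  have T0: "T \<noteq> 0" by (simp add: T_def complex_eq_iff)
  have "Re ((x - p) * cnj T) = 0"
    unfolding T_def a(3)
  proof (rule foot_first_order(2)[OF corner_domainD(1)[OF cd] a(1) aR])
    fix t assume "0 \<le> t" "t \<le> R / 2"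
    then have "Complex t (\<phi>1 t) \<in> \<sigma>1" by (rule corner_domainD(7)[OF cd])
    then have "infdist x \<sigma>1 \<le> dist x (Complex t (\<phi>1 t))" by (rule infdist_le)
    then show "cmod (x - Complex a (\<phi>1 a)) \<le> cmod (x - Complex t (\<phi>1 t))"
      using p(2) d(1) a(3) by (simp add: dist_norm)
  qed (use R N a0 in auto)
  then obtain y where y: "(x - p) * cnj T = \<i> * of_real y"
    by (intro that[of "Im ((x - p) * cnj T)"]) (simp add: complex_eq_iff)
  define \<tau> where "\<tau> = sgn T"
  have \<tau>: "cmod \<tau> = 1" using T0 by (simp add: \<tau>_def norm_sgn)
  define l where "l = y / cmod T"
  have xp: "x - p = of_real l * (\<i> * \<tau>)"
  proof -
    have "(x - p) * of_real ((cmod T)\<^sup>2) = (x - p) * cnj T * T" unfolding complex_norm_square by (simp only: mult_ac)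
    also have "\<dots> = \<i> * of_real y * T" by (simp add: y)
    finally have "x - p = \<i> * of_real y * T / of_real ((cmod T)\<^sup>2)" using T0 by (simp add: nonzero_eq_divide_eq)
    then show ?thesis by (simp add: l_def \<tau>_def sgn_eq power2_eq_square)
  qed
  have "cmod (x - p) = \<bar>l\<bar>" unfolding xp by (simp only: norm_mult norm_of_real norm_ii \<tau> mult_1_right)
  then have ld: "\<bar>l\<bar> = d" using p(2) by simp
  have "l = d"
  proof (rule ccontr)
    assume "l \<noteq> d"
    then have l: "l = - d" using ld by (auto simp: abs_if split: if_splits)
    \<comment> \<open>No point of either curve is closer to \<open>x\<close> than \<open>d\<close>,
      so the ball lies in \<open>\<Omega>\<close>; with \<open>l = - d\<close> its radius to the
      foot would approach the curve from the outer side.\<close>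
    have "ball x d \<subseteq> \<Omega>"
    proof (rule corner_domainD(9)[OF cd])
      show "connected (ball x d)" by (rule connected_ball)
      show "ball x d \<subseteq> ball 0 R"
      proof
        fix z assume "z \<in> ball x d"
        then have "cmod z < cmod x + d" using norm_triangle_ineq4[of x "x - z"] by (simp add: dist_norm)
        then have "cmod z < R" using d(3) r(1,2) by linarith
        then show "z \<in> ball 0 R" by simp
      qed
      have "infdist x \<sigma>1 \<le> dist x z" if "z \<in> \<sigma>1" for z using that by (rule infdist_le)
      moreover have "infdist x \<sigma>2 \<le> dist x z" if "z \<in> \<sigma>2" for z using that by (rule infdist_le)
      ultimately show "ball x d \<inter> (\<sigma>1 \<union> \<sigma>2) = {}" using d by fastforce
      show "ball x d \<inter> \<Omega> \<noteq> {}" using dpos x by force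
    qed
    show False
    proof (rule foot_on_outer_side[OF sc cd a0 a(2) _ _ dpos])
      have "M * a \<le> M * (2 * cmod x)" using a2 M by (intro mult_left_mono) auto
      then show "100 * (M * a) \<le> 1" "3 * (M * a) \<le> \<epsilon>" using r by auto
      fix \<eta> assume \<eta>: "0 < \<eta>" "\<eta> \<le> d"
      let ?z = "Complex a (\<phi>1 a) - of_real \<eta> * (\<i> * sgn (Complex 1 (\<phi>1' a)))"
      have "x - ?z = of_real (\<eta> - d) * (\<i> * \<tau>)"
        using xp unfolding l by (simp add: \<tau>_def T_def a(3) algebra_simps)
      then have "cmod (x - ?z) = \<bar>\<eta> - d\<bar>" by (simp only: norm_mult norm_of_real norm_ii \<tau> mult_1_right)
      then have "?z \<in> ball x d" using \<eta> by (simp add: dist_norm)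
      then show "?z \<in> \<Omega>" using \<open>ball x d \<subseteq> \<Omega>\<close> by blast
    qed
  qed
  then have x_eq: "x = Complex a (\<phi>1 a) + of_real d * (\<i> * sgn (Complex 1 (\<phi>1' a)))"
    using xp by (simp add: \<tau>_def T_def a(3) algebra_simps)
  have "cmod (x - rcis (cmod x) (arcsin (d / cmod x))) \<le> 12 * N * (cmod x)\<^sup>2"
    by (subst (1) x_eq, rule foot_polar)
      (use x_eq[symmetric] r a0 a2 dpos d N tangent_graphD(2,3)[OF corner_domainD(1)[OF cd] a(1,2)] in auto)
  with a0 a2 x_eq dpos show thesis by (rule that)
qed

lemma bracketedI:
  assumes \<mu>: "0 < \<mu>" "\<mu> < 2"
    and in1: "cmod e1 = 1" "\<kappa>1 > 0" "lens \<mu> q1 (e1 * cis (\<mu> * pi / 2)) \<kappa>1 \<subseteq> \<Omega>"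
    and out: "cmod e2 = 1" "\<kappa>2 > 0" "\<And>z. z \<in> \<Omega> \<Longrightarrow>
      cos (\<mu> * pi / 2) * \<bar>Im (lens_map q2 (e2 * cis (\<mu> * pi / 2)) (- \<kappa>2) z)\<bar>
      \<le> sin (\<mu> * pi / 2) * Re (lens_map q2 (e2 * cis (\<mu> * pi / 2)) (- \<kappa>2) z)"
    and V1: "V1 = lens_map q1 (e1 * cis (\<mu> * pi / 2)) \<kappa>1 x * cis (\<mu> * pi / 2)"
      "V1 * cis (- (\<mu> * pi / 2)) \<in> wedge \<mu> \<and> \<bar>ln (wedge_weight \<mu> (V1 * cis (- (\<mu> * pi / 2)))) - ln G\<bar> \<le> E"
    and V2: "V2 = lens_map q2 (e2 * cis (\<mu> * pi / 2)) (- \<kappa>2) x * cis (\<mu> * pi / 2)"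
      "V2 * cis (- (\<mu> * pi / 2)) \<in> wedge \<mu> \<and> \<bar>ln (wedge_weight \<mu> (V2 * cis (- (\<mu> * pi / 2)))) - ln G\<bar> \<le> E"
  shows "bracketed \<mu> \<Omega> x (- ln G) E"
proof -
  have e: "V1 * cis (- (\<mu> * pi / 2)) = lens_map q1 (e1 * cis (\<mu> * pi / 2)) \<kappa>1 x"
    "V2 * cis (- (\<mu> * pi / 2)) = lens_map q2 (e2 * cis (\<mu> * pi / 2)) (- \<kappa>2) x"
    by (simp_all add: V1(1) V2(1) mult.assoc cis_mult)
  have b: "cmod (e1 * cis (\<mu> * pi / 2)) = 1" "cmod (e2 * cis (\<mu> * pi / 2)) = 1"
    using in1 out by (simp_all add: norm_mult)
  have "x \<in> lens \<mu> q1 (e1 * cis (\<mu> * pi / 2)) \<kappa>1" "\<bar>lens_sol \<mu> q1 (e1 * cis (\<mu> * pi / 2)) \<kappa>1 x - (- ln G)\<bar> \<le> E"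
    using V1(2) unfolding e by (simp_all add: lens_def lens_sol_def abs_minus_commute)
  moreover have "x \<in> lens \<mu> q2 (e2 * cis (\<mu> * pi / 2)) (- \<kappa>2)" "\<bar>lens_sol \<mu> q2 (e2 * cis (\<mu> * pi / 2)) (- \<kappa>2) x - (- ln G)\<bar> \<le> E"
    using V2(2) unfolding e by (simp_all add: lens_def lens_sol_def abs_minus_commute)
  ultimately show ?thesis
    unfolding bracketed_def using b in1 out by (metis neg_less_0_iff_less)
qed

proposition bracketed_near_side:
  fixes \<mu> N R M \<epsilon> :: real
  assumes sc: "corner_scale \<mu> N R M \<epsilon>"
  obtains \<delta> C where "\<delta> > 0" "C > 0" "\<And>\<Omega> \<sigma>1 \<sigma>2 \<phi>1 \<phi>1' \<phi>2 \<phi>2' x. corner_domain \<mu> N R \<Omega> \<sigma>1 \<sigma>2 \<phi>1 \<phi>1' \<phi>2 \<phi>2' \<Longrightarrow>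
    x \<in> \<Omega> \<Longrightarrow> 0 < cmod x \<Longrightarrow> cmod x < \<delta> \<Longrightarrow> infdist x \<sigma>1 \<le> infdist x \<sigma>2 \<Longrightarrow> infdist x \<sigma>1 < cmod x \<Longrightarrow>
    bracketed \<mu> \<Omega> x (- ln (\<mu> * cmod x * sin (arcsin (infdist x \<sigma>1 / cmod x) / \<mu>))) (C * infdist x \<sigma>1)"
proof -
  have \<mu>: "0 < \<mu>" "\<mu> < 2" and M: "0 < M" and N: "0 < N" using sc by (auto simp: corner_scale_def)
  define S where "S = sin (\<mu> * pi / 2)"
  have S: "S > 0" "S \<le> 1" unfolding S_def using \<mu> by (auto intro!: sin_gt_zero)
  obtain \<delta>1 where \<delta>1: "\<delta>1 > 0" "\<And>r. 0 < r \<Longrightarrow> r < \<delta>1 \<Longrightarrow> small_radius N R M \<epsilon> r"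
    using eventually_small_radius[OF sc] by metis
  \<comment> \<open>The distance of \<open>V\<close> from \<open>x\<close> contributes
    \<open>18 * M\<close>, that of \<open>x\<close> from its polar model \<open>12 * N\<close>;
    \<open>B\<close> also has to dominate \<open>k \<le> 2 * M\<close>.\<close>
  define B where "B = 20 * M + 12 * N"
  have B: "B > 0" using M N by (simp add: B_def)
  obtain \<delta>2 C where \<delta>2: "\<delta>2 > 0" and C: "C > 0" and
    near: "\<And>r t V k. 0 < r \<Longrightarrow> r < \<delta>2 \<Longrightarrow> 0 < t \<Longrightarrow> t \<le> pi / 2 \<Longrightarrow> t \<le> 5 * pi / 8 * \<mu> \<Longrightarrow>
      \<bar>k\<bar> \<le> B \<Longrightarrow> cmod (V - rcis r t) \<le> B * r\<^sup>2 \<Longrightarrow> Im V = r * sin t + k * (r * sin t)\<^sup>2 \<Longrightarrow>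
      V * cis (- (\<mu> * pi / 2)) \<in> wedge \<mu> \<and>
      \<bar>ln (wedge_weight \<mu> (V * cis (- (\<mu> * pi / 2)))) - ln (\<mu> * r * sin (t / \<mu>))\<bar> \<le> C * (r * sin t)"
    using wedge_weight_near_side[OF \<mu> B] by metis
  obtain c where c: "c > 0" "\<And>t. 5 * pi / 8 * \<mu> < t \<Longrightarrow> t \<le> pi / 2 \<Longrightarrow>
    \<bar>sin (\<mu> * pi - t)\<bar> + c \<le> sin t \<and> 0 \<le> cos (\<mu> * pi - t)"
    using nearer_side_angle_gap[OF \<mu>(1)] by metis
  \<comment> \<open>The 13 bounds the 12 of \<open>foot_polar\<close> plus \<open>1 / 2\<close> from
    the height of the second graph.\<close>
  define \<delta> where "\<delta> = min (min \<delta>1 \<delta>2) (c / (13 * N))"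
  show thesis
  proof (rule that[of \<delta> C])
    show "\<delta> > 0" using \<delta>1 \<delta>2 c N by (simp add: \<delta>_def)
    show "C > 0" by fact
    fix \<Omega> \<sigma>1 \<sigma>2 \<phi>1 \<phi>1' \<phi>2 \<phi>2' x
    assume cd: "corner_domain \<mu> N R \<Omega> \<sigma>1 \<sigma>2 \<phi>1 \<phi>1' \<phi>2 \<phi>2'" and x: "x \<in> \<Omega>"
      and x0: "0 < cmod x" and x\<delta>: "cmod x < \<delta>" and le: "infdist x \<sigma>1 \<le> infdist x \<sigma>2"
      and lt: "infdist x \<sigma>1 < cmod x"
    define r where "r = cmod x"
    define d where "d = infdist x \<sigma>1"
    define t where "t = arcsin (d / r)"
    have r: "0 < r" "r < \<delta>1" "r < \<delta>2" "13 * (N * r) < c"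
      using x0 x\<delta> N by (auto simp: r_def \<delta>_def field_simps)
    have sr: "small_radius N R M \<epsilon> (cmod x)" using \<delta>1(2) r by (simp add: r_def)
    note sr' = small_radiusD[OF sr, folded r_def]
    obtain a where a: "0 < a" "a \<le> 2 * r" and xe: "x = Complex a (\<phi>1 a) + of_real d * (\<i> * sgn (Complex 1 (\<phi>1' a)))"
      and d0: "0 < d" and xt: "cmod (x - rcis r t) \<le> 12 * N * r\<^sup>2"
      using nearer_foot[OF sc cd x sr d_def le[folded d_def] lt[folded d_def]] unfolding r_def t_def by metis
    have dr: "0 < d / r" "d / r < 1" using d0 lt r by (auto simp: r_def d_def)
    have rt: "r * sin t = d" unfolding t_def using dr r by (subst sin_arcsin) auto
    have t: "0 < t" "t \<le> pi / 2"
      using arcsin_less_arcsin[of 0 "d / r"] arcsin_ubound[of "d / r"] dr by (auto simp: t_def)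
    have t\<mu>: "t \<le> 5 * pi / 8 * \<mu>"
    proof (rule ccontr)
      assume "\<not> t \<le> 5 * pi / 8 * \<mu>"
      then have gap: "\<bar>sin (\<mu> * pi - t)\<bar> + c \<le> sin t" "0 \<le> cos (\<mu> * pi - t)" using c(2)[of t] t by auto
      \<comment> \<open>The abscissa of the projection of the polar model of \<open>x\<close> to the
        second ray; the point of \<open>\<sigma>2\<close> above it would be closer to
        \<open>x\<close> than \<open>d\<close>.\<close>
      define s where "s = r * cos (\<mu> * pi - t)"
      have s: "0 \<le> s" "s \<le> r" using gap r by (auto simp: s_def mult_left_le)
      define P where "P = cis (\<mu> * pi) * Complex s (\<phi>2 s)"
      have "P \<in> \<sigma>2" unfolding P_def using s sr' by (intro corner_domainD(8)[OF cd]) auto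
      then have "infdist x \<sigma>2 \<le> dist x P" by (rule infdist_le)
      then have "d \<le> cmod (x - P)" using le by (simp add: d_def dist_norm)
      also have "x - P = (x - rcis r t) + cis (\<mu> * pi) * (of_real r * cis (t - \<mu> * pi) - Complex s (\<phi>2 s))"
        by (simp add: P_def rcis_def algebra_simps cis_mult)
      also have "cmod \<dots> \<le> cmod (x - rcis r t) + cmod (of_real r * cis (t - \<mu> * pi) - Complex s (\<phi>2 s))"
        by (intro order_trans[OF norm_triangle_ineq]) (simp add: norm_mult)
      also have "of_real r * cis (t - \<mu> * pi) - Complex s (\<phi>2 s) = Complex 0 (- (r * sin (\<mu> * pi - t)) - \<phi>2 s)"
        by (simp add: s_def complex_eq_iff cos_diff sin_diff algebra_simps)
      also have "cmod (Complex 0 (- (r * sin (\<mu> * pi - t)) - \<phi>2 s)) = \<bar>r * sin (\<mu> * pi - t) + \<phi>2 s\<bar>"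
        by (simp add: cmod_def abs_minus_commute)
      also have "\<dots> \<le> r * \<bar>sin (\<mu> * pi - t)\<bar> + \<bar>\<phi>2 s\<bar>"
        using abs_triangle_ineq[of "r * sin (\<mu> * pi - t)" "\<phi>2 s"] r by (simp add: abs_mult)
      also have "\<bar>\<phi>2 s\<bar> \<le> N / 2 * s\<^sup>2"
        using tangent_graphD(3)[OF corner_domainD(2)[OF cd], of s] s sr' by simp
      also have "\<dots> \<le> N / 2 * r\<^sup>2" using s N by (intro mult_left_mono power_mono) auto
      finally have "d \<le> 12 * N * r\<^sup>2 + (r * \<bar>sin (\<mu> * pi - t)\<bar> + N / 2 * r\<^sup>2)" using xt by simp
      also have "\<dots> \<le> r * (\<bar>sin (\<mu> * pi - t)\<bar> + 13 * (N * r))" using N by (simp add: power2_eq_square algebra_simps)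
      also have "\<dots> < r * (\<bar>sin (\<mu> * pi - t)\<bar> + c)" using r by (intro mult_strict_left_mono) auto
      also have "\<dots> \<le> r * sin t" using gap r by (intro mult_left_mono) auto
      finally show False using rt by simp
    qed
    have aR: "a \<le> R" using a sr' by linarith
    have Ma: "M * a \<le> M * (2 * r)" using a M by (intro mult_left_mono) auto
    then have Ma1: "20 * (M * a) \<le> 1" and Ma2: "3 * (M * a) \<le> \<epsilon>" using sr' by auto
    have a0: "0 \<le> a" using a by simp
    define p where "p = Complex a (\<phi>1 a)"
    define \<tau> where "\<tau> = sgn (Complex 1 (\<phi>1' a))"
    have "Complex 1 (\<phi>1' a) \<noteq> 0" by (simp add: complex_eq_iff)
    then have \<tau>: "cmod \<tau> = 1" unfolding \<tau>_def by (simp add: norm_sgn)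
    have "(x - p) * cnj \<tau> = of_real d * \<i> * (\<tau> * cnj \<tau>)" by (simp add: xe p_def \<tau>_def)
    also have "\<tau> * cnj \<tau> = 1" using \<tau> by (simp add: complex_norm_square[symmetric])
    finally have xp: "Im ((x - p) * cnj \<tau>) = d" by simp
    have xp2: "cmod (x - p) = d"
    proof -
      have "x - p = of_real d * (\<i> * \<tau>)" by (simp add: xe p_def \<tau>_def)
      then show ?thesis using d0 by (simp only: norm_mult norm_of_real norm_ii \<tau> mult_1_right abs_of_pos)
    qed
    obtain e1 k1 q1 where e1: "cmod e1 = 1" "cmod (e1 - 1) \<le> 3 * (M * a)" and q1: "cmod q1 \<le> M * a\<^sup>2"
      and k1: "0 < k1" "k1 \<le> 2 * (M * S)"
      and id1: "\<And>z. Im ((z - q1) * cnj e1) - k1 * (cmod (z - q1))\<^sup>2 = Im ((z - p) * cnj \<tau>) - k1 * (cmod (z - p))\<^sup>2"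
      and in1: "lens \<mu> q1 (e1 * cis (\<mu> * pi / 2)) (k1 / S) \<subseteq> \<Omega>"
      using corner_lens_inside[OF sc cd a0 aR Ma1 Ma2] unfolding p_def \<tau>_def S_def by metis
    obtain e2 k2 q2 where e2: "cmod e2 = 1" "cmod (e2 - 1) \<le> 3 * (M * a)" and q2: "cmod q2 \<le> M * a\<^sup>2"
      and k2: "0 < k2" "k2 \<le> 2 * (M * S)"
      and id2: "\<And>z. Im ((z - q2) * cnj e2) + k2 * (cmod (z - q2))\<^sup>2 = Im ((z - p) * cnj \<tau>) + k2 * (cmod (z - p))\<^sup>2"
      and out: "\<And>z. z \<in> \<Omega> \<Longrightarrow> cos (\<mu> * pi / 2) * \<bar>Im (lens_map q2 (e2 * cis (\<mu> * pi / 2)) (- (k2 / S)) z)\<bar>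
        \<le> sin (\<mu> * pi / 2) * Re (lens_map q2 (e2 * cis (\<mu> * pi / 2)) (- (k2 / S)) z)"
      using corner_lens_outside[OF sc cd a0 aR Ma1 Ma2] unfolding p_def \<tau>_def S_def by metis
    have MS: "M * S \<le> M" using M S by (simp add: mult_left_le)
    have \<kappa>: "\<bar>k1 / S\<bar> \<le> 2 * M" "\<bar>- (k2 / S)\<bar> \<le> 2 * M" using k1 k2 S by (auto simp: field_simps)
    define V1 where "V1 = lens_map q1 (e1 * cis (\<mu> * pi / 2)) (k1 / S) x * cis (\<mu> * pi / 2)"
    define V2 where "V2 = lens_map q2 (e2 * cis (\<mu> * pi / 2)) (- (k2 / S)) x * cis (\<mu> * pi / 2)"
    have Mr: "4 * (M * r) \<le> 1" using sr' by simp
    have xr: "cmod x \<le> r" by (simp add: r_def)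
    have V1x: "cmod (V1 - x) \<le> 18 * M * r\<^sup>2" unfolding V1_def
      by (rule lens_map_near_identity[OF e1 q1 \<kappa>(1) a0 a(2) xr Mr]) (use M in simp)
    have V2x: "cmod (V2 - x) \<le> 18 * M * r\<^sup>2" unfolding V2_def
      by (rule lens_map_near_identity[OF e2 q2 \<kappa>(2) a0 a(2) xr Mr]) (use M in simp)
    have close: "cmod (V - rcis r t) \<le> B * r\<^sup>2" if "cmod (V - x) \<le> 18 * M * r\<^sup>2" for V
    proof -
      have "cmod (V - rcis r t) \<le> cmod (V - x) + cmod (x - rcis r t)"
        using norm_triangle_ineq[of "V - x" "x - rcis r t"] by simp
      also have "\<dots> \<le> 18 * M * r\<^sup>2 + 12 * N * r\<^sup>2" using that xt by simp
      also have "\<dots> \<le> B * r\<^sup>2"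
      proof -
        have "0 \<le> M * r\<^sup>2" using M by simp
        then show ?thesis by (simp add: B_def algebra_simps)
      qed
      finally show ?thesis .
    qed
    \<comment> \<open>The first-side equation takes the same value from \<open>q1\<close> and from
      \<open>p\<close>, and \<open>x\<close> lies on the normal at \<open>p\<close>; so this value
      is exactly \<open>d - k1 * d\<^sup>2\<close>.\<close>
    have Im1: "Im V1 = r * sin t + (- k1) * (r * sin t)\<^sup>2"
      unfolding V1_def S_def lens_sides(3)[OF \<mu> e1(1)] id1 xp xp2 rt by simp
    have Im2: "Im V2 = r * sin t + k2 * (r * sin t)\<^sup>2"
    proof -
      have "Im V2 = Im ((x - q2) * cnj e2) - (- k2) * (cmod (x - q2))\<^sup>2"
        unfolding V2_def S_def using lens_sides(3)[OF \<mu> e2(1), of q2 "- k2" x] by simp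
      also have "\<dots> = Im ((x - q2) * cnj e2) + k2 * (cmod (x - q2))\<^sup>2" by (simp only: mult_minus_left diff_minus_eq_add)
      finally show ?thesis unfolding id2 xp xp2 rt .
    qed
    have "k1 \<le> 2 * M" "k2 \<le> 2 * M" using k1 k2 MS by linarith+
    then have k: "\<bar>- k1\<bar> \<le> B" "\<bar>k2\<bar> \<le> B" using k1(1) k2(1) M N by (auto simp: B_def)
    have "bracketed \<mu> \<Omega> x (- ln (\<mu> * r * sin (t / \<mu>))) (C * (r * sin t))"
    proof (rule bracketedI[OF \<mu> e1(1) _ in1 e2(1) _ out V1_def _ V2_def])
      show "0 < k1 / S" "0 < k2 / S" using k1 k2 S by auto
    qed (use near[OF r(1,3) t t\<mu> k(1) close[OF V1x] Im1] near[OF r(1,3) t t\<mu> k(2) close[OF V2x] Im2] in auto)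
    then show "bracketed \<mu> \<Omega> x (- ln (\<mu> * cmod x * sin (arcsin (infdist x \<sigma>1 / cmod x) / \<mu>))) (C * infdist x \<sigma>1)"
      unfolding rt by (simp add: r_def d_def t_def)
  qed
qed

text \<open>If 0 is a nearest point on both curves, the one-sided first-order conditions put
  \<open>x\<close> at an angle of at least \<open>pi / 2\<close> from both tangent rays. The
  exterior lens keeps \<open>x\<close> near the cone, so this needs \<open>\<mu> \<ge> 1\<close> and
  confines the argument to the middle range.\<close>

proposition bracketed_corner_foot:
  fixes \<mu> N R M \<epsilon> :: real
  assumes sc: "corner_scale \<mu> N R M \<epsilon>"
  obtains \<delta> C where "\<delta> > 0" "C > 0" "\<And>\<Omega> \<sigma>1 \<sigma>2 \<phi>1 \<phi>1' \<phi>2 \<phi>2' x. corner_domain \<mu> N R \<Omega> \<sigma>1 \<sigma>2 \<phi>1 \<phi>1' \<phi>2 \<phi>2' \<Longrightarrow>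
    x \<in> \<Omega> \<Longrightarrow> 0 < cmod x \<Longrightarrow> cmod x < \<delta> \<Longrightarrow> infdist x \<sigma>1 = cmod x \<Longrightarrow> infdist x \<sigma>2 = cmod x \<Longrightarrow>
    1 \<le> \<mu> \<and> pi / 2 \<le> Arg2pi x \<and> Arg2pi x \<le> \<mu> * pi - pi / 2 \<and>
    bracketed \<mu> \<Omega> x (- ln (\<mu> * cmod x * sin (Arg2pi x / \<mu>))) (C * cmod x)"
proof -
  have \<mu>: "0 < \<mu>" "\<mu> < 2" and M: "0 < M" and N: "0 < N" and R: "0 < R" and \<epsilon>: "0 < \<epsilon>"
    using sc by (auto simp: corner_scale_def)
  define h where "h = \<mu> * pi / 2"
  define S where "S = sin h"
  define Co where "Co = cos h"
  have h: "0 < h" "h < pi" using \<mu> by (auto simp: h_def)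
  have S: "S > 0" "S \<le> 1" unfolding S_def using h by (auto intro!: sin_gt_zero)
  have SC: "Co * Co + S * S = 1" using sin_cos_squared_add2[of h] by (simp add: Co_def S_def power2_eq_square)
  obtain \<delta>1 where \<delta>1: "\<delta>1 > 0" "\<And>r. 0 < r \<Longrightarrow> r < \<delta>1 \<Longrightarrow> small_radius N R M \<epsilon> r"
    using eventually_small_radius[OF sc] by metis
  define B where "B = 18 * M"
  have B: "B > 0" using M by (simp add: B_def)
  obtain \<delta>2 C where \<delta>2: "\<delta>2 > 0" and C: "C > 0" and
    mid: "\<And>r t V. 1 \<le> \<mu> \<Longrightarrow> 0 < r \<Longrightarrow> r < \<delta>2 \<Longrightarrow> pi / 2 \<le> t \<Longrightarrow> t \<le> \<mu> * pi - pi / 2 \<Longrightarrow>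
      cmod (V - rcis r t) \<le> B * r\<^sup>2 \<Longrightarrow>
      V * cis (- (\<mu> * pi / 2)) \<in> wedge \<mu> \<and>
      \<bar>ln (wedge_weight \<mu> (V * cis (- (\<mu> * pi / 2)))) - ln (\<mu> * r * sin (t / \<mu>))\<bar> \<le> C * r"
  proof (cases "1 \<le> \<mu>")
    case True
    from wedge_weight_interior[OF True \<mu>(2) B] show thesis using that by metis
  next
    case False
    then show thesis using that[of 1 1] by simp
  qed
  \<comment> \<open>The last bound makes the curvature term \<open>k2 * r\<^sup>2\<close> smaller
    than \<open>S * r\<close>.\<close>
  define \<delta> where "\<delta> = min (min \<delta>1 \<delta>2) (S / (4 * M))"
  show thesis
  proof (rule that[of \<delta> C])
    show "\<delta> > 0" using \<delta>1 \<delta>2 S M by (simp add: \<delta>_def)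
    show "C > 0" by fact
    fix \<Omega> \<sigma>1 \<sigma>2 \<phi>1 \<phi>1' \<phi>2 \<phi>2' x
    assume cd: "corner_domain \<mu> N R \<Omega> \<sigma>1 \<sigma>2 \<phi>1 \<phi>1' \<phi>2 \<phi>2'" and x: "x \<in> \<Omega>"
      and x0: "0 < cmod x" and x\<delta>: "cmod x < \<delta>" and d1: "infdist x \<sigma>1 = cmod x" and d2: "infdist x \<sigma>2 = cmod x"
    define r where "r = cmod x"
    have r: "0 < r" "r < \<delta>1" "r < \<delta>2" "4 * M * r < S"
      using x0 x\<delta> M by (auto simp: r_def \<delta>_def field_simps)
    have sr: "small_radius N R M \<epsilon> (cmod x)" using \<delta>1(2) r by (simp add: r_def)
    note sr' = small_radiusD[OF sr, folded r_def]
    have flat: "\<phi> 0 = 0" "\<phi>' 0 = 0" if "tangent_graph \<phi> \<phi>' N R" for \<phi> \<phi>'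
      using tangent_graphD(1,2)[OF that, of 0] R by auto
    note tg1 = corner_domainD(1)[OF cd] and tg2 = corner_domainD(2)[OF cd]
    have R2: "0 < R / 2" "R / 2 \<le> R" using R by auto
    have one: "Complex 1 0 = 1" "Complex 0 0 = 0" by (simp_all add: complex_eq_iff)
    have fo1: "Re x \<le> 0"
    proof -
      have "Re ((x - Complex 0 (\<phi>1 0)) * cnj (Complex 1 (\<phi>1' 0))) \<le> 0"
      proof (rule foot_first_order(1)[OF tg1 order_refl R2])
        fix t assume "0 \<le> t" "t \<le> R / 2"
        then have "infdist x \<sigma>1 \<le> dist x (Complex t (\<phi>1 t))" by (intro infdist_le corner_domainD(7)[OF cd])
        then show "cmod (x - Complex 0 (\<phi>1 0)) \<le> cmod (x - Complex t (\<phi>1 t))"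
          using d1 by (simp add: dist_norm flat(1)[OF tg1] one)
      qed (use N in simp)
      then show ?thesis by (simp add: flat[OF tg1] one)
    qed
    have fo2: "Re (x * cis (- (\<mu> * pi))) \<le> 0"
    proof -
      have "Re ((x * cis (- (\<mu> * pi)) - Complex 0 (\<phi>2 0)) * cnj (Complex 1 (\<phi>2' 0))) \<le> 0"
      proof (rule foot_first_order(1)[OF tg2 order_refl R2])
        fix t assume "0 \<le> t" "t \<le> R / 2"
        then have "infdist x \<sigma>2 \<le> dist x (cis (\<mu> * pi) * Complex t (\<phi>2 t))" by (intro infdist_le corner_domainD(8)[OF cd])
        then have "cmod x \<le> cmod (x - cis (\<mu> * pi) * Complex t (\<phi>2 t))" using d2 by (simp add: dist_norm)
        also have "x - cis (\<mu> * pi) * Complex t (\<phi>2 t) = cis (\<mu> * pi) * (x * cis (- (\<mu> * pi)) - Complex t (\<phi>2 t))"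
          by (simp add: right_diff_distrib mult.left_commute cis_mult)
        finally show "cmod (x * cis (- (\<mu> * pi)) - Complex 0 (\<phi>2 0)) \<le> cmod (x * cis (- (\<mu> * pi)) - Complex t (\<phi>2 t))"
          by (simp add: norm_mult flat(1)[OF tg2] one)
      qed (use N in simp)
      then show ?thesis by (simp add: flat[OF tg2] one)
    qed
    have a: "0 \<le> R" "20 * (M * 0) \<le> 1" "3 * (M * 0) \<le> \<epsilon>" using R \<epsilon> by auto
    obtain e1 k1 q1 where e1: "cmod e1 = 1" "cmod (e1 - 1) \<le> 3 * (M * 0)" and q1: "cmod q1 \<le> M * 0\<^sup>2"
      and k1: "0 < k1" "k1 \<le> 2 * (M * S)"
      and in1: "lens \<mu> q1 (e1 * cis (\<mu> * pi / 2)) (k1 / S) \<subseteq> \<Omega>"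
      using corner_lens_inside[OF sc cd order_refl a] unfolding S_def h_def by metis
    obtain e2 k2 q2 where e2: "cmod e2 = 1" "cmod (e2 - 1) \<le> 3 * (M * 0)" and q2: "cmod q2 \<le> M * 0\<^sup>2"
      and k2: "0 < k2" "k2 \<le> 2 * (M * S)"
      and out: "\<And>z. z \<in> \<Omega> \<Longrightarrow> cos (\<mu> * pi / 2) * \<bar>Im (lens_map q2 (e2 * cis (\<mu> * pi / 2)) (- (k2 / S)) z)\<bar>
        \<le> sin (\<mu> * pi / 2) * Re (lens_map q2 (e2 * cis (\<mu> * pi / 2)) (- (k2 / S)) z)"
      using corner_lens_outside[OF sc cd order_refl a] unfolding S_def h_def by metis
    have \<kappa>: "\<bar>k1 / S\<bar> \<le> 2 * M" "\<bar>- (k2 / S)\<bar> \<le> 2 * M" using k1 k2 S by (auto simp: field_simps)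
    define V1 where "V1 = lens_map q1 (e1 * cis (\<mu> * pi / 2)) (k1 / S) x * cis (\<mu> * pi / 2)"
    define V2 where "V2 = lens_map q2 (e2 * cis (\<mu> * pi / 2)) (- (k2 / S)) x * cis (\<mu> * pi / 2)"
    have Mr: "4 * (M * r) \<le> 1" "0 \<le> 2 * r" using sr' by auto
    have xr: "cmod x \<le> r" by (simp add: r_def)
    have V1x: "cmod (V1 - x) \<le> B * r\<^sup>2" unfolding V1_def B_def
      by (rule lens_map_near_identity[OF e1 q1 \<kappa>(1) order_refl Mr(2) xr Mr(1)]) (use M in simp)
    have V2x: "cmod (V2 - x) \<le> B * r\<^sup>2" unfolding V2_def B_def
      by (rule lens_map_near_identity[OF e2 q2 \<kappa>(2) order_refl Mr(2) xr Mr(1)]) (use M in simp)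
    define y where "y = x * cis (- h)"
    have xy: "x = y * cis h" by (simp add: y_def mult.assoc cis_mult)
    have ny: "cmod y = r" by (simp add: y_def norm_mult r_def)
    have W2: "lens_map q2 (e2 * cis (\<mu> * pi / 2)) (- (k2 / S)) x = y + of_real (k2 / S * r\<^sup>2)"
    proof -
      have "e2 = 1" "q2 = 0" using e2 q2 by auto
      then show ?thesis by (simp add: lens_map_def y_def h_def cis_cnj r_def)
    qed
    have o: "Co * \<bar>Im y\<bar> \<le> S * Re y + k2 * r\<^sup>2"
      using out[OF x, unfolded W2] S unfolding h_def[symmetric] Co_def[symmetric] S_def[symmetric]
      by (simp add: distrib_left)
    have f1: "Re y * Co - Im y * S \<le> 0" using fo1 unfolding xy by (simp add: Co_def S_def)
    have "h + - (\<mu> * pi) = - h" by (simp add: h_def)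
    then have "x * cis (- (\<mu> * pi)) = y * cis (- h)" unfolding xy by (simp only: mult.assoc cis_mult)
    then have f2: "Re y * Co + Im y * S \<le> 0" using fo2 by (simp add: Co_def S_def)
    have f: "Co * Re y \<le> - (S * \<bar>Im y\<bar>)" using f1 f2 by (simp add: abs_if mult.commute)
    have k2r: "k2 * r\<^sup>2 < S * r"
    proof -
      have "k2 * r \<le> 2 * (M * S) * r" using k2 r by (intro mult_right_mono) auto
      also have "\<dots> = 2 * M * r * S" by (simp add: mult_ac)
      also have "\<dots> \<le> 2 * M * r * 1" using S M r by (intro mult_left_mono) auto
      also have "\<dots> < S"
      proof -
        have "0 < M * r" using M r by simp
        then show ?thesis using r(4) by simp
      qed
      finally have "k2 * r * r < S * r" using r by (intro mult_strict_right_mono)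
      then show ?thesis by (simp add: power2_eq_square mult.assoc)
    qed
    \<comment> \<open>For \<open>\<mu> < 1\<close> the condition \<open>f\<close> puts
      \<open>y\<close> into the polar cone of the wedge, while \<open>o\<close> puts it into the
      wedge enlarged by \<open>k2 * r\<^sup>2\<close>. Both together give
      \<open>S * r \<le> k2 * r\<^sup>2\<close>.\<close>
    have \<mu>1: "1 \<le> \<mu>"
    proof (rule ccontr)
      assume "\<not> 1 \<le> \<mu>"
      then have "h < pi / 2" by (simp add: h_def)
      then have Co: "Co > 0" unfolding Co_def using h by (intro cos_gt_zero) auto
      have "0 \<le> S * \<bar>Im y\<bar>" using S by simp
      then have "Co * Re y \<le> 0" using f by linarith
      then have re: "Re y \<le> 0" using Co by (simp add: mult_le_0_iff)
      have 1: "S * (S * \<bar>Im y\<bar>) \<le> S * (- (Co * Re y))" using f S by (intro mult_left_mono) auto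
      have 2: "Co * (Co * \<bar>Im y\<bar>) \<le> Co * (S * Re y + k2 * r\<^sup>2)" using o Co by (intro mult_left_mono) auto
      have "(Co * Co + S * S) * \<bar>Im y\<bar> \<le> Co * (k2 * r\<^sup>2)" using 1 2 by (simp add: algebra_simps)
      then have im: "\<bar>Im y\<bar> \<le> Co * (k2 * r\<^sup>2)" by (simp add: SC)
      have re2: "S * \<bar>Re y\<bar> \<le> k2 * r\<^sup>2 - Co * \<bar>Im y\<bar>" using o re by simp
      have "(S * r)\<^sup>2 = (S * \<bar>Re y\<bar>)\<^sup>2 + (S * \<bar>Im y\<bar>)\<^sup>2"
        unfolding ny[symmetric] power_mult_distrib cmod_power2 by (simp add: distrib_left)
      also have "\<dots> \<le> (k2 * r\<^sup>2 - Co * \<bar>Im y\<bar>)\<^sup>2 + (S * \<bar>Im y\<bar>)\<^sup>2"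
        using re2 S by (intro add_right_mono power_mono) auto
      also have "\<dots> = (k2 * r\<^sup>2)\<^sup>2 - 2 * (Co * (k2 * r\<^sup>2)) * \<bar>Im y\<bar> + (Co * Co + S * S) * \<bar>Im y\<bar>\<^sup>2"
        by (simp add: power2_eq_square algebra_simps)
      also have "\<dots> \<le> (k2 * r\<^sup>2)\<^sup>2 - 2 * \<bar>Im y\<bar> * \<bar>Im y\<bar> + \<bar>Im y\<bar>\<^sup>2"
        unfolding SC using im by (simp add: mult_right_mono)
      also have "\<dots> \<le> (k2 * r\<^sup>2)\<^sup>2"
        using zero_le_power2[of "\<bar>Im y\<bar>"] unfolding power2_eq_square[of "\<bar>Im y\<bar>"] by linarith
      finally have "S * r \<le> k2 * r\<^sup>2" by (rule power2_le_imp_le) (use k2 in simp)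
      then show False using k2r by simp
    qed
    define \<psi> where "\<psi> = Arg y"
    have y\<psi>: "y = rcis r \<psi>" using rcis_cmod_Arg[of y] by (simp add: \<psi>_def ny)
    have \<psi>b: "- pi < \<psi>" "\<psi> \<le> pi" using Arg_bounded[of y] by (auto simp: \<psi>_def)
    have hpi: "pi / 2 \<le> h" using \<mu>1 by (simp add: h_def)
    have \<psi>h: "\<bar>\<psi>\<bar> \<le> h - pi / 2"
    proof (rule ccontr)
      assume neg: "\<not> \<bar>\<psi>\<bar> \<le> h - pi / 2"
      have "sin \<bar>\<psi>\<bar> = \<bar>sin \<psi>\<bar>"
      proof -
        have "sin \<bar>\<psi>\<bar> \<ge> 0" using \<psi>b by (intro sin_ge_zero) auto
        then show ?thesis by (auto simp: abs_if)
      qed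
      moreover have "Re y = r * cos \<psi>" "Im y = r * sin \<psi>" by (subst y\<psi>, simp)+
      ultimately have "\<bar>Im y\<bar> = r * sin \<bar>\<psi>\<bar>" "Re y = r * cos \<bar>\<psi>\<bar>"
        using r by (simp_all add: abs_mult)
      then have "r * (Co * cos \<bar>\<psi>\<bar> + S * sin \<bar>\<psi>\<bar>) \<le> 0" using f by (simp add: algebra_simps)
      then have "cos (h - \<bar>\<psi>\<bar>) \<le> 0" using r by (simp add: cos_diff Co_def S_def mult_le_0_iff)
      moreover have "h - \<bar>\<psi>\<bar> < pi / 2" using neg by simp
      ultimately have "h - \<bar>\<psi>\<bar> \<le> - (pi / 2)" using cos_gt_zero_pi[of "h - \<bar>\<psi>\<bar>"] by linarith
      \<comment> \<open>The cosine condition alone also admits \<open>\<mu> = 1\<close> with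
        \<open>x\<close> opposite to the bisector; only the exterior lens excludes that.\<close>
      then have "h = pi / 2" "\<bar>\<psi>\<bar> = pi" using hpi \<psi>b by (auto simp: abs_if split: if_splits)
      then have "\<psi> = pi" using \<psi>b by (auto simp: abs_if split: if_splits)
      then have "Re y = - r" "Im y = 0" by (subst y\<psi>, simp)+
      then show False using o k2r \<open>h = pi / 2\<close> by (simp add: S_def Co_def)
    qed
    define \<theta> where "\<theta> = h + \<psi>"
    have \<theta>: "pi / 2 \<le> \<theta>" "\<theta> \<le> \<mu> * pi - pi / 2"
      using \<psi>h unfolding \<theta>_def h_def abs_le_iff by linarith+
    have x\<theta>: "x = rcis r \<theta>" by (simp add: xy y\<psi> \<theta>_def rcis_def mult.assoc cis_mult add.commute)
    have "Arg2pi x = \<theta>"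
    proof (rule Arg2pi_unique)
      show "of_real r * exp (\<i> * of_real \<theta>) = x" by (simp add: x\<theta> rcis_def cis_conv_exp)
      have "\<mu> * pi < 2 * pi" using \<mu> by simp
      then show "\<theta> < 2 * pi" "0 \<le> \<theta>" using \<theta> pi_gt_zero by linarith+
    qed fact
    moreover have "bracketed \<mu> \<Omega> x (- ln (\<mu> * r * sin (\<theta> / \<mu>))) (C * r)"
    proof (rule bracketedI[OF \<mu> e1(1) _ in1 e2(1) _ out V1_def _ V2_def])
      show "0 < k1 / S" "0 < k2 / S" using k1 k2 S by auto
    qed (use mid[OF \<mu>1 r(1,3) \<theta>] V1x V2x x\<theta> in auto)
    ultimately show "1 \<le> \<mu> \<and> pi / 2 \<le> Arg2pi x \<and> Arg2pi x \<le> \<mu> * pi - pi / 2 \<and>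
      bracketed \<mu> \<Omega> x (- ln (\<mu> * cmod x * sin (Arg2pi x / \<mu>))) (C * cmod x)"
      using \<mu>1 \<theta> by (simp add: r_def)
  qed
qed

subsection \<open>Symmetries\<close>

lemma infdist_vimage_isometry:
  fixes f :: "complex \<Rightarrow> complex"
  assumes f: "surj f" "\<And>y z. dist (f y) (f z) = dist y z"
  shows "infdist y (f -` A) = infdist (f y) A"
proof (cases "A = {}")
  case False
  have im: "f ` (f -` A) = A" using f(1) by (rule surj_image_vimage_eq)
  then have ne: "f -` A \<noteq> {}" using False by blast
  have "infdist (f y) A = (INF a\<in>f ` (f -` A). dist (f y) a)" unfolding im by (rule infdist_notempty[OF False])
  also have "\<dots> = (INF a\<in>f -` A. dist y a)" by (simp only: image_image f(2))
  also have "\<dots> = infdist y (f -` A)" by (rule infdist_notempty[OF ne, symmetric])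
  finally show ?thesis by simp
qed (simp add: infdist_def)

text \<open>The reflection in the bisector of the cone; it sends the polar angle
  \<open>\<theta>\<close> to \<open>\<mu> * pi - \<theta>\<close> and exchanges the two
  sides.\<close>

definition corner_reflection :: "real \<Rightarrow> complex \<Rightarrow> complex" where
  "corner_reflection \<mu> z = cnj z * cis (\<mu> * pi)"

lemma corner_reflection_simps:
  "corner_reflection \<mu> (corner_reflection \<mu> z) = z"
  "cmod (corner_reflection \<mu> z) = cmod z"
  "dist (corner_reflection \<mu> y) (corner_reflection \<mu> z) = dist y z"
  "corner_reflection \<mu> (cis (\<mu> * pi) * Complex s t) = Complex s (- t)"
  "corner_reflection \<mu> (Complex s t) = cis (\<mu> * pi) * Complex s (- t)"
  "corner_reflection \<mu> (of_real s * cis (\<mu> * pi / 2)) = of_real s * cis (\<mu> * pi / 2)"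
  "corner_reflection \<mu> (- z) = - corner_reflection \<mu> z"
  "surj (corner_reflection \<mu>)"
proof -
  show 1: "corner_reflection \<mu> (corner_reflection \<mu> z) = z" for z
    by (simp add: corner_reflection_def cis_cnj mult.assoc cis_mult)
  show 2: "cmod (corner_reflection \<mu> z) = cmod z" for z by (simp add: corner_reflection_def norm_mult)
  have "corner_reflection \<mu> y - corner_reflection \<mu> z = corner_reflection \<mu> (y - z)"
    by (simp add: corner_reflection_def algebra_simps)
  then show "dist (corner_reflection \<mu> y) (corner_reflection \<mu> z) = dist y z" by (simp add: dist_norm 2)
  have c: "cnj (Complex s t) = Complex s (- t)" by (simp add: complex_eq_iff)
  show "corner_reflection \<mu> (cis (\<mu> * pi) * Complex s t) = Complex s (- t)"
    by (simp add: corner_reflection_def cis_cnj c mult.assoc mult.commute[of _ "cis (\<mu> * pi)"] mult.left_commute[of _ "cis (\<mu> * pi)"])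
       (simp add: mult.assoc[symmetric] cis_mult)
  show "corner_reflection \<mu> (Complex s t) = cis (\<mu> * pi) * Complex s (- t)"
    by (simp add: corner_reflection_def c mult.commute)
  have "- (\<mu> * pi / 2) + \<mu> * pi = \<mu> * pi / 2" by simp
  then have "cis (- (\<mu> * pi / 2)) * cis (\<mu> * pi) = cis (\<mu> * pi / 2)" by (simp only: cis_mult)
  then show "corner_reflection \<mu> (of_real s * cis (\<mu> * pi / 2)) = of_real s * cis (\<mu> * pi / 2)"
    by (simp add: corner_reflection_def cis_cnj mult.assoc)
  show "corner_reflection \<mu> (- z) = - corner_reflection \<mu> z" by (simp add: corner_reflection_def)
  show "surj (corner_reflection \<mu>)" using 1 by (metis surjI)
qed

lemma continuous_corner_reflection: "continuous_on A (corner_reflection \<mu>)"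
  unfolding corner_reflection_def by (intro continuous_intros)

lemma corner_domain_reflection:
  assumes "corner_domain \<mu> N R \<Omega> \<sigma>1 \<sigma>2 \<phi>1 \<phi>1' \<phi>2 \<phi>2'"
  shows "corner_domain \<mu> N R (corner_reflection \<mu> -` \<Omega>) (corner_reflection \<mu> -` \<sigma>2) (corner_reflection \<mu> -` \<sigma>1)
    (\<lambda>t. - \<phi>2 t) (\<lambda>t. - \<phi>2' t) (\<lambda>t. - \<phi>1 t) (\<lambda>t. - \<phi>1' t)"
proof -
  let ?f = "corner_reflection \<mu>"
  note cd = corner_domainD[OF assms]
  note fs = corner_reflection_simps
  have cont: "continuous_on UNIV ?f" by (rule continuous_corner_reflection)
  show ?thesis
    unfolding corner_domain_def
  proof (intro conjI ballI allI impI)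
    show "tangent_graph (\<lambda>t. - \<phi>2 t) (\<lambda>t. - \<phi>2' t) N R" "tangent_graph (\<lambda>t. - \<phi>1 t) (\<lambda>t. - \<phi>1' t) N R"
      using tangent_graph_uminus[OF cd(2)] tangent_graph_uminus[OF cd(1)] .
    show "closed (?f -` \<sigma>2)" "closed (?f -` \<sigma>1)" using closed_vimage[OF cd(4) cont] closed_vimage[OF cd(3) cont] .
    show "\<exists>t\<in>{0..R}. z = Complex t (- \<phi>2 t)" if "z \<in> ?f -` \<sigma>2" "cmod z < R" for z
    proof -
      have "?f z \<in> \<sigma>2" "cmod (?f z) < R" using that by (simp_all add: fs(2))
      from cd(6)[OF this] obtain t where t: "0 \<le> t" "t \<le> R" "?f z = cis (\<mu> * pi) * Complex t (\<phi>2 t)"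
        by blast
      have "z = Complex t (- \<phi>2 t)" using arg_cong[OF t(3), of ?f] by (simp add: fs)
      then show ?thesis using t by auto
    qed
    show "\<exists>t\<in>{0..R}. z = cis (\<mu> * pi) * Complex t (- \<phi>1 t)" if "z \<in> ?f -` \<sigma>1" "cmod z < R" for z
    proof -
      have "?f z \<in> \<sigma>1" "cmod (?f z) < R" using that by (simp_all add: fs(2))
      from cd(5)[OF this] obtain t where t: "0 \<le> t" "t \<le> R" "?f z = Complex t (\<phi>1 t)"
        by blast
      have "z = cis (\<mu> * pi) * Complex t (- \<phi>1 t)" using arg_cong[OF t(3), of ?f] by (simp add: fs)
      then show ?thesis using t by auto
    qed
    show "Complex t (- \<phi>2 t) \<in> ?f -` \<sigma>2" "cis (\<mu> * pi) * Complex t (- \<phi>1 t) \<in> ?f -` \<sigma>1" if "t \<in> {0..R / 2}" for t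
      using cd(7,8)[of t] that by (auto simp: fs)
    show "A \<subseteq> ?f -` \<Omega>" if A: "connected A" "A \<subseteq> ball 0 R" "A \<inter> (?f -` \<sigma>2 \<union> ?f -` \<sigma>1) = {}" "A \<inter> ?f -` \<Omega> \<noteq> {}" for A
    proof -
      have "?f ` A \<subseteq> \<Omega>"
      proof (rule cd(9))
        show "connected (?f ` A)" using A(1) by (intro connected_continuous_image continuous_corner_reflection)
        show "?f ` A \<subseteq> ball 0 R" using A(2) by (auto simp: fs)
        show "?f ` A \<inter> (\<sigma>1 \<union> \<sigma>2) = {}" "?f ` A \<inter> \<Omega> \<noteq> {}" using A(3,4) by auto
      qed
      then show ?thesis by auto
    qed
    show "z \<notin> ?f -` \<sigma>2 \<union> ?f -` \<sigma>1" if "z \<in> ?f -` \<Omega>" "cmod z < R" for z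
      using cd(10)[of "?f z"] that fs(2) by auto
    show "\<exists>\<rho>>0. \<forall>s. 0 < s \<longrightarrow> s < \<rho> \<longrightarrow> of_real s * cis (\<mu> * pi / 2) \<in> ?f -` \<Omega> \<and> - (of_real s * cis (\<mu> * pi / 2)) \<notin> ?f -` \<Omega>"
      using cd(11) by (simp add: fs)
  qed
qed

lemma wedge_cnj: "cnj W \<in> wedge \<mu> \<longleftrightarrow> W \<in> wedge \<mu>" "wedge_weight \<mu> (cnj W) = wedge_weight \<mu> W"
  by (simp_all add: wedge_def wedge_weight_def Arg_cnj)

lemma bracketed_reflection:
  assumes "bracketed \<mu> (corner_reflection \<mu> -` \<Omega>) (corner_reflection \<mu> x) F E"
  shows "bracketed \<mu> \<Omega> x F E"
proof -
  let ?f = "corner_reflection \<mu>"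
  have L: "lens_map q b \<kappa> (?f z) = cnj (lens_map (?f q) (?f b) \<kappa> z)" for q b \<kappa> z
  proof -
    have "cmod (?f z - q) = cmod (z - ?f q)"
      using corner_reflection_simps(1,3)[of \<mu>] by (metis dist_norm)
    moreover have "cis (\<mu> * pi) * cis (- (\<mu> * pi)) = 1" by (simp add: cis_mult)
    then have "q * cnj b = q * cnj b * (cis (\<mu> * pi) * cis (- (\<mu> * pi)))" by simp
    ultimately show ?thesis by (simp add: lens_map_def corner_reflection_def cis_cnj algebra_simps)
  qed
  have mem: "?f z \<in> lens \<mu> q b \<kappa> \<longleftrightarrow> z \<in> lens \<mu> (?f q) (?f b) \<kappa>"
    and sol: "lens_sol \<mu> q b \<kappa> (?f z) = lens_sol \<mu> (?f q) (?f b) \<kappa> z" for q b \<kappa> z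
    by (simp_all add: lens_def lens_sol_def L wedge_cnj)
  note fs = corner_reflection_simps
  obtain q b \<kappa> where 1: "cmod b = 1" "\<kappa> > 0" "lens \<mu> q b \<kappa> \<subseteq> ?f -` \<Omega>" "?f x \<in> lens \<mu> q b \<kappa>" "\<bar>lens_sol \<mu> q b \<kappa> (?f x) - F\<bar> \<le> E"
    using assms unfolding bracketed_def by blast
  have "lens \<mu> (?f q) (?f b) \<kappa> \<subseteq> \<Omega>"
  proof
    fix z assume "z \<in> lens \<mu> (?f q) (?f b) \<kappa>"
    then have "?f z \<in> ?f -` \<Omega>" using mem 1(3) by blast
    then show "z \<in> \<Omega>" by (simp add: fs)
  qed
  then have A: "\<exists>q b \<kappa>. cmod b = 1 \<and> \<kappa> > 0 \<and> lens \<mu> q b \<kappa> \<subseteq> \<Omega> \<and> x \<in> lens \<mu> q b \<kappa> \<and> \<bar>lens_sol \<mu> q b \<kappa> x - F\<bar> \<le> E"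
    using 1 mem sol fs(2) by metis
  obtain q b \<kappa> where 2: "cmod b = 1" "\<kappa> < 0" "\<And>z. z \<in> ?f -` \<Omega> \<Longrightarrow>
      cos (\<mu> * pi / 2) * \<bar>Im (lens_map q b \<kappa> z)\<bar> \<le> sin (\<mu> * pi / 2) * Re (lens_map q b \<kappa> z)"
    "?f x \<in> lens \<mu> q b \<kappa>" "\<bar>lens_sol \<mu> q b \<kappa> (?f x) - F\<bar> \<le> E"
    using assms unfolding bracketed_def by blast
  have "cos (\<mu> * pi / 2) * \<bar>Im (lens_map (?f q) (?f b) \<kappa> z)\<bar> \<le> sin (\<mu> * pi / 2) * Re (lens_map (?f q) (?f b) \<kappa> z)"
    if "z \<in> \<Omega>" for z
    using 2(3)[of "?f z"] that by (simp add: L fs)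
  then have B: "\<exists>q b \<kappa>. cmod b = 1 \<and> \<kappa> < 0 \<and>
        (\<forall>z\<in>\<Omega>. cos (\<mu> * pi / 2) * \<bar>Im (lens_map q b \<kappa> z)\<bar> \<le> sin (\<mu> * pi / 2) * Re (lens_map q b \<kappa> z)) \<and>
        x \<in> lens \<mu> q b \<kappa> \<and> \<bar>lens_sol \<mu> q b \<kappa> x - F\<bar> \<le> E"
    using 2 mem sol fs(2) by (intro exI[of _ "?f q"] exI[of _ "?f b"] exI[of _ \<kappa>]) auto
  show ?thesis unfolding bracketed_def using A B by blast
qed

lemma bracketed_rotation:
  assumes "bracketed \<mu> ((\<lambda>z. z * cis \<alpha>) -` \<Omega>) (x * cis (- \<alpha>)) F E"
  shows "bracketed \<mu> \<Omega> x F E"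
proof -
  have cc: "cis (- \<alpha>) * cis \<alpha> = 1" by (simp add: cis_mult)
  have L: "lens_map q b \<kappa> (z * cis (- \<alpha>)) = lens_map (q * cis \<alpha>) (b * cis \<alpha>) \<kappa> z" for q b \<kappa> z
  proof -
    have e: "z * cis (- \<alpha>) - q = (z - q * cis \<alpha>) * cis (- \<alpha>)"
      using cc by (simp add: left_diff_distrib mult.assoc mult.commute[of "cis \<alpha>"])
    then have "cmod (z * cis (- \<alpha>) - q) = cmod (z - q * cis \<alpha>)" by (simp add: norm_mult)
    moreover have "(z * cis (- \<alpha>) - q) * cnj b = (z - q * cis \<alpha>) * cnj (b * cis \<alpha>)"
      unfolding e by (simp add: cis_cnj mult_ac)
    ultimately show ?thesis by (simp add: lens_map_def)
  qed
  have mem: "z * cis (- \<alpha>) \<in> lens \<mu> q b \<kappa> \<longleftrightarrow> z \<in> lens \<mu> (q * cis \<alpha>) (b * cis \<alpha>) \<kappa>"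
    and sol: "lens_sol \<mu> q b \<kappa> (z * cis (- \<alpha>)) = lens_sol \<mu> (q * cis \<alpha>) (b * cis \<alpha>) \<kappa> z" for q b \<kappa> z
    by (simp_all add: lens_def lens_sol_def L)
  have n: "cmod (b * cis \<alpha>) = cmod b" for b by (simp add: norm_mult)
  have rot_mem: "z * cis (- \<alpha>) \<in> (\<lambda>z. z * cis \<alpha>) -` \<Omega> \<longleftrightarrow> z \<in> \<Omega>" for z by (simp add: mult.assoc cis_mult)
  obtain q b \<kappa> where 1: "cmod b = 1" "\<kappa> > 0" "lens \<mu> q b \<kappa> \<subseteq> (\<lambda>z. z * cis \<alpha>) -` \<Omega>"
    "x * cis (- \<alpha>) \<in> lens \<mu> q b \<kappa>" "\<bar>lens_sol \<mu> q b \<kappa> (x * cis (- \<alpha>)) - F\<bar> \<le> E"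
    using assms unfolding bracketed_def by blast
  have "lens \<mu> (q * cis \<alpha>) (b * cis \<alpha>) \<kappa> \<subseteq> \<Omega>" using mem 1(3) rot_mem by blast
  then have A: "\<exists>q b \<kappa>. cmod b = 1 \<and> \<kappa> > 0 \<and> lens \<mu> q b \<kappa> \<subseteq> \<Omega> \<and> x \<in> lens \<mu> q b \<kappa> \<and> \<bar>lens_sol \<mu> q b \<kappa> x - F\<bar> \<le> E"
    using 1 mem sol n by metis
  obtain q b \<kappa> where 2: "cmod b = 1" "\<kappa> < 0" "\<And>z. z \<in> (\<lambda>z. z * cis \<alpha>) -` \<Omega> \<Longrightarrow>
      cos (\<mu> * pi / 2) * \<bar>Im (lens_map q b \<kappa> z)\<bar> \<le> sin (\<mu> * pi / 2) * Re (lens_map q b \<kappa> z)"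
    "x * cis (- \<alpha>) \<in> lens \<mu> q b \<kappa>" "\<bar>lens_sol \<mu> q b \<kappa> (x * cis (- \<alpha>)) - F\<bar> \<le> E"
    using assms unfolding bracketed_def by blast
  have "\<forall>z\<in>\<Omega>. cos (\<mu> * pi / 2) * \<bar>Im (lens_map (q * cis \<alpha>) (b * cis \<alpha>) \<kappa> z)\<bar>
      \<le> sin (\<mu> * pi / 2) * Re (lens_map (q * cis \<alpha>) (b * cis \<alpha>) \<kappa> z)"
    using 2(3) rot_mem unfolding L[symmetric] by blast
  then have B: "\<exists>q b \<kappa>. cmod b = 1 \<and> \<kappa> < 0 \<and>
        (\<forall>z\<in>\<Omega>. cos (\<mu> * pi / 2) * \<bar>Im (lens_map q b \<kappa> z)\<bar> \<le> sin (\<mu> * pi / 2) * Re (lens_map q b \<kappa> z)) \<and>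
        x \<in> lens \<mu> q b \<kappa> \<and> \<bar>lens_sol \<mu> q b \<kappa> x - F\<bar> \<le> E"
    using 2 mem sol n by (intro exI[of _ "q * cis \<alpha>"] exI[of _ "b * cis \<alpha>"] exI[of _ \<kappa>]) auto
  show ?thesis unfolding bracketed_def using A B by blast
qed

text \<open>Otherwise the polar angle of \<open>x\<close> would be close both to some \<open>t \<le> pi / 2\<close> and to \<open>\<mu> * pi - t\<close>.\<close>

lemma equidistant_imp_corner_foot:
  fixes \<mu> N R M \<epsilon> :: real
  assumes sc: "corner_scale \<mu> N R M \<epsilon>" and \<mu>1: "1 < \<mu>"
  obtains \<delta> where "\<delta> > 0" "\<And>\<Omega> \<sigma>1 \<sigma>2 \<phi>1 \<phi>1' \<phi>2 \<phi>2' x. corner_domain \<mu> N R \<Omega> \<sigma>1 \<sigma>2 \<phi>1 \<phi>1' \<phi>2 \<phi>2' \<Longrightarrow>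
    x \<in> \<Omega> \<Longrightarrow> 0 < cmod x \<Longrightarrow> cmod x < \<delta> \<Longrightarrow> infdist x \<sigma>1 = infdist x \<sigma>2 \<Longrightarrow> \<not> infdist x \<sigma>1 < cmod x"
proof -
  have \<mu>: "0 < \<mu>" "\<mu> < 2" and N: "0 < N" using sc by (auto simp: corner_scale_def)
  define h where "h = \<mu> * pi / 2"
  have h: "pi / 2 < h" "h < pi" using \<mu> \<mu>1 by (auto simp: h_def)
  have sh: "sin h > 0" "cos h < 0" using h cos_lt_zero_pi[of h] pi_gt_zero by (auto intro!: sin_gt_zero)
  \<comment> \<open>A lower bound of \<open>sin (h - t)\<close> for t between 0 and
    \<open>pi / 2\<close>: both coefficients in its addition formula are at least \<open>c\<close>,
    and \<open>sin t + cos t \<ge> 1\<close>.\<close>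
  define c where "c = min (sin h) (- cos h)"
  have c: "c > 0" using sh by (simp add: c_def)
  obtain \<delta>1 where \<delta>1: "\<delta>1 > 0" "\<And>r. 0 < r \<Longrightarrow> r < \<delta>1 \<Longrightarrow> small_radius N R M \<epsilon> r"
    using eventually_small_radius[OF sc] by metis
  define \<delta> where "\<delta> = min \<delta>1 (c / (12 * N))"
  show thesis
  proof (rule that[of \<delta>])
    show "\<delta> > 0" using \<delta>1 c N by (simp add: \<delta>_def)
    fix \<Omega> \<sigma>1 \<sigma>2 \<phi>1 \<phi>1' \<phi>2 \<phi>2' x
    assume cd: "corner_domain \<mu> N R \<Omega> \<sigma>1 \<sigma>2 \<phi>1 \<phi>1' \<phi>2 \<phi>2'" and x: "x \<in> \<Omega>"
      and x0: "0 < cmod x" and x\<delta>: "cmod x < \<delta>" and eq: "infdist x \<sigma>1 = infdist x \<sigma>2"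
    let ?f = "corner_reflection \<mu>"
    note fs = corner_reflection_simps
    show "\<not> infdist x \<sigma>1 < cmod x"
    proof
      assume lt: "infdist x \<sigma>1 < cmod x"
      define r where "r = cmod x"
      define d where "d = infdist x \<sigma>1"
      define t where "t = arcsin (d / r)"
      have r: "0 < r" "r < \<delta>1" "12 * (N * r) < c" using x0 x\<delta> N by (auto simp: r_def \<delta>_def field_simps)
      have sr: "small_radius N R M \<epsilon> (cmod x)" using \<delta>1(2) r by (simp add: r_def)
      have 1: "cmod (x - rcis r t) \<le> 12 * N * r\<^sup>2"
        using nearer_foot[OF sc cd x sr d_def _ lt[folded d_def]] eq unfolding r_def t_def d_def by (metis order_refl)
      note inf = infdist_vimage_isometry[OF fs(8,3)]
      have d': "d = infdist (?f x) (?f -` \<sigma>2)" "d \<le> infdist (?f x) (?f -` \<sigma>1)" "d < cmod (?f x)"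
        using eq lt by (simp_all add: inf fs d_def)
      have "?f x \<in> ?f -` \<Omega>" using x by (simp add: fs)
      from nearer_foot[OF sc corner_domain_reflection[OF cd] this _ d']
      have "cmod (?f x - rcis r t) \<le> 12 * N * r\<^sup>2"
        unfolding r_def t_def using sr fs(2) by metis
      then have 2: "cmod (x - ?f (rcis r t)) \<le> 12 * N * r\<^sup>2"
        using fs(1,3) by (metis dist_norm)
      have fr: "?f (rcis r t) = rcis r (2 * h - t)"
        by (simp add: corner_reflection_def rcis_def cis_cnj mult.assoc cis_mult h_def algebra_simps)
      have "cmod (rcis r t - rcis r (2 * h - t)) \<le> 24 * N * r\<^sup>2"
        using norm_triangle_ineq4[of "x - rcis r (2 * h - t)" "x - rcis r t"] 1 2 unfolding fr by simp
      moreover have "rcis r t - rcis r (2 * h - t) = of_real (2 * r * sin (h - t)) * (- \<i> * cis h)"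
      proof -
        have "cis t = cis h * cis (- (h - t))" "cis (2 * h - t) = cis h * cis (h - t)" by (simp_all add: cis_mult)
        moreover have "cis (- w) - cis w = - \<i> * of_real (2 * sin w)" for w by (simp add: complex_eq_iff)
        moreover have "rcis r t - rcis r (2 * h - t) = of_real r * (cis t - cis (2 * h - t))"
          by (simp add: rcis_def right_diff_distrib)
        ultimately have "rcis r t - rcis r (2 * h - t) = of_real r * (cis h * (- \<i> * of_real (2 * sin (h - t))))"
          by (simp only: right_diff_distrib[symmetric])
        then show ?thesis by (simp add: mult_ac)
      qed
      ultimately have "2 * r * sin (h - t) \<le> 24 * N * r\<^sup>2"
        using abs_ge_self[of "2 * r * sin (h - t)"] by (simp only: norm_mult norm_of_real norm_minus_cancel norm_ii norm_cis mult_1_right)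
      then have "2 * r * sin (h - t) \<le> 2 * r * (12 * (N * r))" by (simp add: power2_eq_square mult_ac)
      then have s: "sin (h - t) \<le> 12 * (N * r)" using r by simp
      have dr: "0 \<le> d / r" "d / r \<le> 1" using lt r infdist_nonneg[of x \<sigma>1] by (auto simp: r_def d_def)
      have t: "0 \<le> t" "t \<le> pi / 2" unfolding t_def using dr arcsin_le_arcsin[of 0 "d / r"] arcsin_ubound[of "d / r"] by auto
      have ct: "0 \<le> cos t" "0 \<le> sin t" using t by (auto intro!: cos_ge_zero sin_ge_zero)
      have "1 = (sin t)\<^sup>2 + (cos t)\<^sup>2" by simp
      also have "\<dots> \<le> sin t + cos t"
        using ct sin_le_one[of t] cos_le_one[of t] by (intro add_mono) (auto simp: power2_eq_square mult_left_le)
      finally have "c * 1 \<le> c * (sin t + cos t)" using c by (intro mult_left_mono) auto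
      also have "\<dots> \<le> sin h * cos t + (- cos h) * sin t"
      proof -
        have "c * cos t \<le> sin h * cos t" "c * sin t \<le> (- cos h) * sin t"
          using mult_right_mono[of c "sin h" "cos t"] mult_right_mono[of c "- cos h" "sin t"] ct
          unfolding c_def by linarith+
        then show ?thesis by (simp add: distrib_left)
      qed
      also have "\<dots> = sin (h - t)" by (simp add: sin_diff)
      finally show False using s r by simp
    qed
  qed
qed

text \<open>This is \<open>f_corner\<close> in coordinates with \<open>\<alpha> = 0\<close>, with
  the distance to the frontier replaced by the smaller of the two distances. Apart from ties it
  depends on \<open>x\<close> only through reflection-invariant quantities.\<close>

definition corner_profile :: "real \<Rightarrow> complex \<Rightarrow> real \<Rightarrow> real \<Rightarrow> real" where
  "corner_profile \<mu> x d1 d2 =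
     (if \<mu> \<le> 1 then - ln (\<mu> * norm x * sin (arcsin (min d1 d2 / norm x) / \<mu>))
      else if d1 < d2 then - ln (\<mu> * norm x * sin (arcsin (d1 / norm x) / \<mu>))
      else if d1 = d2 then - ln (\<mu> * norm x * sin (Arg2pi x / \<mu>))
      else - ln (\<mu> * norm x * sin (arcsin (d2 / norm x) / \<mu>)))"

theorem bracketed_corner_profile:
  fixes \<mu> N R M \<epsilon> :: real
  assumes sc: "corner_scale \<mu> N R M \<epsilon>"
  obtains \<delta> C where "\<delta> > 0" "C > 0" "\<And>\<Omega> \<sigma>1 \<sigma>2 \<phi>1 \<phi>1' \<phi>2 \<phi>2' x. corner_domain \<mu> N R \<Omega> \<sigma>1 \<sigma>2 \<phi>1 \<phi>1' \<phi>2 \<phi>2' \<Longrightarrow>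
    x \<in> \<Omega> \<Longrightarrow> cmod x < \<delta> \<Longrightarrow>
    bracketed \<mu> \<Omega> x (corner_profile \<mu> x (infdist x \<sigma>1) (infdist x \<sigma>2)) (C * min (infdist x \<sigma>1) (infdist x \<sigma>2))"
proof -
  have \<mu>: "0 < \<mu>" "\<mu> < 2" and R: "0 < R" using sc by (auto simp: corner_scale_def)
  obtain \<delta>1 C1 where near: "\<delta>1 > 0" "C1 > 0" "\<And>\<Omega> \<sigma>1 \<sigma>2 \<phi>1 \<phi>1' \<phi>2 \<phi>2' x. corner_domain \<mu> N R \<Omega> \<sigma>1 \<sigma>2 \<phi>1 \<phi>1' \<phi>2 \<phi>2' \<Longrightarrow>
    x \<in> \<Omega> \<Longrightarrow> 0 < cmod x \<Longrightarrow> cmod x < \<delta>1 \<Longrightarrow> infdist x \<sigma>1 \<le> infdist x \<sigma>2 \<Longrightarrow> infdist x \<sigma>1 < cmod x \<Longrightarrow>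
    bracketed \<mu> \<Omega> x (- ln (\<mu> * cmod x * sin (arcsin (infdist x \<sigma>1 / cmod x) / \<mu>))) (C1 * infdist x \<sigma>1)"
    using bracketed_near_side[OF sc] by metis
  obtain \<delta>2 C2 where foot: "\<delta>2 > 0" "C2 > 0" "\<And>\<Omega> \<sigma>1 \<sigma>2 \<phi>1 \<phi>1' \<phi>2 \<phi>2' x. corner_domain \<mu> N R \<Omega> \<sigma>1 \<sigma>2 \<phi>1 \<phi>1' \<phi>2 \<phi>2' \<Longrightarrow>
    x \<in> \<Omega> \<Longrightarrow> 0 < cmod x \<Longrightarrow> cmod x < \<delta>2 \<Longrightarrow> infdist x \<sigma>1 = cmod x \<Longrightarrow> infdist x \<sigma>2 = cmod x \<Longrightarrow>
    1 \<le> \<mu> \<and> pi / 2 \<le> Arg2pi x \<and> Arg2pi x \<le> \<mu> * pi - pi / 2 \<and>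
    bracketed \<mu> \<Omega> x (- ln (\<mu> * cmod x * sin (Arg2pi x / \<mu>))) (C2 * cmod x)"
    using bracketed_corner_foot[OF sc] by metis
  obtain \<delta>3 where tie: "\<delta>3 > 0" "\<And>\<Omega> \<sigma>1 \<sigma>2 \<phi>1 \<phi>1' \<phi>2 \<phi>2' x. 1 < \<mu> \<Longrightarrow> corner_domain \<mu> N R \<Omega> \<sigma>1 \<sigma>2 \<phi>1 \<phi>1' \<phi>2 \<phi>2' \<Longrightarrow>
    x \<in> \<Omega> \<Longrightarrow> 0 < cmod x \<Longrightarrow> cmod x < \<delta>3 \<Longrightarrow> infdist x \<sigma>1 = infdist x \<sigma>2 \<Longrightarrow> \<not> infdist x \<sigma>1 < cmod x"
  proof (cases "1 < \<mu>")
    case True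
    show thesis using equidistant_imp_corner_foot[OF sc True] that by metis
  next
    case False
    then show thesis using that[of 1] by simp
  qed
  define \<delta> where "\<delta> = Min {\<delta>1, \<delta>2, \<delta>3, R}"
  define C where "C = max C1 C2"
  have mono: "bracketed \<mu> \<Omega> x F E'" if "bracketed \<mu> \<Omega> x F E" "E \<le> E'" for \<Omega> x F E E'
    using that unfolding bracketed_def by (meson order_trans)
  show thesis
  proof (rule that[of \<delta> C])
    show "\<delta> > 0" "C > 0" using near(1,2) foot(1,2) tie(1) R by (auto simp: \<delta>_def C_def)
    fix \<Omega> \<sigma>1 \<sigma>2 \<phi>1 \<phi>1' \<phi>2 \<phi>2' x
    assume cd: "corner_domain \<mu> N R \<Omega> \<sigma>1 \<sigma>2 \<phi>1 \<phi>1' \<phi>2 \<phi>2'" and x: "x \<in> \<Omega>" and "cmod x < \<delta>"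
    then have small: "cmod x < \<delta>1" "cmod x < \<delta>2" "cmod x < \<delta>3" "cmod x < R" by (auto simp: \<delta>_def)
    let ?d1 = "infdist x \<sigma>1" and ?d2 = "infdist x \<sigma>2"
    note zero = zero_mem_curves[OF sc cd]
    have x0: "0 < cmod x" using corner_domainD(10)[OF cd x small(4)] zero by auto
    have dle: "?d1 \<le> cmod x" "?d2 \<le> cmod x" using infdist_le[OF zero(1), of x] infdist_le[OF zero(2), of x] by simp_all
    have Cd: "C1 * d \<le> C * d" "C2 * d \<le> C * d" if "d \<ge> 0" for d
      using that by (auto simp: C_def intro!: mult_right_mono)
    consider "?d1 \<le> ?d2" "?d1 < cmod x" | "?d1 = cmod x" "?d2 = cmod x" | "?d2 < ?d1" using dle by linarith
    then show "bracketed \<mu> \<Omega> x (corner_profile \<mu> x ?d1 ?d2) (C * min ?d1 ?d2)"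
    proof cases
      case 1
      \<comment> \<open>Here the corner is not the nearest point, and then \<open>tie\<close>
        forbids equal distances for \<open>\<mu> > 1\<close>; the branch with \<open>Arg2pi\<close>
        does not occur.\<close>
      have "\<mu> \<le> 1 \<or> ?d1 \<noteq> ?d2" using tie(2)[OF _ cd x x0 small(3)] 1 by linarith
      then have p: "corner_profile \<mu> x ?d1 ?d2 = - ln (\<mu> * cmod x * sin (arcsin (?d1 / cmod x) / \<mu>))"
        using 1 by (auto simp: corner_profile_def min_def)
      show ?thesis unfolding p
        by (rule mono[OF near(3)[OF cd x x0 small(1) 1]])
          (use 1 Cd infdist_nonneg[of x \<sigma>1] in \<open>simp add: min_def\<close>)
    next
      case corner: 2
      note b = foot(3)[OF cd x x0 small(2) corner]
      have p: "corner_profile \<mu> x ?d1 ?d2 = - ln (\<mu> * cmod x * sin (Arg2pi x / \<mu>))"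
      \<comment> \<open>For \<open>\<mu> = 1\<close> the profile is given by
        \<open>arcsin 1\<close>, but the angle is then forced to be \<open>pi / 2\<close>, so both
        formulas agree.\<close>
      proof (cases "\<mu> = 1")
        case True
        then have "Arg2pi x = pi / 2" using b by simp
        then have "sin (Arg2pi x) = 1" by (simp only: sin_pi_half)
        then show ?thesis using True corner x0 unfolding corner_profile_def by simp
      next
        case False
        then show ?thesis using b corner by (simp add: corner_profile_def)
      qed
      show ?thesis unfolding p
        by (rule mono[of \<Omega> x _ "C2 * cmod x"]) (use b corner Cd in auto)
    next
      case second: 3
      let ?f = "corner_reflection \<mu>"
      note fs = corner_reflection_simps
      note inf = infdist_vimage_isometry[OF fs(8,3)]
      have p: "corner_profile \<mu> x ?d1 ?d2 = - ln (\<mu> * cmod (?f x) * sin (arcsin (?d2 / cmod (?f x)) / \<mu>))"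
        using second by (simp add: corner_profile_def min_def fs)
      have m: "min ?d1 ?d2 = ?d2" using second by simp
      have "bracketed \<mu> (?f -` \<Omega>) (?f x) (- ln (\<mu> * cmod (?f x) * sin (arcsin (infdist (?f x) (?f -` \<sigma>2) / cmod (?f x)) / \<mu>)))
          (C1 * infdist (?f x) (?f -` \<sigma>2))"
        by (rule near(3)[OF corner_domain_reflection[OF cd]]) (use x x0 small second dle in \<open>simp_all add: inf fs\<close>)
      then have "bracketed \<mu> \<Omega> x (- ln (\<mu> * cmod (?f x) * sin (arcsin (?d2 / cmod (?f x)) / \<mu>))) (C1 * ?d2)"
        unfolding inf fs(1) by (rule bracketed_reflection)
      then show ?thesis unfolding p m by (rule mono) (use Cd infdist_nonneg[of x \<sigma>2] in auto)
    qed
  qed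
qed

subsection \<open>Conic singularities\<close>

text \<open>Two applications of the mean value theorem give the remainder
  \<open>K * (t - a)\<^sup>2\<close> without the usual factor one half; this is the origin of
  \<open>2 * K \<le> N\<close>.\<close>

lemma tangent_graph_of_C2:
  assumes C2: "C2_with_derivs b \<phi> \<phi>' \<phi>''" and z: "\<phi> 0 = 0" "\<phi>' 0 = 0"
    and bd: "\<And>t. t \<in> {0..b} \<Longrightarrow> \<bar>\<phi>'' t\<bar> \<le> K" and K: "0 \<le> K" "2 * K \<le> N" and R: "0 \<le> R" "R \<le> b"
  shows "tangent_graph \<phi> \<phi>' N R"
proof -
  have mv: "\<exists>z\<in>{s..t}. f t - f s = (t - s) * f' z"
    if f: "\<And>x. x \<in> {0..b} \<Longrightarrow> (f has_vector_derivative f' x) (at x within {0..b})" and st: "0 \<le> s" "s \<le> t" "t \<le> b"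
    for f f' :: "real \<Rightarrow> real" and s t
  proof (cases "s = t")
    case False
    then have "s < t" using st by simp
    have "(f has_derivative (\<lambda>h. h * f' x)) (at x within {s..t})" if "s \<le> x" "x \<le> t" for x
      using has_vector_derivative_within_subset[OF f, of x "{s..t}"] that st
      by (auto simp: has_vector_derivative_def)
    from mvt_simple[OF \<open>s < t\<close> this] obtain z where "z \<in> {s<..<t}" "f t - f s = (t - s) * f' z" by auto
    then show ?thesis by (intro bexI[of _ z]) auto
  qed (use st in auto)
  have d1: "(\<phi> has_vector_derivative \<phi>' x) (at x within {0..b})"
    and d2: "(\<phi>' has_vector_derivative \<phi>'' x) (at x within {0..b})" if "x \<in> {0..b}" for x
    using C2 that by (auto simp: C2_with_derivs_def)
  have lip: "\<bar>\<phi>' t - \<phi>' s\<bar> \<le> K * \<bar>t - s\<bar>" if "0 \<le> s" "s \<le> b" "0 \<le> t" "t \<le> b" for s t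
  proof -
    have *: "\<bar>\<phi>' t - \<phi>' s\<bar> \<le> K * \<bar>t - s\<bar>" if st: "0 \<le> s" "s \<le> t" "t \<le> b" for s t
    proof -
      obtain z where z: "z \<in> {s..t}" "\<phi>' t - \<phi>' s = (t - s) * \<phi>'' z" using mv[OF d2 st] by blast
      have "\<bar>\<phi>'' z\<bar> \<le> K" using bd[of z] z that by auto
      then have "\<bar>t - s\<bar> * \<bar>\<phi>'' z\<bar> \<le> \<bar>t - s\<bar> * K" by (intro mult_left_mono) auto
      then show ?thesis unfolding z(2) abs_mult by (simp add: mult.commute)
    qed
    show ?thesis using *[of s t] *[of t s] that by (cases "s \<le> t") (auto simp: abs_minus_commute)
  qed
  have taylor: "\<bar>\<phi> t - \<phi> a - \<phi>' a * (t - a)\<bar> \<le> N / 2 * (t - a)\<^sup>2"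
    if at: "0 \<le> a" "a \<le> b" "0 \<le> t" "t \<le> b" for a t
  proof -
    have "\<exists>z. 0 \<le> z \<and> z \<le> b \<and> \<bar>z - a\<bar> \<le> \<bar>t - a\<bar> \<and> \<phi> t - \<phi> a = (t - a) * \<phi>' z"
    proof (cases "a \<le> t")
      case True
      then obtain z where "z \<in> {a..t}" "\<phi> t - \<phi> a = (t - a) * \<phi>' z" using mv[OF d1 at(1) True at(4)] by blast
      then show ?thesis using that by (intro exI[of _ z]) auto
    next
      case False
      then have "t \<le> a" by simp
      then obtain z where "z \<in> {t..a}" "\<phi> a - \<phi> t = (a - t) * \<phi>' z" using mv[OF d1 at(3) _ at(2)] by blast
      then show ?thesis using that by (intro exI[of _ z]) (auto simp: algebra_simps)
    qed
    then obtain z where z: "0 \<le> z" "z \<le> b" "\<bar>z - a\<bar> \<le> \<bar>t - a\<bar>" "\<phi> t - \<phi> a = (t - a) * \<phi>' z" by blast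
    have "\<phi> t - \<phi> a - \<phi>' a * (t - a) = (t - a) * (\<phi>' z - \<phi>' a)" unfolding z(4) by (simp add: algebra_simps)
    then have "\<bar>\<phi> t - \<phi> a - \<phi>' a * (t - a)\<bar> = \<bar>t - a\<bar> * \<bar>\<phi>' z - \<phi>' a\<bar>" by (simp add: abs_mult)
    also have "\<dots> \<le> \<bar>t - a\<bar> * (K * \<bar>t - a\<bar>)"
    proof (rule mult_left_mono)
      have "\<bar>\<phi>' z - \<phi>' a\<bar> \<le> K * \<bar>z - a\<bar>" using lip[of a z] z that by simp
      also have "\<dots> \<le> K * \<bar>t - a\<bar>" using z K by (intro mult_left_mono) auto
      finally show "\<bar>\<phi>' z - \<phi>' a\<bar> \<le> K * \<bar>t - a\<bar>" .
    qed simp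
    also have "\<dots> = K * (t - a)\<^sup>2" by (simp add: power2_eq_square abs_mult[symmetric])
    also have "\<dots> \<le> N / 2 * (t - a)\<^sup>2" using K by (intro mult_right_mono) auto
    finally show ?thesis .
  qed
  have "\<bar>\<phi>' a\<bar> \<le> N * a" if "0 \<le> a" "a \<le> b" for a
  proof -
    have "\<bar>\<phi>' a\<bar> \<le> K * a" using lip[of 0 a] that z K by simp
    also have "\<dots> \<le> N * a" using that K by (intro mult_right_mono) auto
    finally show ?thesis .
  qed
  then show ?thesis unfolding tangent_graph_def using z taylor R by auto
qed

lemma corner_scale_exists:
  assumes \<mu>: "0 < \<mu>" "\<mu> < 2" and N: "0 < N" and R0: "0 < R0"
  obtains R M \<epsilon> where "corner_scale \<mu> N R M \<epsilon>" "R \<le> R0"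
proof -
  define S where "S = sin (\<mu> * pi / 2)"
  have S: "S > 0" unfolding S_def using \<mu> by (intro sin_gt_zero) auto
  \<comment> \<open>The order is \<open>\<epsilon>\<close> from \<open>\<mu>\<close>, then
    \<open>R\<close> from \<open>N\<close> and \<open>\<epsilon>\<close>, then \<open>M\<close> from
    \<open>N\<close> and \<open>R\<close>. The case \<open>\<mu> = 1\<close> is separate because
    \<open>sin pi\<close> vanishes.\<close>
  define \<epsilon> where "\<epsilon> = (if \<mu> = 1 then S / 4 else min (S / 4) (\<bar>sin (\<mu> * pi)\<bar> / 2))"
  have "sin (\<mu> * pi) \<noteq> 0" if "\<mu> \<noteq> 1"
  proof -
    have d: "sin (\<mu> * pi) = 2 * S * cos (\<mu> * pi / 2)" using sin_double[of "\<mu> * pi / 2"] by (simp add: S_def)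
    have "cos (\<mu> * pi / 2) \<noteq> 0"
    proof (cases "\<mu> < 1")
      case True
      then show ?thesis using cos_gt_zero[of "\<mu> * pi / 2"] \<mu> by simp
    next
      case False
      then show ?thesis using cos_lt_zero_pi[of "\<mu> * pi / 2"] \<mu> that by simp
    qed
    then show ?thesis using d S by simp
  qed
  then have \<epsilon>: "\<epsilon> > 0" "\<epsilon> \<le> S / 4" "\<mu> \<noteq> 1 \<Longrightarrow> \<epsilon> \<le> \<bar>sin (\<mu> * pi)\<bar> / 2" using S by (auto simp: \<epsilon>_def)
  define R where "R = min R0 (\<epsilon> / N)"
  have R: "0 < R" "R \<le> R0" "N * R \<le> \<epsilon>"
    using N R0 \<epsilon> mult_left_mono[of R "\<epsilon> / N" N] by (auto simp: R_def)
  define M where "M = max (8 * N / S) (8 / (S * R))"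
  have M: "8 * N \<le> M * S" "8 \<le> M * S * R"
  proof -
    have "8 * N / S * S \<le> M * S" using S by (intro mult_right_mono) (auto simp: M_def)
    then show "8 * N \<le> M * S" using S by simp
    have "8 / (S * R) * (S * R) \<le> M * (S * R)" using S R by (intro mult_right_mono) (auto simp: M_def)
    then show "8 \<le> M * S * R" using S R by (simp add: mult.assoc)
  qed
  have "M > 0" using N S by (simp add: M_def less_max_iff_disj)
  then have "corner_scale \<mu> N R M \<epsilon>"
    unfolding corner_scale_def S_def[symmetric] using \<mu> N R \<epsilon> M by auto
  then show thesis using R(2) that by blast
qed

text \<open>All three sets contain 0, so their nearest points to \<open>x\<close> have modulus at
  most \<open>2 * cmod x\<close> and lie in the disc where the frontier is the union of the
  curves.\<close>

lemma infdist_frontier_eq_min: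
  fixes x :: complex
  assumes cl: "closed \<sigma>1" "closed \<sigma>2" and zero: "0 \<in> \<sigma>1" "0 \<in> \<sigma>2" and r0: "0 < r0"
    and fr: "frontier \<Omega> \<inter> ball 0 r0 = (\<sigma>1 \<union> \<sigma>2) \<inter> ball 0 r0" and x: "2 * cmod x < r0"
  shows "infdist x (frontier \<Omega>) = min (infdist x \<sigma>1) (infdist x \<sigma>2)"
proof (rule antisym)
  have "0 \<in> (\<sigma>1 \<union> \<sigma>2) \<inter> ball 0 r0" using zero r0 by simp
  then have z: "0 \<in> frontier \<Omega>" unfolding fr[symmetric] by blast
  obtain p where p: "p \<in> frontier \<Omega>" "infdist x (frontier \<Omega>) = cmod (x - p)" "cmod p \<le> 2 * cmod x"
    using obtain_foot[OF frontier_closed z] by metis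
  then have "p \<in> frontier \<Omega> \<inter> ball 0 r0" using x by simp
  then have "p \<in> \<sigma>1 \<union> \<sigma>2" unfolding fr by blast
  then show "min (infdist x \<sigma>1) (infdist x \<sigma>2) \<le> infdist x (frontier \<Omega>)"
    using infdist_le[of p \<sigma>1 x] infdist_le[of p \<sigma>2 x] p(2) by (auto simp: dist_norm min_le_iff_disj)
  have "infdist x (frontier \<Omega>) \<le> infdist x \<sigma>" if \<sigma>: "closed \<sigma>" "0 \<in> \<sigma>" "\<sigma> \<subseteq> \<sigma>1 \<union> \<sigma>2" for \<sigma>
  proof -
    obtain p where p: "p \<in> \<sigma>" "infdist x \<sigma> = cmod (x - p)" "cmod p \<le> 2 * cmod x"
      using obtain_foot[OF \<sigma>(1,2)] by metis
    then have "p \<in> (\<sigma>1 \<union> \<sigma>2) \<inter> ball 0 r0" using x \<sigma>(3) by auto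
    then have "p \<in> frontier \<Omega>" unfolding fr[symmetric] by blast
    then show ?thesis using infdist_le[of p "frontier \<Omega>" x] p(2) by (simp add: dist_norm)
  qed
  from this[OF cl(1) zero(1)] this[OF cl(2) zero(2)]
  show "infdist x (frontier \<Omega>) \<le> min (infdist x \<sigma>1) (infdist x \<sigma>2)" by simp
qed

lemma C2_arc_closed:
  assumes "C2_arc_from_origin \<sigma> \<alpha>"
  shows "closed \<sigma>" "0 \<in> \<sigma>"
proof -
  obtain \<gamma> where g: "arc \<gamma>" "path_image \<gamma> = \<sigma>" "pathstart \<gamma> = 0"
    using assms unfolding C2_arc_from_origin_def by blast
  show "closed \<sigma>" using closed_arc_image[OF g(1)] g(2) by simp
  show "0 \<in> \<sigma>" using pathstart_in_path_image[of \<gamma>] g by simp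
qed

lemma corner_domain_of_conic_singularity:
  assumes op: "open \<Omega>" and \<mu>: "0 < \<mu>" "\<mu> < 2" and cs: "conic_singularity \<Omega> \<sigma>1 \<sigma>2 \<alpha> \<mu> r0"
    and n1: "C2_norm_le \<sigma>1 \<alpha> N1" and n2: "C2_norm_le \<sigma>2 (\<alpha> + \<mu> * pi) N2"
    and N: "2 * N1 \<le> N" "2 * N2 \<le> N" and R: "0 < R" "R \<le> r0" "R \<le> 1 / N1" "R \<le> 1 / N2" "N * R \<le> 1"
  obtains \<phi>1 \<phi>1' \<phi>2 \<phi>2' where "corner_domain \<mu> N R ((\<lambda>z. z * cis \<alpha>) -` \<Omega>) ((\<lambda>z. z * cis \<alpha>) -` \<sigma>1) ((\<lambda>z. z * cis \<alpha>) -` \<sigma>2)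
    \<phi>1 \<phi>1' \<phi>2 \<phi>2'"
proof -
  let ?g = "\<lambda>z. z * cis \<alpha>"
  have arcs: "C2_arc_from_origin \<sigma>1 \<alpha>" "C2_arc_from_origin \<sigma>2 (\<alpha> + \<mu> * pi)"
    and fr: "frontier \<Omega> \<inter> ball 0 r0 = (\<sigma>1 \<union> \<sigma>2) \<inter> ball 0 r0"
    and sec: "\<And>\<epsilon>. \<epsilon> > 0 \<Longrightarrow> \<exists>\<rho>>0. sector \<alpha> \<epsilon> (\<mu> * pi - \<epsilon>) \<rho> \<subseteq> \<Omega> \<inter> ball 0 \<rho> \<and>
                 \<Omega> \<inter> ball 0 \<rho> \<subseteq> sector \<alpha> (- \<epsilon>) (\<mu> * pi + \<epsilon>) \<rho>"
    using cs by (auto simp: conic_singularity_def)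
  have cont: "continuous_on A ?g" for A by (intro continuous_intros)
  have ng: "cmod (?g z) = cmod z" for z by (simp add: norm_mult)
  have graph: "\<exists>\<phi> \<phi>'. tangent_graph \<phi> \<phi>' N R \<and>
      (\<forall>z\<in>?g -` \<sigma>. cmod z < R \<longrightarrow> (\<exists>t\<in>{0..R}. z = Complex t (\<phi> t) * cis (\<beta> - \<alpha>))) \<and>
      (\<forall>t\<in>{0..R / 2}. Complex t (\<phi> t) * cis (\<beta> - \<alpha>) \<in> ?g -` \<sigma>)"
    if norm: "C2_norm_le \<sigma> \<beta> K" and K: "2 * K \<le> N" "R \<le> 1 / K" for \<sigma> \<beta> K
  proof -
    obtain \<phi> \<phi>' \<phi>'' where K0: "K > 0" and C2: "C2_with_derivs (1/K) \<phi> \<phi>' \<phi>''" and z: "\<phi> 0 = 0" "\<phi>' 0 = 0"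
      and bd: "\<And>t. t \<in> {0..1/K} \<Longrightarrow> \<bar>\<phi>'' t\<bar> \<le> K"
      and eq: "\<sigma> \<inter> ball 0 (1/K) = (\<lambda>t. Complex t (\<phi> t) * cis \<beta>) ` {0..1/K} \<inter> ball 0 (1/K)"
      using norm unfolding C2_norm_le_def by blast
    have tg: "tangent_graph \<phi> \<phi>' N R"
      by (rule tangent_graph_of_C2[OF C2 z bd]) (use K0 K R in auto)
    have rot: "w * cis (\<beta> - \<alpha>) * cis \<alpha> = w * cis \<beta>" for w by (simp add: mult.assoc cis_mult)
    have "\<exists>t\<in>{0..R}. z = Complex t (\<phi> t) * cis (\<beta> - \<alpha>)" if z: "?g z \<in> \<sigma>" "cmod z < R" for z
    proof -
      have "?g z \<in> \<sigma> \<inter> ball 0 (1/K)" using z K ng[of z] by simp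
      then obtain t where t: "t \<in> {0..1/K}" "?g z = Complex t (\<phi> t) * cis \<beta>" unfolding eq by blast
      have "z * cis \<alpha> * cis (- \<alpha>) = Complex t (\<phi> t) * cis \<beta> * cis (- \<alpha>)" using t(2) by simp
      then have ze: "z = Complex t (\<phi> t) * cis (\<beta> - \<alpha>)" by (simp add: mult.assoc cis_mult)
      have "t \<le> cmod (Complex t (\<phi> t))" using complex_Re_le_cmod[of "Complex t (\<phi> t)"] by simp
      also have "\<dots> = cmod z" by (simp add: ze norm_mult)
      finally show ?thesis using ze t z by auto
    qed
    moreover have "?g (Complex t (\<phi> t) * cis (\<beta> - \<alpha>)) \<in> \<sigma>" if t: "0 \<le> t" "t \<le> R / 2" for t
    proof -
      \<comment> \<open>The height is at most \<open>t / 2\<close>, so for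
        \<open>t \<le> R / 2\<close> the graph point has modulus below \<open>R\<close>, inside the
        disc where it is known to belong to the curve.\<close>
      have "\<bar>\<phi> t\<bar> \<le> N / 2 * t\<^sup>2" using tangent_graphD(3)[OF tg, of t] t R by simp
      also have "\<dots> = N * t * (t / 2)" by (simp add: power2_eq_square)
      also have "\<dots> \<le> 1 * (t / 2)"
      proof (rule mult_right_mono)
        have "N * t \<le> N * R" using t R K K0 by (intro mult_left_mono) auto
        then show "N * t \<le> 1" using R by simp
      qed (use t in simp)
      finally have "cmod (Complex t (\<phi> t)) < R" using cmod_le[of "Complex t (\<phi> t)"] t R by auto
      then have "Complex t (\<phi> t) * cis \<beta> \<in> (\<lambda>t. Complex t (\<phi> t) * cis \<beta>) ` {0..1/K} \<inter> ball 0 (1/K)"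
        using t R K by (auto simp: norm_mult)
      then show ?thesis unfolding eq[symmetric] rot by blast
    qed
    ultimately show ?thesis using tg by auto
  qed
  obtain \<phi>1 \<phi>1' where g1: "tangent_graph \<phi>1 \<phi>1' N R"
    "\<forall>z\<in>?g -` \<sigma>1. cmod z < R \<longrightarrow> (\<exists>t\<in>{0..R}. z = Complex t (\<phi>1 t) * cis (\<alpha> - \<alpha>))"
    "\<forall>t\<in>{0..R / 2}. Complex t (\<phi>1 t) * cis (\<alpha> - \<alpha>) \<in> ?g -` \<sigma>1"
    using graph[OF n1 N(1) R(3)] by blast
  obtain \<phi>2 \<phi>2' where g2: "tangent_graph \<phi>2 \<phi>2' N R"
    "\<forall>z\<in>?g -` \<sigma>2. cmod z < R \<longrightarrow> (\<exists>t\<in>{0..R}. z = Complex t (\<phi>2 t) * cis (\<alpha> + \<mu> * pi - \<alpha>))"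
    "\<forall>t\<in>{0..R / 2}. Complex t (\<phi>2 t) * cis (\<alpha> + \<mu> * pi - \<alpha>) \<in> ?g -` \<sigma>2"
    using graph[OF n2 N(2) R(4)] by blast
  have cmu: "w * cis (\<alpha> + \<mu> * pi - \<alpha>) = cis (\<mu> * pi) * w" "w * cis (\<alpha> - \<alpha>) = w" for w by simp_all
  note g1 = g1[unfolded cmu] and g2 = g2[unfolded cmu]
  have "corner_domain \<mu> N R (?g -` \<Omega>) (?g -` \<sigma>1) (?g -` \<sigma>2) \<phi>1 \<phi>1' \<phi>2 \<phi>2'"
    unfolding corner_domain_def
  proof (intro conjI allI impI)
    show "tangent_graph \<phi>1 \<phi>1' N R" "tangent_graph \<phi>2 \<phi>2' N R" by fact+
    show "closed (?g -` \<sigma>1)" "closed (?g -` \<sigma>2)"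
      using C2_arc_closed(1)[OF arcs(1)] C2_arc_closed(1)[OF arcs(2)] closed_vimage[OF _ cont] by auto
    show "\<forall>z\<in>?g -` \<sigma>1. cmod z < R \<longrightarrow> (\<exists>t\<in>{0..R}. z = Complex t (\<phi>1 t))"
      "\<forall>z\<in>?g -` \<sigma>2. cmod z < R \<longrightarrow> (\<exists>t\<in>{0..R}. z = cis (\<mu> * pi) * Complex t (\<phi>2 t))"
      using g1(2) g2(2) .
    show "\<forall>t\<in>{0..R / 2}. Complex t (\<phi>1 t) \<in> ?g -` \<sigma>1 \<and> cis (\<mu> * pi) * Complex t (\<phi>2 t) \<in> ?g -` \<sigma>2"
      using g1(3) g2(3) by blast
    show "A \<subseteq> ?g -` \<Omega>" if A: "connected A" "A \<subseteq> ball 0 R" "A \<inter> (?g -` \<sigma>1 \<union> ?g -` \<sigma>2) = {}" "A \<inter> ?g -` \<Omega> \<noteq> {}" for A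
    proof -
      have "connected (?g ` A)" using A(1) by (intro connected_continuous_image cont)
      moreover have "?g ` A \<inter> \<Omega> \<noteq> {}" using A(4) by auto
      moreover have "?g ` A \<inter> frontier \<Omega> = {}"
      proof (rule ccontr)
        assume "?g ` A \<inter> frontier \<Omega> \<noteq> {}"
        then obtain z where z: "z \<in> A" "?g z \<in> frontier \<Omega>" by auto
        then have "?g z \<in> ball 0 r0" using A(2) R ng[of z] by auto
        then have "?g z \<in> \<sigma>1 \<union> \<sigma>2" using fr z by blast
        then show False using A(3) z by auto
      qed
      ultimately have "?g ` A - \<Omega> = {}" using connected_Int_frontier[of "?g ` A" \<Omega>] by blast
      then show ?thesis by auto
    qed
    show "\<forall>z\<in>?g -` \<Omega>. cmod z < R \<longrightarrow> z \<notin> ?g -` \<sigma>1 \<union> ?g -` \<sigma>2"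
    proof (intro ballI impI)
      fix z assume z: "z \<in> ?g -` \<Omega>" "cmod z < R"
      then have "?g z \<notin> frontier \<Omega>" using op by (simp add: frontier_def interior_open)
      moreover have "?g z \<in> ball 0 r0" using z R ng[of z] by simp
      ultimately show "z \<notin> ?g -` \<sigma>1 \<union> ?g -` \<sigma>2" using fr by blast
    qed
    show "\<exists>\<rho>>0. \<forall>s. 0 < s \<longrightarrow> s < \<rho> \<longrightarrow> of_real s * cis (\<mu> * pi / 2) \<in> ?g -` \<Omega> \<and> - (of_real s * cis (\<mu> * pi / 2)) \<notin> ?g -` \<Omega>"
    proof -
      \<comment> \<open>The first aperture places the bisector inside the inner sector. The second
        leaves the opposite ray outside the outer one, since its angle from the bisector is then
        below \<open>pi / 2 + \<mu> * pi / 4 < pi\<close>.\<close>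
      have "\<mu> * pi / 4 > 0" "(2 - \<mu>) * pi / 4 > 0" using \<mu> by simp_all
      from sec[OF this(1)] sec[OF this(2)] obtain \<rho>1 \<rho>2 where \<rho>: "\<rho>1 > 0" "\<rho>2 > 0"
        and i: "sector \<alpha> (\<mu> * pi / 4) (\<mu> * pi - \<mu> * pi / 4) \<rho>1 \<subseteq> \<Omega> \<inter> ball 0 \<rho>1"
        and o: "\<Omega> \<inter> ball 0 \<rho>2 \<subseteq> sector \<alpha> (- ((2 - \<mu>) * pi / 4)) (\<mu> * pi + (2 - \<mu>) * pi / 4) \<rho>2"
        by blast
      show ?thesis
      proof (intro exI[of _ "min \<rho>1 \<rho>2"] conjI allI impI)
        show "min \<rho>1 \<rho>2 > 0" using \<rho> by simp
        fix s assume s: "0 < s" "s < min \<rho>1 \<rho>2"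
        have "?g (of_real s * cis (\<mu> * pi / 2)) = rcis s (\<alpha> + \<mu> * pi / 2)"
          by (simp add: rcis_def mult.assoc cis_mult add.commute)
        moreover have "rcis s (\<alpha> + \<mu> * pi / 2) \<in> sector \<alpha> (\<mu> * pi / 4) (\<mu> * pi - \<mu> * pi / 4) \<rho>1"
          unfolding sector_def using s \<mu> by (intro CollectI exI[of _ s] exI[of _ "\<mu> * pi / 2"]) auto
        ultimately show "of_real s * cis (\<mu> * pi / 2) \<in> ?g -` \<Omega>" using i by auto
        show "- (of_real s * cis (\<mu> * pi / 2)) \<notin> ?g -` \<Omega>"
        proof
          assume "- (of_real s * cis (\<mu> * pi / 2)) \<in> ?g -` \<Omega>"
          then have "?g (- (of_real s * cis (\<mu> * pi / 2))) \<in> \<Omega> \<inter> ball 0 \<rho>2"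
            using s ng[of "- (of_real s * cis (\<mu> * pi / 2))"] by (simp add: norm_mult)
          then obtain r \<theta> where r: "0 < r" and th: "- ((2 - \<mu>) * pi / 4) < \<theta>" "\<theta> < \<mu> * pi + (2 - \<mu>) * pi / 4"
            and eq: "?g (- (of_real s * cis (\<mu> * pi / 2))) = rcis r (\<alpha> + \<theta>)"
            using o unfolding sector_def by blast
          have "cmod (?g (- (of_real s * cis (\<mu> * pi / 2)))) = s" using s by (simp add: norm_mult)
          moreover have "cmod (rcis r (\<alpha> + \<theta>)) = r" using r by simp
          ultimately have rs: "r = s" unfolding eq by linarith
          define y where "y = \<theta> - \<mu> * pi / 2"
          have "rcis s (\<alpha> + \<theta>) = of_real s * (cis (\<mu> * pi / 2) * cis \<alpha>) * cis y"
            by (simp add: rcis_def cis_mult y_def mult.assoc add.commute)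
          then have "- (of_real s * (cis (\<mu> * pi / 2) * cis \<alpha>)) = of_real s * (cis (\<mu> * pi / 2) * cis \<alpha>) * cis y"
            using eq rs by (simp add: mult.assoc)
          moreover have "w * (cis y + 1) = 0" if "- w = w * cis y" for w
            by (simp only: distrib_left that[symmetric] mult_1_right) simp
          ultimately have "of_real s * (cis (\<mu> * pi / 2) * cis \<alpha>) * (cis y + 1) = 0" by blast
          then have "cis y + 1 = 0" using s by simp
          then have "cos y = - 1" by (simp add: complex_eq_iff add_eq_0_iff)
          moreover have "cos \<bar>y\<bar> > cos pi"
          proof (rule cos_monotone_0_pi)
            have "\<mu> * pi < 2 * pi" using \<mu> by simp
            moreover have "(2 - \<mu>) * pi / 4 = pi / 2 - \<mu> * pi / 4" by (simp add: field_simps)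
            ultimately show "\<bar>y\<bar> < pi" using th unfolding y_def abs_less_iff by linarith
          qed simp_all
          ultimately show False by simp
        qed
      qed
    qed
  qed
  then show thesis by (rule that)
qed

theorem theorem1p1:
  fixes \<mu> r\<^sub>0 N\<^sub>1 N\<^sub>2 :: real
  assumes "0 < \<mu>" and "\<mu> < 2" and "0 < r\<^sub>0"
  shows "\<exists>\<delta>>0. \<exists>C>0. \<forall>(\<Omega> :: complex set) \<sigma>\<^sub>1 \<sigma>\<^sub>2 \<alpha> u.
           open \<Omega> \<and> connected \<Omega> \<and> \<Omega> \<noteq> {} \<and> bounded \<Omega> \<and>
           conic_singularity \<Omega> \<sigma>\<^sub>1 \<sigma>\<^sub>2 \<alpha> \<mu> r\<^sub>0 \<and>
           C2_norm_le \<sigma>\<^sub>1 \<alpha> N\<^sub>1 \<and> C2_norm_le \<sigma>\<^sub>2 (\<alpha> + \<mu> * pi) N\<^sub>2 \<and>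
           C2_on u \<Omega> \<and> (\<forall>x\<in>\<Omega>. laplacian u x = exp (2 * u x)) \<and>
           (\<forall>z\<in>frontier \<Omega>. filterlim u at_top (at z within \<Omega>)) \<longrightarrow>
           (\<forall>x\<in>\<Omega> \<inter> ball 0 \<delta>.
              \<bar>u x - f_corner \<Omega> \<sigma>\<^sub>1 \<sigma>\<^sub>2 \<alpha> \<mu> x\<bar> \<le> C * infdist x (frontier \<Omega>))"
proof (cases "0 < N\<^sub>1 \<and> 0 < N\<^sub>2")
  case False
  \<comment> \<open>\<open>C2_norm_le\<close> includes positivity of its bound, so the premises are
    contradictory and any constants serve.\<close>
  then show ?thesis by (intro exI[of _ 1] conjI) (auto simp: C2_norm_le_def)
next
  case True
  note \<mu> = assms(1,2)
  define N where "N = 2 * max N\<^sub>1 N\<^sub>2"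
  define R0 where "R0 = min r\<^sub>0 (min (1 / N\<^sub>1) (1 / N\<^sub>2))"
  have N: "0 < N" "2 * N\<^sub>1 \<le> N" "2 * N\<^sub>2 \<le> N" and R0: "0 < R0" using True assms(3) by (auto simp: N_def R0_def)
  obtain R M \<epsilon> where sc: "corner_scale \<mu> N R M \<epsilon>" and RR0: "R \<le> R0"
    using corner_scale_exists[OF \<mu> N(1) R0] by metis
  have "sin (\<mu> * pi / 2) \<le> 1" "N * R \<le> \<epsilon>" "\<epsilon> \<le> sin (\<mu> * pi / 2) / 4" "0 < \<epsilon>"
    using sc by (auto simp: corner_scale_def)
  then have "N * R \<le> 1" by linarith
  then have R: "0 < R" "R \<le> r\<^sub>0" "R \<le> 1 / N\<^sub>1" "R \<le> 1 / N\<^sub>2" "N * R \<le> 1"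
    using sc RR0 by (auto simp: corner_scale_def R0_def)
  obtain \<delta> C where \<delta>: "\<delta> > 0" and C: "C > 0" and
    br: "\<And>\<Omega> \<sigma>1 \<sigma>2 \<phi>1 \<phi>1' \<phi>2 \<phi>2' x. corner_domain \<mu> N R \<Omega> \<sigma>1 \<sigma>2 \<phi>1 \<phi>1' \<phi>2 \<phi>2' \<Longrightarrow> x \<in> \<Omega> \<Longrightarrow> cmod x < \<delta> \<Longrightarrow>
      bracketed \<mu> \<Omega> x (corner_profile \<mu> x (infdist x \<sigma>1) (infdist x \<sigma>2)) (C * min (infdist x \<sigma>1) (infdist x \<sigma>2))"
    using bracketed_corner_profile[OF sc] by metis
  \<comment> \<open>The bound \<open>r\<^sub>0 / 2\<close> lets the distance to the frontier be
    computed from the two curves.\<close>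
  define \<delta>' where "\<delta>' = min \<delta> (r\<^sub>0 / 2)"
  have \<delta>': "\<delta>' > 0" using \<delta> assms(3) by (simp add: \<delta>'_def)
  show ?thesis
  proof (rule exI[of _ \<delta>'], rule conjI[OF \<delta>'], rule exI[of _ C], rule conjI[OF C],
      intro allI impI ballI, elim conjE)
    fix \<Omega> :: "complex set" and \<sigma>1 \<sigma>2 \<alpha> u x
    assume \<Omega>: "open \<Omega>" "bounded \<Omega>" and cs: "conic_singularity \<Omega> \<sigma>1 \<sigma>2 \<alpha> \<mu> r\<^sub>0"
      and n1: "C2_norm_le \<sigma>1 \<alpha> N\<^sub>1" and n2: "C2_norm_le \<sigma>2 (\<alpha> + \<mu> * pi) N\<^sub>2"
      and u: "C2_on u \<Omega>" "\<forall>x\<in>\<Omega>. laplacian u x = exp (2 * u x)"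
        "\<forall>z\<in>frontier \<Omega>. filterlim u at_top (at z within \<Omega>)"
      and x: "x \<in> \<Omega> \<inter> ball 0 \<delta>'"
    let ?g = "\<lambda>z. z * cis \<alpha>"
    define y where "y = x * cis (- \<alpha>)"
    have gy: "?g y = x" and ny: "cmod y = cmod x" by (simp_all add: y_def mult.assoc cis_mult norm_mult)
    obtain \<phi>1 \<phi>1' \<phi>2 \<phi>2' where cd: "corner_domain \<mu> N R (?g -` \<Omega>) (?g -` \<sigma>1) (?g -` \<sigma>2) \<phi>1 \<phi>1' \<phi>2 \<phi>2'"
      using corner_domain_of_conic_singularity[OF \<Omega>(1) \<mu> cs n1 n2 N(2,3) R] by metis
    have "surj ?g" by (rule surjI[of _ "\<lambda>z. z * cis (- \<alpha>)"]) (simp add: mult.assoc cis_mult)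
    moreover have "dist (?g a) (?g b) = dist a b" for a b
      by (simp add: dist_norm left_diff_distrib[symmetric] norm_mult)
    ultimately have inf: "infdist y (?g -` A) = infdist x A" for A
      using infdist_vimage_isometry[of ?g y A] gy by simp
    have arcs: "C2_arc_from_origin \<sigma>1 \<alpha>" "C2_arc_from_origin \<sigma>2 (\<alpha> + \<mu> * pi)"
      and fr: "frontier \<Omega> \<inter> ball 0 r\<^sub>0 = (\<sigma>1 \<union> \<sigma>2) \<inter> ball 0 r\<^sub>0"
      using cs by (auto simp: conic_singularity_def)
    have d: "infdist x (frontier \<Omega>) = min (infdist x \<sigma>1) (infdist x \<sigma>2)"
      by (rule infdist_frontier_eq_min[OF C2_arc_closed(1)[OF arcs(1)] C2_arc_closed(1)[OF arcs(2)]
            C2_arc_closed(2)[OF arcs(1)] C2_arc_closed(2)[OF arcs(2)] assms(3) fr])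
        (use x in \<open>simp add: \<delta>'_def\<close>)
    have "bracketed \<mu> (?g -` \<Omega>) y (corner_profile \<mu> y (infdist x \<sigma>1) (infdist x \<sigma>2)) (C * infdist x (frontier \<Omega>))"
      using br[OF cd, of y] x gy ny unfolding inf d by (simp add: \<delta>'_def)
    moreover have "corner_profile \<mu> y (infdist x \<sigma>1) (infdist x \<sigma>2) = f_corner \<Omega> \<sigma>1 \<sigma>2 \<alpha> \<mu> x"
      unfolding corner_profile_def f_corner_def Let_def d ny y_def[symmetric] ..
    ultimately have b: "bracketed \<mu> \<Omega> x (f_corner \<Omega> \<sigma>1 \<sigma>2 \<alpha> \<mu> x) (C * infdist x (frontier \<Omega>))"
      unfolding y_def by (metis bracketed_rotation)
    obtain q b \<kappa> where 1: "cmod b = 1" "\<kappa> > 0" "lens \<mu> q b \<kappa> \<subseteq> \<Omega>" "x \<in> lens \<mu> q b \<kappa>"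
      "\<bar>lens_sol \<mu> q b \<kappa> x - f_corner \<Omega> \<sigma>1 \<sigma>2 \<alpha> \<mu> x\<bar> \<le> C * infdist x (frontier \<Omega>)"
      using b unfolding bracketed_def by blast
    have "u x \<le> lens_sol \<mu> q b \<kappa> x"
      by (rule solution_le_lens_sol[OF \<mu> 1(1,2) \<Omega>(1) u(1) _ 1(3,4)]) (use u(2) in blast)
    moreover obtain q' b' \<kappa>' where 2: "cmod b' = 1" "\<kappa>' < 0" "\<forall>z\<in>\<Omega>.
      cos (\<mu> * pi / 2) * \<bar>Im (lens_map q' b' \<kappa>' z)\<bar> \<le> sin (\<mu> * pi / 2) * Re (lens_map q' b' \<kappa>' z)"
      "x \<in> lens \<mu> q' b' \<kappa>'"
      "\<bar>lens_sol \<mu> q' b' \<kappa>' x - f_corner \<Omega> \<sigma>1 \<sigma>2 \<alpha> \<mu> x\<bar> \<le> C * infdist x (frontier \<Omega>)"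
      using b unfolding bracketed_def by blast
    have "lens_sol \<mu> q' b' \<kappa>' x \<le> u x"
      by (rule lens_sol_le_solution[OF \<mu> 2(1,2) \<Omega> u(1) _ _ _ 2(4)]) (use u(2,3) 2(3) x in auto)
    ultimately show "\<bar>u x - f_corner \<Omega> \<sigma>1 \<sigma>2 \<alpha> \<mu> x\<bar> \<le> C * infdist x (frontier \<Omega>)"
      using 1(5) 2(5) by linarith
  qed
qed

end
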